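(* Assume the Continuum Hypothesis. For each of the following items there exists an almost disjoint family $\mathcal{A}$ (a possibly different one for each item) for which $\Phi(\mathcal{A})$ is a Hausdorff compact and separable space of cardinality $\mathfrak{c}$ such that: (1) $\Phi(\mathcal{A})$ is a Ramsey space that is not a Hindman space; (2) $\Phi(\mathcal{A})$ is a Hindman space that is not a Ramsey space; (3) $\Phi(\mathcal{A})$ is a differentially compact space that is not a Hindman space; (4) $\Phi(\mathcal{A})$ is a differentially compact space that is not a Ramsey space.
   Context: $\omega=\{0,1,2,\dots\}$. For infinite $D\subseteq\omega$: $\mathrm{FS}(D)$ is the set of all sums of nonempty finite sets of distinct elements of $D$; $[D]^2$ is the set of unordered pairs of distinct elements of $D$; $\Delta(D)=\{a-b:a,b\in D,\ a>b\}$. A topological space $X$ is a Hindman space if for every $f:\omega\to X$ there are an infinite $D\subseteq\omega$ and $x\in X$ such that for every neighbourhood $U$ of $x$ there is a finite $K\subseteq\omega$ with $f[\mathrm{FS}(D\setminus K)]\subseteq U$. $X$ is a Ramsey space if for every $f:[\omega]^2\to X$ there are an infinite $D\subseteq\omega$ and $x\in X$ such that for every neighbourhood $U$ of $x$ there is a finite $K\subseteq\omega$ with $f[[D\setminus K]^2]\subseteq U$. $X$ is a differentially compact space if for every $f:\omega\to X$ there are an infinite $D\subseteq\omega$ and $x\in X$ such that for every neighbourhood $U$ of $x$ there is a finite $K\subseteq\omega$ with $f[\Delta(D\setminus K)]\subseteq U$. An almost disjoint family on a countably infinite set $\Lambda$ is a family $\mathcal{A}$ of infinite subsets of $\Lambda$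 with $A\cap B$ finite for distinct $A,B\in\mathcal{A}$. For infinite such $\mathcal{A}$, $\Psi(\mathcal{A})=\Lambda\cup\mathcal{A}$ is the space in which points of $\Lambda$ are isolated and basic neighbourhoods of $A\in\mathcal{A}$ are $\{A\}\cup(A\setminus F)$ with $F$ finite; $\Phi(\mathcal{A})=\Psi(\mathcal{A})\cup\{\infty\}$ is its Alexandroff one-point compactification. *)

theory Defs
  imports "HOL-Analysis.Analysis" "HOL-Library.Ramsey" "HOL-Library.Equipollence"
begin

definition continuum_hypothesis :: bool where
  "continuum_hypothesis \<longleftrightarrow> (\<forall>S :: real set. countable S \<or> S \<approx> (UNIV :: real set))"

definition FS :: "nat set \<Rightarrow> nat set" where
  "FS D = {(\<Sum>n\<in>F. n) | F. F \<subseteq> D \<and> finite F \<and> F \<noteq> {}}"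

definition Delta :: "nat set \<Rightarrow> nat set" where
  "Delta D = {a - b | a b. a \<in> D \<and> b \<in> D \<and> a > b}"

definition Hindman_space :: "'a topology \<Rightarrow> bool" where
  "Hindman_space X \<longleftrightarrow>
    (\<forall>f :: nat \<Rightarrow> 'a. range f \<subseteq> topspace X \<longrightarrow>
      (\<exists>D x. infinite D \<and> x \<in> topspace X \<and>
        (\<forall>U. openin X U \<and> x \<in> U \<longrightarrow> (\<exists>K. finite K \<and> f ` FS (D - K) \<subseteq> U))))"

text \<open>A function on \<open>[\<omega>]\<^sup>2\<close> is a function on \<^typ>\<open>nat set\<close> whose values outside
  the two-element sets are irrelevant.\<close>

definition Ramsey_space :: "'a topology \<Rightarrow> bool" where
  "Ramsey_space X \<longleftrightarrow>
    (\<forall>f :: nat set \<Rightarrow> 'a. f ` nsets UNIV 2 \<subseteq> topspace X \<longrightarrow>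
      (\<exists>D x. infinite D \<and> x \<in> topspace X \<and>
        (\<forall>U. openin X U \<and> x \<in> U \<longrightarrow> (\<exists>K. finite K \<and> f ` nsets (D - K) 2 \<subseteq> U))))"

definition differentially_compact_space :: "'a topology \<Rightarrow> bool" where
  "differentially_compact_space X \<longleftrightarrow>
    (\<forall>f :: nat \<Rightarrow> 'a. range f \<subseteq> topspace X \<longrightarrow>
      (\<exists>D x. infinite D \<and> x \<in> topspace X \<and>
        (\<forall>U. openin X U \<and> x \<in> U \<longrightarrow> (\<exists>K. finite K \<and> f ` Delta (D - K) \<subseteq> U))))"

definition almost_disjoint_family :: "'a set \<Rightarrow> 'a set set \<Rightarrow> bool" where
  "almost_disjoint_family \<Lambda> \<A> \<longleftrightarrow>
    countable \<Lambda> \<and> infinite \<Lambda> \<and>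
    (\<forall>A\<in>\<A>. A \<subseteq> \<Lambda> \<and> infinite A) \<and>
    (\<forall>A\<in>\<A>. \<forall>B\<in>\<A>. A \<noteq> B \<longrightarrow> finite (A \<inter> B))"

text \<open>The point set \<open>\<Lambda> \<union> \<A>\<close> is rendered as a tagged disjoint union.\<close>

definition Psi_space :: "'a set \<Rightarrow> 'a set set \<Rightarrow> ('a + 'a set) topology" where
  "Psi_space \<Lambda> \<A> = topology_generated_by
     ({{Inl n} | n. n \<in> \<Lambda>} \<union>
      {insert (Inr A) (Inl ` (A - F)) | A F. A \<in> \<A> \<and> finite F})"

definition Phi_space :: "'a set \<Rightarrow> 'a set set \<Rightarrow> ('a + 'a set) option topology" where
  "Phi_space \<Lambda> \<A> = Alexandroff_compactification (Psi_space \<Lambda> \<A>)"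

lemma topspace_Psi_space:
  assumes "almost_disjoint_family \<Lambda> \<A>"
  shows "topspace (Psi_space \<Lambda> \<A>) = Inl ` \<Lambda> \<union> Inr ` \<A>"
proof -
  have sub: "A \<subseteq> \<Lambda>" if "A \<in> \<A>" for A
    using assms that by (auto simp: almost_disjoint_family_def)
  have aux: "X = a \<Longrightarrow> Y \<subseteq> a \<union> b \<Longrightarrow> b \<subseteq> Y \<Longrightarrow> X \<union> Y = a \<union> b" for X Y a b :: "('a + 'a set) set"
    by blast
  have "(\<Union>{{Inl n} | n. n \<in> \<Lambda>} :: ('a + 'a set) set) = Inl ` \<Lambda>"
    by auto
  moreover have "\<Union>{insert (Inr A) (Inl ` (A - F)) | A F. A \<in> \<A> \<and> finite F}
      \<subseteq> Inl ` \<Lambda> \<union> Inr ` \<A>"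
    using sub by (intro Union_least) auto
  moreover have "Inr ` \<A> \<subseteq> \<Union>{insert (Inr A) (Inl ` (A - F)) | A F. A \<in> \<A> \<and> finite F}"
  proof (rule image_subsetI)
    fix A assume "A \<in> \<A>"
    then have "insert (Inr A) (Inl ` (A - {})) \<in>
        {insert (Inr A) (Inl ` (A - F)) | A F. A \<in> \<A> \<and> finite F}"
      by (intro CollectI exI[of _ A] exI[of _ "{}"]) simp
    then show "Inr A \<in> \<Union>{insert (Inr A) (Inl ` (A - F)) | A F. A \<in> \<A> \<and> finite F}"
      by (rule UnionI) simp
  qed
  ultimately show ?thesis
    unfolding Psi_space_def topology_generated_by_topspace Union_Un_distrib by (rule aux)
qed

lemma openin_Psi_space:
  assumes "almost_disjoint_family \<Lambda> \<A>"
  shows "openin (Psi_space \<Lambda> \<A>) U \<longleftrightarrow>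
    U \<subseteq> Inl ` \<Lambda> \<union> Inr ` \<A> \<and>
    (\<forall>A\<in>\<A>. Inr A \<in> U \<longrightarrow> (\<exists>F. finite F \<and> Inl ` (A - F) \<subseteq> U))" (is "?L \<longleftrightarrow> ?R")
proof
  assume L: ?L
  define B where "B = {{Inl n} | n. n \<in> \<Lambda>} \<union> {insert (Inr A) (Inl ` (A - F)) | A F. A \<in> \<A> \<and> finite F}"
  have "generate_topology_on B U"
    using L unfolding Psi_space_def B_def[symmetric] by (rule openin_topology_generated_by)
  then have "\<forall>A\<in>\<A>. Inr A \<in> U \<longrightarrow> (\<exists>F. finite F \<and> Inl ` (A - F) \<subseteq> U)"
  proof (induction rule: generate_topology_on.induct)
    case (Int a b)
    show ?case
    proof (intro ballI impI)
      fix A assume "A \<in> \<A>" "Inr A \<in> a \<inter> b"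
      then have A: "A \<in> \<A>" "Inr A \<in> a" "Inr A \<in> b" by simp_all
      obtain F where F: "finite F" "Inl ` (A - F) \<subseteq> a"
        using Int.IH(1)[rule_format, OF A(1,2)] by (elim exE conjE)
      obtain G where G: "finite G" "Inl ` (A - G) \<subseteq> b"
        using Int.IH(2)[rule_format, OF A(1,3)] by (elim exE conjE)
      have "finite (F \<union> G) \<and> Inl ` (A - (F \<union> G)) \<subseteq> a \<inter> b"
        using F G by (auto simp: image_subset_iff)
      then show "\<exists>F. finite F \<and> Inl ` (A - F) \<subseteq> a \<inter> b" by (rule exI)
    qed
  next
    case (UN K)
    show ?case
    proof (intro ballI impI)
      fix A assume A: "A \<in> \<A>" "Inr A \<in> \<Union>K"
      then obtain k where k: "k \<in> K" "Inr A \<in> k" by blast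
      obtain F where F: "finite F" "Inl ` (A - F) \<subseteq> k"
        using UN.IH[OF k(1), rule_format, OF A(1) k(2)] by (elim exE conjE)
      have "Inl ` (A - F) \<subseteq> \<Union>K" using F(2) Union_upper[OF k(1)] by (rule subset_trans)
      with F(1) show "\<exists>F. finite F \<and> Inl ` (A - F) \<subseteq> \<Union>K" by (intro exI conjI)
    qed
  next
    case (Basis s)
    then consider n where "s = {Inl n}"
      | A F where "s = insert (Inr A) (Inl ` (A - F))" "finite F"
      unfolding B_def by blast
    then show ?case by cases auto
  qed simp
  then show ?R using openin_subset[OF L] topspace_Psi_space[OF assms] by simp
next
  assume R: ?R
  show ?L
  proof (subst openin_subopen, intro ballI)
    fix x assume x: "x \<in> U"
    show "\<exists>T. openin (Psi_space \<Lambda> \<A>) T \<and> x \<in> T \<and> T \<subseteq> U"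
    proof (cases x)
      case (Inl n)
      then have "openin (Psi_space \<Lambda> \<A>) {Inl n}"
        unfolding Psi_space_def using R x by (intro topology_generated_by_Basis) auto
      then show ?thesis using Inl x by blast
    next
      case (Inr A)
      then have A: "A \<in> \<A>" using R x by auto
      then obtain F where F: "finite F" "Inl ` (A - F) \<subseteq> U"
        using R x Inr by metis
      have "openin (Psi_space \<Lambda> \<A>) (insert (Inr A) (Inl ` (A - F)))"
        unfolding Psi_space_def using A F by (intro topology_generated_by_Basis) auto
      moreover have "insert (Inr A) (Inl ` (A - F)) \<subseteq> U" using Inr x F(2) by simp
      ultimately show ?thesis using Inr by (intro exI[of _ "insert (Inr A) (Inl ` (A - F))"]) simp
    qed
  qed
qed

end

theory Submission
  imports Defs
begin

text \<open>
  A Ramsey space is differentially compact (colour a pair by its difference), and so is a Hindman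
  space (pass to partial sums), so (3) and (4) follow from (1) and (2).

  For (1) and (2) let \<open>\<rho>\<close> and \<open>\<sigma>\<close> be the two operations \<open>D \<mapsto> FS D\<close> and \<open>D \<mapsto> [D]\<^sup>2\<close>, in either
  order, and call a set negligible if it contains no \<open>\<sigma> E\<close> with \<open>E\<close> infinite. Under CH there is an
  enumeration in type \<open>\<omega>\<^sub>1\<close> of all functions \<open>f\<close> to be handled and all sets \<open>E\<close>. At each stage a
  set \<open>D\<close> is chosen such that \<open>f\<close> on \<open>\<rho> D\<close> is eventually constant, eventually in one of
  the members constructed so far, or eventually outside each of them, and such that \<open>f ` \<rho> D\<close> is
  negligible. The new member is a sparse set which meets \<open>\<sigma> (E - K)\<close> for all finite \<open>K\<close> and
  is almost disjoint from all earlier members and from all the negligible images; so in the third case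
  \<open>f\<close> still converges to the point at infinity of the final space. The members are negligible,
  hence the inclusion of \<open>\<omega>\<close> has no \<open>\<sigma>\<close>-convergent restriction.

  The combinatorial core is that \<open>D\<close> with \<open>f ` \<rho> D\<close> negligible exists. It is built
  along an idempotent ultrafilter, by a case distinction on the behaviour of \<open>f\<close> modulo the
  ultrafilter.
\<close>

section \<open>Idempotent ultrafilters\<close>

text \<open>Later members have to be almost disjoint from the image of \<open>\<rho> D\<close>, so
  that the limit at infinity survives, while the member of a stage belonging to \<open>E\<close>
  must meet all \<open>\<sigma> (E - K)\<close>. These demands clash as soon as the image contains
  some \<open>\<sigma> E\<close>; this is where negligibility comes from. CH leaves countably many
  predecessors to each stage, so one diagonal sequence meets all demands: each of its terms avoids
  finitely many negligible sets, and that these do not cover \<open>\<sigma> E\<close> is the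
  theorem of Hindman or of Ramsey.

  The set \<open>D\<close> is chosen term by term, and which values are harmful depends on the terms
  already chosen. The constraints therefore form a strategy \<open>W\<close>, sending the finite set
  of chosen terms to a set in the ultrafilter \<open>p\<close>. The case distinctions rest on one
  dichotomy: a function is constant on a set of \<open>p\<close> or tends to infinity along
  \<open>p\<close>.\<close>

definition proper_filter :: "'a set set \<Rightarrow> bool" where
  "proper_filter F \<longleftrightarrow> UNIV \<in> F \<and> {} \<notin> F \<and> (\<forall>A\<in>F. \<forall>B\<in>F. A \<inter> B \<in> F) \<and>
    (\<forall>A\<in>F. \<forall>B. A \<subseteq> B \<longrightarrow> B \<in> F)"

definition ultrafilter :: "'a set set \<Rightarrow> bool" where
  "ultrafilter p \<longleftrightarrow> proper_filter p \<and> (\<forall>A. A \<in> p \<or> - A \<in> p)"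

lemma proper_filterI:
  assumes "UNIV \<in> F" "{} \<notin> F" "\<And>A B. A \<in> F \<Longrightarrow> B \<in> F \<Longrightarrow> A \<inter> B \<in> F"
    "\<And>A B. A \<in> F \<Longrightarrow> A \<subseteq> B \<Longrightarrow> B \<in> F"
  shows "proper_filter F"
  using assms unfolding proper_filter_def by simp

lemma proper_filter_mono: "proper_filter F \<Longrightarrow> A \<in> F \<Longrightarrow> A \<subseteq> B \<Longrightarrow> B \<in> F"
  unfolding proper_filter_def by blast

lemma proper_filter_Int: "proper_filter F \<Longrightarrow> A \<in> F \<Longrightarrow> B \<in> F \<Longrightarrow> A \<inter> B \<in> F"
  unfolding proper_filter_def by blast

lemma proper_filter_Union_chain:
  assumes "subset.chain \<F> C" "C \<noteq> {}" "\<And>F. F \<in> \<F> \<Longrightarrow> proper_filter F"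
  shows "proper_filter (\<Union>C)"
proof -
  have pf: "proper_filter F" if "F \<in> C" for F
    using assms(1,3) that unfolding subset.chain_def by blast
  have "A \<inter> B \<in> \<Union>C" if "A \<in> F" "F \<in> C" "B \<in> G" "G \<in> C" for A B F G
  proof -
    have "F \<subseteq> G \<or> G \<subseteq> F"
      using assms(1) that unfolding subset_chain_def by blast
    then show ?thesis
      using that proper_filter_Int[OF pf[OF \<open>F \<in> C\<close>], of A B]
        proper_filter_Int[OF pf[OF \<open>G \<in> C\<close>], of A B] by blast
  qed
  moreover have "B \<in> \<Union>C" if "A \<in> F" "F \<in> C" "A \<subseteq> B" for A B F
    using that proper_filter_mono[OF pf[OF \<open>F \<in> C\<close>], of A B] by blast
  moreover have "UNIV \<in> F \<and> {} \<notin> F" if "F \<in> C" for F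
    using pf[OF that] unfolding proper_filter_def by simp
  ultimately show ?thesis
    using assms(2) unfolding proper_filter_def by (auto; metis)
qed

text \<open>The last clause says that the sets \<open>X \<inter> A\<close> form a base of
  \<open>H\<close>; it allows properties of \<open>H\<close> to be checked on \<open>F\<close> and
  \<open>G\<close> separately.\<close>

lemma proper_filter_adjoin:
  assumes F: "proper_filter F"
    and G: "UNIV \<in> G" "\<And>A B. A \<in> G \<Longrightarrow> B \<in> G \<Longrightarrow> A \<inter> B \<in> G"
    and meets: "\<And>X A. X \<in> F \<Longrightarrow> A \<in> G \<Longrightarrow> X \<inter> A \<noteq> {}"
  obtains H where "proper_filter H" "F \<subseteq> H" "G \<subseteq> H" "\<forall>Y\<in>H. \<exists>X\<in>F. \<exists>A\<in>G. X \<inter> A \<subseteq> Y"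
proof
  let ?H = "{Y. \<exists>X\<in>F. \<exists>A\<in>G. X \<inter> A \<subseteq> Y}"
  show "F \<subseteq> ?H" using G(1) by blast
  show "G \<subseteq> ?H" using F unfolding proper_filter_def by blast
  show "\<forall>Y\<in>?H. \<exists>X\<in>F. \<exists>A\<in>G. X \<inter> A \<subseteq> Y" by blast
  show "proper_filter ?H"
  proof (rule proper_filterI)
    show "UNIV \<in> ?H" using \<open>G \<subseteq> ?H\<close> G(1) by blast
    show "{} \<notin> ?H" using meets by blast
    show "Z \<in> ?H" if "Y \<in> ?H" "Y \<subseteq> Z" for Y Z
      using that by (blast intro: subset_trans)
    show "Y \<inter> Z \<in> ?H" if Y: "Y \<in> ?H" and Z: "Z \<in> ?H" for Y Z
    proof -
      obtain X A X' A' where *: "X \<in> F" "A \<in> G" "X \<inter> A \<subseteq> Y" "X' \<in> F" "A' \<in> G" "X' \<inter> A' \<subseteq> Z"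
        using Y Z by blast
      have "X \<inter> X' \<in> F" "A \<inter> A' \<in> G" using * G(2) proper_filter_Int[OF F] by auto
      moreover have "(X \<inter> X') \<inter> (A \<inter> A') \<subseteq> Y \<inter> Z" using * by blast
      ultimately show ?thesis by blast
    qed
  qed
qed

lemma ultrafilter_extends:
  assumes "proper_filter F"
  obtains p where "ultrafilter p" "F \<subseteq> p"
proof -
  let ?Z = "{G. proper_filter G \<and> F \<subseteq> G}"
  have "\<exists>M\<in>?Z. \<forall>X\<in>?Z. M \<subseteq> X \<longrightarrow> X = M"
  proof (rule subset_Zorn_nonempty)
    show "?Z \<noteq> {}" using assms by blast
    show "\<Union>C \<in> ?Z" if "C \<noteq> {}" "subset.chain ?Z C" for C
    proof -
      have "proper_filter (\<Union>C)"
        using proper_filter_Union_chain[OF that(2,1)] by simp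
      moreover have "F \<subseteq> \<Union>C" using that unfolding subset.chain_def by blast
      ultimately show ?thesis by simp
    qed
  qed
  then obtain M where "M \<in> ?Z" and max': "\<forall>X\<in>?Z. M \<subseteq> X \<longrightarrow> X = M"
    by (rule bexE)
  then have M: "proper_filter M" "F \<subseteq> M" by simp_all
  have max: "X = M" if "proper_filter X" "F \<subseteq> X" "M \<subseteq> X" for X
    using max' that by simp
  have "A \<in> M \<or> - A \<in> M" for A
  proof (cases "\<exists>X\<in>M. X \<inter> A = {}")
    case True
    then obtain X where "X \<in> M" "X \<inter> A = {}" by (rule bexE)
    then have "- A \<in> M" by (metis proper_filter_mono[OF M(1)] disjoint_eq_subset_Compl)
    then show ?thesis by (rule disjI2)
  next
    case False
    have 1: "UNIV \<in> {UNIV, A}" by simp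
    have 2: "B \<inter> C \<in> {UNIV, A}" if "B \<in> {UNIV, A}" "C \<in> {UNIV, A}" for B C
      using that by auto
    have "{} \<notin> M" using M(1) unfolding proper_filter_def by simp
    then have 3: "X \<inter> B \<noteq> {}" if "X \<in> M" "B \<in> {UNIV, A}" for X B
      using that False by auto
    obtain H where H: "proper_filter H" "M \<subseteq> H" "{UNIV, A} \<subseteq> H"
      by (rule proper_filter_adjoin[OF M(1) 1], erule 2, assumption, erule 3, assumption) (rule that)
    have "H = M" by (rule max[OF H(1) order_trans[OF M(2) H(2)] H(2)])
    with H(3) show ?thesis by simp
  qed
  with M show ?thesis by (intro that) (simp_all add: ultrafilter_def)
qed

text \<open>The statement \<open>{x. P x} \<in> p\<close> is read as a quantifier "for
  \<open>p\<close>-most \<open>x\<close>". The \<open>Collect\<close> lemmas below say that it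
  commutes with negation, conjunction and finite quantifiers.\<close>

locale ultra =
  fixes p :: "'a set set"
  assumes ultrafilter: "ultrafilter p"
begin

lemma proper: "proper_filter p"
  using ultrafilter unfolding ultrafilter_def by blast

lemma mono: "A \<in> p \<Longrightarrow> A \<subseteq> B \<Longrightarrow> B \<in> p"
  by (rule proper_filter_mono[OF proper])

lemma Int_iff: "A \<inter> B \<in> p \<longleftrightarrow> A \<in> p \<and> B \<in> p"
  using proper_filter_Int[OF proper] mono by (metis inf_le1 inf_le2)

lemma Compl_iff: "- A \<in> p \<longleftrightarrow> A \<notin> p"
  using ultrafilter proper unfolding ultrafilter_def proper_filter_def
  by (metis Compl_disjoint)

lemma UNIV_mem: "UNIV \<in> p" and empty_notin: "{} \<notin> p"
  using proper unfolding proper_filter_def by blast+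

lemma Collect_not: "{x. \<not> P x} \<in> p \<longleftrightarrow> {x. P x} \<notin> p"
  using Compl_iff[of "{x. P x}"] by (simp add: Collect_neg_eq)

lemma Collect_conj: "{x. P x \<and> Q x} \<in> p \<longleftrightarrow> {x. P x} \<in> p \<and> {x. Q x} \<in> p"
  by (simp add: Collect_conj_eq Int_iff)

lemma Collect_ball_finite:
  "finite I \<Longrightarrow> (\<And>i. i \<in> I \<Longrightarrow> {x. P i x} \<in> p) \<Longrightarrow> {x. \<forall>i\<in>I. P i x} \<in> p"
proof (induction I rule: finite_induct)
  case empty
  then show ?case by (simp add: UNIV_mem)
next
  case (insert i I)
  then show ?case by (simp add: Collect_conj)
qed

lemma Collect_bex_finite:
  assumes "finite I" "{x. \<exists>i\<in>I. P i x} \<in> p"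
  shows "\<exists>i\<in>I. {x. P i x} \<in> p"
proof (rule ccontr)
  assume "\<not> ?thesis"
  then have "{x. \<forall>i\<in>I. \<not> P i x} \<in> p"
    by (intro Collect_ball_finite assms(1)) (simp add: Collect_not)
  then have "{x. \<not> (\<exists>i\<in>I. P i x)} \<in> p" by simp
  then show False using assms(2) unfolding Collect_not by blast
qed

lemma nonempty: "{x. P x} \<in> p \<Longrightarrow> \<exists>x. P x"
  using empty_notin by (metis Collect_empty_eq)

text \<open>A bound on \<open>p\<close>-most values would leave finitely many of them, and one would
  be taken on a set of \<open>p\<close>. So a function that is not constant on a set of
  \<open>p\<close> tends to infinity along \<open>p\<close>.\<close>

lemma eventually_gt:
  fixes g :: "'a \<Rightarrow> nat"
  assumes "\<And>v. {x. g x = v} \<notin> p"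
  shows "{x. g x > M} \<in> p"
proof (rule ccontr)
  assume "{x. g x > M} \<notin> p"
  then have "{x. \<not> g x > M} \<in> p" by (rule Collect_not[THEN iffD2])
  then have "{x. \<exists>v\<in>{..M}. g x = v} \<in> p" by (rule mono) auto
  then show False using Collect_bex_finite[of "{..M}" "\<lambda>v x. g x = v"] assms by auto
qed

lemma eventually_abs_gt:
  fixes g :: "'a \<Rightarrow> int"
  assumes "\<And>v. {x. g x = v} \<notin> p"
  shows "{x. \<bar>g x\<bar> > M} \<in> p"
proof (rule ccontr)
  assume "{x. \<bar>g x\<bar> > M} \<notin> p"
  then have "{x. \<not> \<bar>g x\<bar> > M} \<in> p" by (rule Collect_not[THEN iffD2])
  then have "{x. \<exists>v\<in>{-M..M}. g x = v} \<in> p" by (rule mono) auto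
  then show False using Collect_bex_finite[of "{-M..M}" "\<lambda>v x. g x = v"] assms by auto
qed

end

text \<open>This order of convolution makes \<open>p \<mapsto> p + q\<close> continuous on the space of ultrafilters.\<close>

definition filter_add :: "nat set set \<Rightarrow> nat set set \<Rightarrow> nat set set" where
  "filter_add F V = {A. {n. {m. n + m \<in> A} \<in> V} \<in> F}"

lemma mem_filter_add: "A \<in> filter_add F V \<longleftrightarrow> {n. {m. n + m \<in> A} \<in> V} \<in> F"
  unfolding filter_add_def by (rule mem_Collect_eq)

text \<open>In the space of ultrafilters an additive filter is a closed subsemigroup.\<close>

definition additive_filter :: "nat set set \<Rightarrow> bool" where
  "additive_filter F \<longleftrightarrow> proper_filter F \<and> (\<forall>V. ultrafilter V \<and> F \<subseteq> V \<longrightarrow> F \<subseteq> filter_add F V)"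

lemma proper_filter_add:
  assumes "proper_filter F" "ultrafilter V"
  shows "proper_filter (filter_add F V)"
proof -
  interpret ultra V by standard (rule assms)
  show ?thesis unfolding proper_filter_def filter_add_def
  proof (intro conjI ballI allI impI, goal_cases)
    case 1
    then show ?case using assms(1) UNIV_mem by (simp add: proper_filter_def)
  next
    case 2
    then show ?case using assms(1) empty_notin by (simp add: proper_filter_def)
  next
    case (3 A B)
    then show ?case using assms(1)
      by (simp add: Collect_conj) (simp add: proper_filter_def Collect_conj_eq)
  next
    case (4 A B)
    then have "{n. {m. n + m \<in> A} \<in> V} \<subseteq> {n. {m. n + m \<in> B} \<in> V}"
      using mono by (smt (verit) Collect_mono subsetD)
    then show ?case using proper_filter_mono[OF assms(1)] 4 by blast
  qed
qed

lemma ultrafilter_add: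
  assumes "ultrafilter U" "ultrafilter V"
  shows "ultrafilter (filter_add U V)"
proof -
  interpret U: ultra U by standard (rule assms)
  interpret V: ultra V by standard (rule assms)
  show ?thesis unfolding ultrafilter_def
    using proper_filter_add[OF U.proper assms(2)]
    by (auto simp: filter_add_def V.Collect_not U.Collect_not)
qed

lemma ultrafilter_eqI: "ultrafilter U \<Longrightarrow> ultrafilter V \<Longrightarrow> U \<subseteq> V \<Longrightarrow> U = V"
  by (metis subsetI subset_antisym ultra.Compl_iff ultra.intro subsetD)

text \<open>Every ultrafilter \<open>U\<close> extending \<open>H\<close> satisfies
  \<open>filter_add U V = W\<close>. The lemma thus expresses that \<open>U \<mapsto> U + V\<close>
  maps the closed set of ultrafilters extending \<open>F\<close> onto the one belonging to
  \<open>filter_add F V\<close>. If a set of \<open>F\<close> missed a translate of some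
  \<open>B \<in> W\<close>, then \<open>- B\<close> would belong to
  \<open>filter_add F V \<subseteq> W\<close>.\<close>

lemma proper_filter_adjoin_translates:
  assumes pF: "proper_filter F" and V: "ultrafilter V" and W: "ultrafilter W" "filter_add F V \<subseteq> W"
  obtains H where "proper_filter H" "F \<subseteq> H" "\<forall>B\<in>W. {n. {m. n + m \<in> B} \<in> V} \<in> H"
    "\<forall>Y\<in>H. \<exists>X\<in>F. \<exists>B\<in>W. X \<inter> {n. {m. n + m \<in> B} \<in> V} \<subseteq> Y"
proof -
  interpret V: ultra V by standard (rule V)
  interpret W: ultra W by standard (rule W)
  let ?tr = "\<lambda>B. {n. {m. n + m \<in> B} \<in> V}"
  have 1: "UNIV \<in> ?tr ` W" using W.UNIV_mem V.UNIV_mem by (auto intro!: image_eqI[of _ _ UNIV])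
  have 2: "A \<inter> B \<in> ?tr ` W" if "A \<in> ?tr ` W" "B \<in> ?tr ` W" for A B
  proof -
    obtain X Y where *: "X \<in> W" "Y \<in> W" "A = ?tr X" "B = ?tr Y" using \<open>A \<in> _\<close> \<open>B \<in> _\<close> by blast
    have "?tr (X \<inter> Y) = A \<inter> B" by (auto simp: * V.Collect_conj)
    then show ?thesis using * W.Int_iff by blast
  qed
  have 3: "X \<inter> A \<noteq> {}" if "X \<in> F" "A \<in> ?tr ` W" for X A
  proof
    assume e: "X \<inter> A = {}"
    obtain B where B: "B \<in> W" "A = ?tr B" using \<open>A \<in> _\<close> by blast
    have "X \<subseteq> ?tr (- B)" using e by (auto simp: B V.Collect_not)
    then have "- B \<in> filter_add F V"
      using proper_filter_mono[OF pF] \<open>X \<in> F\<close> unfolding filter_add_def by blast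
    then show False using W(2) B(1) W.Compl_iff by blast
  qed
  obtain H where H: "proper_filter H" "F \<subseteq> H" "?tr ` W \<subseteq> H"
      "\<forall>Y\<in>H. \<exists>X\<in>F. \<exists>A\<in>?tr ` W. X \<inter> A \<subseteq> Y"
    by (rule proper_filter_adjoin[OF pF 1], erule 2, assumption, erule 3, assumption)
  show ?thesis
  proof (rule that[OF H(1,2)])
    show "\<forall>B\<in>W. ?tr B \<in> H" using H(3) by (rule image_subset_iff[THEN iffD1])
    show "\<forall>Y\<in>H. \<exists>X\<in>F. \<exists>B\<in>W. X \<inter> ?tr B \<subseteq> Y" using H(4) by (simp only: bex_simps)
  qed
qed

section \<open>Idempotents in closed subsemigroups (Ellis-Numakura)\<close>

lemma additive_filter_extend_add:
  assumes F: "additive_filter F" and V: "ultrafilter V" "F \<subseteq> V"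
  shows "additive_filter (filter_add F V)"
  unfolding additive_filter_def
proof (intro conjI allI impI)
  interpret V: ultra V by standard (rule V)
  have pF: "proper_filter F" and sub: "F \<subseteq> filter_add F V"
    using F V unfolding additive_filter_def by simp_all
  show "proper_filter (filter_add F V)" using pF V(1) by (rule proper_filter_add)
  fix W assume "ultrafilter W \<and> filter_add F V \<subseteq> W"
  then have W: "ultrafilter W" "filter_add F V \<subseteq> W" by auto
  let ?tr = "\<lambda>B. {n. {m. n + m \<in> B} \<in> V}"
  obtain H where H: "proper_filter H" "F \<subseteq> H" "\<forall>B\<in>W. ?tr B \<in> H"
    by (rule proper_filter_adjoin_translates[OF pF V(1) W]) (rule that)
  \<comment> \<open>If \<open>S\<close> is the closed subsemigroup of \<open>F\<close>, the claim is
    that \<open>S + V\<close> is a subsemigroup. An element \<open>W\<close> of it is written as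
    \<open>U + V\<close> with \<open>U\<close> in \<open>S\<close>; then
    \<open>S + V + U \<subseteq> S\<close> gives \<open>S + V + W \<subseteq> S + V\<close>.\<close>
  obtain U where U: "ultrafilter U" "H \<subseteq> U" using ultrafilter_extends[OF H(1)] .
  have "W \<subseteq> filter_add U V" using H(3) U(2) by (simp add: mem_filter_add subset_iff)
  then have WU: "W = filter_add U V"
    by (rule ultrafilter_eqI[OF W(1) ultrafilter_add[OF U(1) V(1)]])
  show "filter_add F V \<subseteq> filter_add (filter_add F V) W"
  proof
    fix A assume "A \<in> filter_add F V"
    then have "?tr A \<in> F" by (rule mem_filter_add[THEN iffD1])
    moreover have "F \<subseteq> filter_add F U"
      using F U(1) order_trans[OF H(2) U(2)] unfolding additive_filter_def by simp
    ultimately have "?tr A \<in> filter_add F U" by (rule subsetD[rotated])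
    then have "{n. {m. m \<in> {m. {k. (n + m) + k \<in> A} \<in> V}} \<in> U} \<in> F"
      by (simp only: mem_filter_add mem_Collect_eq)
    then have "{n. {m. n + m \<in> A} \<in> W} \<in> F"
      by (simp only: WU mem_filter_add mem_Collect_eq add.assoc)
    then show "A \<in> filter_add (filter_add F V) W"
      unfolding mem_filter_add[of A _ W] using sub by (rule subsetD[rotated])
  qed
qed

text \<open>With \<open>S\<close> the closed subsemigroup of \<open>F\<close>, the ultrafilters
  \<open>U\<close> in \<open>S\<close> with \<open>U + V = V\<close> form a closed subsemigroup
  again, and \<open>G\<close> is its filter. It is nonempty because \<open>eq\<close> says
  \<open>S + V = S\<close>, and \<open>V\<close> lies in \<open>S\<close>.\<close>

lemma additive_filter_extend_stabilizer:
  assumes F: "additive_filter F" and V: "ultrafilter V" "F \<subseteq> V" and eq: "filter_add F V = F"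
  obtains G where "additive_filter G" "F \<subseteq> G" "\<forall>B\<in>V. {n. {m. n + m \<in> B} \<in> V} \<in> G"
proof -
  interpret V: ultra V by standard (rule V)
  have pF: "proper_filter F" using F unfolding additive_filter_def by auto
  let ?tr = "\<lambda>B. {n. {m. n + m \<in> B} \<in> V}"
  obtain H where H: "proper_filter H" "F \<subseteq> H" "\<forall>B\<in>V. ?tr B \<in> H"
      "\<forall>Y\<in>H. \<exists>X\<in>F. \<exists>B\<in>V. X \<inter> ?tr B \<subseteq> Y"
    by (rule proper_filter_adjoin_translates[OF pF V(1) V(1) eq[THEN equalityD1, THEN order_trans, OF V(2)]]) (rule that)
  have "H \<subseteq> filter_add H W" if W: "ultrafilter W" "H \<subseteq> W" for W
  proof
    interpret W: ultra W by standard (rule W)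
    have "V \<subseteq> filter_add W V" using H(3) W(2) by (simp add: mem_filter_add subset_iff)
    then have WV: "filter_add W V = V"
      by (rule ultrafilter_eqI[OF V(1) ultrafilter_add[OF W(1) V(1)], symmetric])
    fix A assume "A \<in> H"
    with H(4) have "\<exists>X\<in>F. \<exists>B\<in>V. X \<inter> ?tr B \<subseteq> A" by (rule bspec)
    then obtain X B where XB: "X \<in> F" "B \<in> V" "X \<inter> ?tr B \<subseteq> A" by (elim bexE) (rule that)
    have "F \<subseteq> filter_add F W"
      using F W(1) order_trans[OF H(2) W(2)] unfolding additive_filter_def by simp
    then have 1: "{n. {m. n + m \<in> X} \<in> W} \<in> H"
      using XB(1) H(2) by (simp add: mem_filter_add subset_iff)
    have "{n. {m. n + m \<in> B} \<in> filter_add W V} \<in> H" using H(3) XB(2) WV by auto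
    then have "{n. {m. n + m \<in> ?tr B} \<in> W} \<in> H" by (simp add: filter_add_def add.assoc)
    with 1 have "{n. {m. n + m \<in> X} \<in> W} \<inter> {n. {m. n + m \<in> ?tr B} \<in> W} \<in> H"
      by (rule proper_filter_Int[OF H(1)])
    moreover have "{n. {m. n + m \<in> X} \<in> W} \<inter> {n. {m. n + m \<in> ?tr B} \<in> W} \<subseteq> {n. {m. n + m \<in> A} \<in> W}"
    proof
      fix n assume "n \<in> {n. {m. n + m \<in> X} \<in> W} \<inter> {n. {m. n + m \<in> ?tr B} \<in> W}"
      then have "{m. n + m \<in> X} \<inter> {m. n + m \<in> ?tr B} \<in> W" by (simp add: W.Int_iff)
      then have "{m. n + m \<in> A} \<in> W" by (rule W.mono) (use XB(3) in blast)
      then show "n \<in> {n. {m. n + m \<in> A} \<in> W}" by simp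
    qed
    ultimately show "A \<in> filter_add H W"
      unfolding mem_filter_add by (rule proper_filter_mono[OF H(1)])
  qed
  then have "additive_filter H" using H(1) unfolding additive_filter_def by simp
  then show ?thesis using H(2,3) by (rule that)
qed

text \<open>A maximal additive filter is a minimal closed subsemigroup \<open>S\<close>. For
  \<open>V\<close> in \<open>S\<close>, minimality gives \<open>S + V = S\<close>, and then the
  stabilizer of \<open>V\<close> is all of \<open>S\<close>. It contains \<open>V\<close> itself, so
  \<open>V + V = V\<close>.\<close>

lemma idempotent_ultrafilter_extends:
  assumes "additive_filter F"
  obtains p where "ultrafilter p" "F \<subseteq> p" "filter_add p p = p"
proof -
  let ?Z = "{G. additive_filter G \<and> F \<subseteq> G}"
  have "\<exists>M\<in>?Z. \<forall>X\<in>?Z. M \<subseteq> X \<longrightarrow> X = M"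
  proof (rule subset_Zorn_nonempty)
    show "?Z \<noteq> {}" using assms by blast
    show "\<Union>C \<in> ?Z" if "C \<noteq> {}" "subset.chain ?Z C" for C
    proof -
      have "proper_filter (\<Union>C)"
        using proper_filter_Union_chain[OF that(2,1)] by (simp add: additive_filter_def)
      moreover have "F \<subseteq> \<Union>C" using that unfolding subset.chain_def by blast
      moreover have "A \<in> filter_add (\<Union>C) V" if V: "ultrafilter V" "\<Union>C \<subseteq> V" and "A \<in> G" "G \<in> C" for A V G
      proof -
        have "additive_filter G" using \<open>subset.chain ?Z C\<close> \<open>G \<in> C\<close> unfolding subset.chain_def by blast
        moreover have "G \<subseteq> V" using V \<open>G \<in> C\<close> by blast
        ultimately have "A \<in> filter_add G V" using V(1) \<open>A \<in> G\<close> unfolding additive_filter_def by blast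
        then show ?thesis using \<open>G \<in> C\<close> unfolding filter_add_def by blast
      qed
      ultimately show ?thesis unfolding additive_filter_def by blast
    qed
  qed
  then obtain M where "M \<in> ?Z" and max': "\<forall>X\<in>?Z. M \<subseteq> X \<longrightarrow> X = M"
    by (rule bexE)
  then have M: "additive_filter M" "F \<subseteq> M" by simp_all
  have max: "X = M" if "additive_filter X" "F \<subseteq> X" "M \<subseteq> X" for X
    using max' that by simp
  obtain V where V: "ultrafilter V" "M \<subseteq> V"
    using ultrafilter_extends[of M] M(1) unfolding additive_filter_def by blast
  have "M \<subseteq> filter_add M V" using M(1) V unfolding additive_filter_def by blast
  then have "filter_add M V = M"
    using max[OF additive_filter_extend_add[OF M(1) V]] M(2) by blast
  then obtain G where "additive_filter G" "M \<subseteq> G" "\<forall>B\<in>V. {n. {m. n + m \<in> B} \<in> V} \<in> G"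
    by (rule additive_filter_extend_stabilizer[OF M(1) V])
  then have "\<forall>B\<in>V. {n. {m. n + m \<in> B} \<in> V} \<in> V" using max[of G] M(2) V(2) by blast
  then have "V \<subseteq> filter_add V V" unfolding filter_add_def by blast
  then have "filter_add V V = V" using ultrafilter_eqI V(1) ultrafilter_add by metis
  then show ?thesis using that V M(2) by blast
qed

section \<open>Finite sums\<close>

lemma FS_mono: "D \<subseteq> E \<Longrightarrow> FS D \<subseteq> FS E"
  unfolding FS_def by blast

lemma FS_I: "F \<subseteq> D \<Longrightarrow> finite F \<Longrightarrow> F \<noteq> {} \<Longrightarrow> \<Sum>F \<in> FS D"
  unfolding FS_def by blast

lemma FS_singleton: "x \<in> D \<Longrightarrow> x \<in> FS D"
  using FS_I[of "{x}" D] by simp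

lemma FS_E:
  assumes "x \<in> FS D"
  obtains F where "F \<subseteq> D" "finite F" "F \<noteq> {}" "x = \<Sum>F"
  using assms unfolding FS_def by blast

lemma finite_FS: "finite D \<Longrightarrow> finite (FS D)"
proof -
  assume "finite D"
  have "FS D \<subseteq> sum (\<lambda>n. n) ` Pow D" unfolding FS_def by auto
  then show ?thesis using \<open>finite D\<close> by (meson finite_Pow_iff finite_imageI finite_subset)
qed

lemma FS_add:
  assumes "x \<in> FS D" "y \<in> FS E" "D \<inter> E = {}"
  shows "x + y \<in> FS (D \<union> E)"
proof -
  obtain F where F: "F \<subseteq> D" "finite F" "F \<noteq> {}" "x = \<Sum>F" using assms(1) by (rule FS_E)
  obtain G where G: "G \<subseteq> E" "finite G" "G \<noteq> {}" "y = \<Sum>G" using assms(2) by (rule FS_E)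
  have "x + y = \<Sum>(F \<union> G)"
    using F G assms(3) by (subst sum.union_disjoint) auto
  then show ?thesis using FS_I[of "F \<union> G" "D \<union> E"] F G by auto
qed

lemma FS_gt:
  assumes "x \<in> FS {n<..}" shows "n < x"
proof -
  obtain F where F: "F \<subseteq> {n<..}" "finite F" "F \<noteq> {}" "x = \<Sum>F" using assms by (rule FS_E)
  then obtain a where a: "a \<in> F" by blast
  then have "a \<le> x" using F member_le_sum[of a F "\<lambda>n. n"] by auto
  then show ?thesis using a F(1) by auto
qed

lemma FS_image_E:
  fixes d :: "nat \<Rightarrow> nat"
  assumes "inj d" "x \<in> FS (d ` I)"
  obtains F where "F \<subseteq> I" "finite F" "F \<noteq> {}" "x = (\<Sum>i\<in>F. d i)"
proof -
  obtain G where G: "G \<subseteq> d ` I" "finite G" "G \<noteq> {}" "x = \<Sum>G" using assms(2) by (rule FS_E)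
  obtain F where F: "F \<subseteq> I" "G = d ` F" using G(1) by (meson subset_imageE)
  have "inj_on d F" using assms(1) by (rule inj_on_subset) simp
  then have "finite F" "x = (\<Sum>i\<in>F. d i)" using F(2) G finite_imageD by (auto simp: sum.reindex)
  then show ?thesis using that F G(3) by blast
qed

lemma FS_image_I:
  fixes d :: "nat \<Rightarrow> nat"
  assumes "inj d" "F \<subseteq> I" "finite F" "F \<noteq> {}"
  shows "(\<Sum>i\<in>F. d i) \<in> FS (d ` I)"
proof -
  have "inj_on d F" using assms(1) by (rule inj_on_subset) simp
  then have "(\<Sum>i\<in>F. d i) = \<Sum>(d ` F)" by (simp add: sum.reindex)
  also have "\<dots> \<in> FS (d ` I)" using assms by (intro FS_I) auto
  finally show ?thesis .
qed

text \<open>In an adaptive construction the summand with the largest index is chosen in full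
  knowledge of the rest of the sum. \<open>FS_split_first\<close> serves the opposite purpose: it
  handles functions whose value is already fixed by the summand with the smallest index.\<close>

lemma FS_split_last:
  fixes d :: "nat \<Rightarrow> nat"
  assumes "inj d" "x \<in> FS (range d)"
  obtains n where "x \<in> FS (d ` {..<Suc n})" "x = d n \<or> (\<exists>s\<in>FS (d ` {..<n}). x = s + d n)"
proof -
  obtain F where F: "finite F" "F \<noteq> {}" "x = (\<Sum>i\<in>F. d i)"
    using FS_image_E[OF assms] by metis
  let ?n = "Max F" let ?G = "F - {?n}"
  have n: "?n \<in> F" "\<And>i. i \<in> F \<Longrightarrow> i \<le> ?n" using F by auto
  have x: "x = (\<Sum>i\<in>?G. d i) + d ?n" using F n by (simp add: sum.remove[of F ?n])
  have G: "?G \<subseteq> {..<?n}" using n(2) by (auto simp: order_less_le)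
  show ?thesis
  proof (rule that[of ?n])
    show "x \<in> FS (d ` {..<Suc ?n})"
      unfolding F(3) by (rule FS_image_I[OF assms(1)]) (use F n in \<open>auto simp: less_Suc_eq_le\<close>)
    show "x = d ?n \<or> (\<exists>s\<in>FS (d ` {..<?n}). x = s + d ?n)"
    proof (cases "?G = {}")
      case True
      show ?thesis using x unfolding True by simp
    next
      case False
      then have "(\<Sum>i\<in>?G. d i) \<in> FS (d ` {..<?n})"
        using FS_image_I[OF assms(1) G] F(1) by simp
      then show ?thesis using x by blast
    qed
  qed
qed

lemma FS_split_first:
  fixes d :: "nat \<Rightarrow> nat"
  assumes "inj d" "x \<in> FS (d ` {k..})"
  obtains m where "k \<le> m" "x \<in> FS (d ` {m..})" "x = d m \<or> (\<exists>y\<in>FS (d ` {Suc m..}). x = d m + y)"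
proof -
  obtain F where F: "F \<subseteq> {k..}" "finite F" "F \<noteq> {}" "x = (\<Sum>i\<in>F. d i)"
    using FS_image_E[OF assms] by metis
  let ?m = "Min F" let ?G = "F - {?m}"
  have m: "?m \<in> F" "\<And>i. i \<in> F \<Longrightarrow> ?m \<le> i" using F by auto
  have x: "x = d ?m + (\<Sum>i\<in>?G. d i)" using F m by (simp add: sum.remove[of F ?m])
  have G: "?G \<subseteq> {Suc ?m..}" using m(2) by (auto simp: Suc_le_eq order_less_le)
  show ?thesis
  proof (rule that[of ?m])
    show "k \<le> ?m" using m F(1) by auto
    show "x \<in> FS (d ` {?m..})"
      unfolding F(4) by (rule FS_image_I[OF assms(1)]) (use F m in auto)
    show "x = d ?m \<or> (\<exists>y\<in>FS (d ` {Suc ?m..}). x = d ?m + y)"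
    proof (cases "?G = {}")
      case True
      show ?thesis using x unfolding True by simp
    next
      case False
      then have "(\<Sum>i\<in>?G. d i) \<in> FS (d ` {Suc ?m..})"
        using FS_image_I[OF assms(1) G] F(2) by simp
      then show ?thesis using x by blast
    qed
  qed
qed

section \<open>The Galvin-Glazer argument\<close>

locale idempotent_ultra = ultra p for p :: "nat set set" +
  assumes idempotent: "{x. {y. x + y \<in> A} \<in> p} \<in> p \<longleftrightarrow> A \<in> p"
    and nonprincipal: "{n<..} \<in> p"
begin

text \<open>The points of \<open>A\<close> from which \<open>p\<close>-most steps stay in
  \<open>A\<close>. Unlike \<open>A\<close>, this set is stable: from each of its points
  \<open>p\<close>-most steps stay in \<open>star A\<close>, by
  \<open>star_translate\<close>.\<close>

definition star :: "nat set \<Rightarrow> nat set" where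
  "star A = {x \<in> A. {y. x + y \<in> A} \<in> p}"

lemma star_subset: "star A \<subseteq> A"
  unfolding star_def by blast

lemma star_mem: "A \<in> p \<Longrightarrow> star A \<in> p"
  unfolding star_def using idempotent[of A] Collect_conj[of "\<lambda>x. x \<in> A"] by simp

lemma star_translate:
  assumes "x \<in> star A" shows "{y. x + y \<in> star A} \<in> p"
proof -
  have A: "{y. x + y \<in> A} \<in> p" using assms unfolding star_def by simp
  then have "{y. {z. x + (y + z) \<in> A} \<in> p} \<in> p" using idempotent[of "{y. x + y \<in> A}"] by simp
  then show ?thesis using A unfolding star_def by (simp add: Collect_conj add.assoc)
qed

text \<open>A Galvin--Glazer construction in which the constraints are chosen adaptively.\<close>

lemma adaptive_Hindman:
  assumes "\<forall>P. finite P \<longrightarrow> W P \<in> p"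
  obtains d :: "nat \<Rightarrow> nat"
  where "strict_mono d" "\<forall>n. FS (d ` {n..}) \<subseteq> W (d ` {..<n})"
proof -
  have W: "W P \<in> p" if "finite P" for P using assms that by simp
  \<comment> \<open>The state consists of the set \<open>P\<close> of terms already chosen, the set
    \<open>V\<close> in \<open>p\<close> to which all further sums are confined, and the next term
    \<open>d\<close>. Taking \<open>d\<close> from \<open>star V\<close> guarantees that
    \<open>p\<close>-most \<open>y\<close> can be added to it.\<close>
  let ?I = "\<lambda>(n::nat) (P, V, d). (n = 0 \<longrightarrow> P = {}) \<and> finite P \<and> V \<in> p \<and> V \<subseteq> W P \<and> d \<in> star V"
  let ?R = "\<lambda>(n::nat) (P, V, d) (P', V', d'). P' = insert d P \<and> V' \<subseteq> star V \<and> V' \<subseteq> {y. d + y \<in> star V} \<and>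
    V' \<subseteq> {d<..}"
  have "\<exists>f. \<forall>n. ?I n (f n) \<and> ?R n (f n) (f (Suc n))"
  proof (rule dependent_nat_choice)
    have "star (W {}) \<in> p" using W star_mem by blast
    then obtain d where "d \<in> star (W {})" using empty_notin by fastforce
    then show "\<exists>x. ?I 0 x" using W[of "{}"] by (intro exI[of _ "({}, W {}, d)"]) auto
    fix x n assume I: "?I n x"
    obtain P V d where x: "x = (P, V, d)" by (cases x)
    let ?V = "star V \<inter> {y. d + y \<in> star V} \<inter> W (insert d P) \<inter> {d<..}"
    have "?V \<in> p" using I star_mem[of V] star_translate[of d V] W[of "insert d P"] nonprincipal[of d]
      unfolding x by (simp add: Int_iff)
    moreover from this obtain d' where "d' \<in> star ?V" using empty_notin star_mem[of ?V] by fastforce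
    ultimately show "\<exists>y. ?I (Suc n) y \<and> ?R n x y"
      using I unfolding x by (intro exI[of _ "(insert d P, ?V, d')"]) auto
  qed
  then obtain f where f: "\<forall>n. ?I n (f n) \<and> ?R n (f n) (f (Suc n))" by (rule exE)
  define P where "P n = fst (f n)" for n
  define V where "V n = fst (snd (f n))" for n
  define d where "d n = snd (snd (f n))" for n
  have I: "finite (P n)" "V n \<in> p" "V n \<subseteq> W (P n)" "d n \<in> star (V n)" for n
    using f[THEN spec, of n, THEN conjunct1] unfolding P_def V_def d_def by (auto split: prod.splits)
  have R: "P (Suc n) = insert (d n) (P n)" "V (Suc n) \<subseteq> star (V n)" "V (Suc n) \<subseteq> {y. d n + y \<in> star (V n)}"
    "V (Suc n) \<subseteq> {d n<..}" for n
    using f[THEN spec, of n, THEN conjunct2] unfolding P_def V_def d_def by (auto split: prod.splits)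
  have sm: "strict_mono d"
    unfolding strict_mono_Suc_iff using I(4) R(4) star_subset by blast
  have P: "P n = d ` {..<n}" for n
  proof (induction n)
    case 0
    show ?case using f[THEN spec, of 0, THEN conjunct1] unfolding P_def by (auto split: prod.splits)
  next
    case (Suc n)
    then show ?case by (simp add: R(1) lessThan_Suc)
  qed
  have Vdec: "star (V n) \<subseteq> star (V m)" if "m \<le> n" for m n
    using that
  proof (induction n rule: dec_induct)
    case (step n)
    then show ?case using R(2)[of n] star_subset[of "V (Suc n)"] by blast
  qed simp
  \<comment> \<open>The smallest index \<open>m\<close> is split off: the remaining sum lies in
    \<open>V (Suc m)\<close> by induction, and this set was chosen so that adding \<open>d m\<close>
    leads into \<open>star (V m)\<close>.\<close>
  have sum: "(\<Sum>i\<in>F. d i) \<in> star (V n)" if "finite F" "F \<noteq> {}" "F \<subseteq> {n..}" for F n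
    using that
  proof (induction F arbitrary: n rule: finite_psubset_induct)
    case (psubset F)
    let ?m = "Min F" let ?G = "F - {?m}"
    have m: "?m \<in> F" "\<And>i. i \<in> F \<Longrightarrow> ?m \<le> i" "n \<le> ?m" using psubset by auto
    have x: "(\<Sum>i\<in>F. d i) = d ?m + (\<Sum>i\<in>?G. d i)" using psubset m by (simp add: sum.remove[of F ?m])
    have "(\<Sum>i\<in>F. d i) \<in> star (V ?m)"
    proof (cases "?G = {}")
      case True
      show ?thesis unfolding x unfolding True using I(4) by simp
    next
      case False
      have "?G \<subset> F" "?G \<subseteq> {Suc ?m..}" using m by (auto simp: Suc_le_eq order_less_le)
      then have "(\<Sum>i\<in>?G. d i) \<in> star (V (Suc ?m))" using psubset.IH False by blast
      then show ?thesis unfolding x using R(3) star_subset by blast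
    qed
    then show ?case using Vdec[OF m(3)] by blast
  qed
  have inj: "inj d" using sm by (rule strict_mono_imp_inj_on)
  have "FS (d ` {n..}) \<subseteq> W (d ` {..<n})" for n
  proof
    fix x assume "x \<in> FS (d ` {n..})"
    then obtain F where "F \<subseteq> {n..}" "finite F" "F \<noteq> {}" "x = (\<Sum>i\<in>F. d i)"
      using FS_image_E[OF inj] by metis
    then have "x \<in> star (V n)" using sum by blast
    with star_subset have "x \<in> V n" by (rule subsetD)
    with I(3)[of n, unfolded P] show "x \<in> W (d ` {..<n})" by (rule subsetD)
  qed
  then show ?thesis using that sm by simp
qed

end

text \<open>The sets \<open>FS (E - K)\<close> generate an additive filter: if \<open>n\<close> is a
  sum over a finite \<open>F \<subseteq> E - K\<close>, then adding any element of
  \<open>FS (E - (K \<union> F))\<close> stays in \<open>FS (E - K)\<close>. An idempotent extending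
  this filter contains all of them.\<close>

lemma idempotent_ultra_exists:
  assumes "infinite E"
  obtains p where "idempotent_ultra p" "\<And>K. finite K \<Longrightarrow> FS (E - K) \<in> p"
proof -
  let ?F = "{A. \<exists>K. finite K \<and> FS (E - K) \<subseteq> A}"
  have tails: "FS (E - K) \<in> ?F" if "finite K" for K
    using that by blast
  have ne: "FS (E - K) \<noteq> {}" if "finite K" for K
    using assms that FS_singleton[of _ "E - K"] by (metis Diff_infinite_finite empty_iff ex_in_conv finite.emptyI)
  have "proper_filter ?F"
  proof (rule proper_filterI)
    show "UNIV \<in> ?F" by (auto intro: exI[of _ "{}"])
    show "{} \<notin> ?F" using ne by auto
    show "A \<inter> B \<in> ?F" if "A \<in> ?F" "B \<in> ?F" for A B
    proof -
      obtain K L where "finite K" "FS (E - K) \<subseteq> A" "finite L" "FS (E - L) \<subseteq> B" using \<open>A \<in> ?F\<close> \<open>B \<in> ?F\<close> by blast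
      then have "finite (K \<union> L) \<and> FS (E - (K \<union> L)) \<subseteq> A \<inter> B"
        using FS_mono[of "E - (K \<union> L)" "E - K"] FS_mono[of "E - (K \<union> L)" "E - L"] by blast
      then show ?thesis by blast
    qed
    show "B \<in> ?F" if "A \<in> ?F" "A \<subseteq> B" for A B
      using that by (blast intro: subset_trans)
  qed
  moreover have "?F \<subseteq> filter_add ?F V" if V: "ultrafilter V" "?F \<subseteq> V" for V
  proof
    interpret V: ultra V by standard (rule V)
    fix A assume "A \<in> ?F"
    then obtain K where K: "finite K" "FS (E - K) \<subseteq> A" by blast
    have "{m. n + m \<in> A} \<in> V" if n: "n \<in> FS (E - K)" for n
    proof -
      obtain F where F: "F \<subseteq> E - K" "finite F" "F \<noteq> {}" "n = \<Sum>F" using n by (rule FS_E)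
      have "FS (E - (K \<union> F)) \<in> V" using V(2) tails[of "K \<union> F"] K(1) F(2) by blast
      moreover have "n + m \<in> A" if "m \<in> FS (E - (K \<union> F))" for m
      proof -
        have "n + m \<in> FS (F \<union> (E - (K \<union> F)))"
          using F that by (intro FS_add FS_I) (auto intro: FS_I)
        moreover have "\<dots> \<subseteq> FS (E - K)" using F(1) by (intro FS_mono) auto
        ultimately show ?thesis using K(2) by blast
      qed
      ultimately show ?thesis by (elim V.mono) blast
    qed
    then have "FS (E - K) \<subseteq> {n. {m. n + m \<in> A} \<in> V}" by blast
    then show "A \<in> filter_add ?F V" unfolding mem_filter_add using K(1) by blast
  qed
  ultimately have "additive_filter ?F" unfolding additive_filter_def by simp
  then obtain p where p: "ultrafilter p" "?F \<subseteq> p" "filter_add p p = p"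
    by (rule idempotent_ultrafilter_extends)
  interpret ultra p by standard (rule p)
  have FSp: "FS (E - K) \<in> p" if "finite K" for K using p(2) tails[OF that] by (rule subsetD)
  have "{n<..} \<in> p" for n
  proof -
    have "FS (E - {..n}) \<subseteq> {n<..}"
      using FS_gt[of _ n] FS_mono[of "E - {..n}" "{n<..}"] by fastforce
    then show ?thesis using FSp[of "{..n}"] mono by blast
  qed
  moreover have "{x. {y. x + y \<in> A} \<in> p} \<in> p \<longleftrightarrow> A \<in> p" for A
    using mem_filter_add[of A p p] p(3) by simp
  ultimately have "idempotent_ultra p" by unfold_locales
  then show ?thesis using that FSp by blast
qed

section \<open>Functions on finite sums with values in the pairs\<close>

lemma infinite_obtain_three:
  fixes E :: "nat set"
  assumes "infinite E"
  obtains a b c where "a \<in> E" "b \<in> E" "c \<in> E" "a < b" "b < c"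
  using assms by (metis infinite_nat_iff_unbounded)

context idempotent_ultra
begin

text \<open>For typical \<open>x\<close>, \<open>y\<close>, \<open>z\<close> both
  \<open>g (x + y)\<close> and \<open>g (x + y + z)\<close> equal the value \<open>v\<close>
  belonging to \<open>x\<close>. So \<open>w = x + y\<close> satisfies
  \<open>g (w + z) = g w\<close>, and by idempotency \<open>p\<close>-most \<open>w\<close> are of
  this kind.\<close>

lemma Collect_bex_const:
  fixes g :: "nat \<Rightarrow> nat"
  assumes "{x. \<exists>v. {y. g (x + y) = v} \<in> p} \<in> p"
  shows "{x. {y. g (x + y) = g x} \<in> p} \<in> p"
proof -
  let ?Q = "{w. {z. g (w + z) = g w} \<in> p}"
  have "{x. {y. x + y \<in> ?Q} \<in> p} \<in> p"
  proof (rule mono[OF assms], safe)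
    fix x v assume v: "{y. g (x + y) = v} \<in> p"
    then have "{y. {z. g (x + (y + z)) = v} \<in> p} \<in> p"
      using idempotent[of "{y. g (x + y) = v}"] by simp
    with v have "{y. g (x + y) = v \<and> {z. g (x + (y + z)) = v} \<in> p} \<in> p" by (simp add: Collect_conj)
    then show "{y. x + y \<in> ?Q} \<in> p" by (rule mono) (auto simp: add.assoc)
  qed
  then show ?thesis by (simp only: idempotent)
qed

text \<open>Otherwise \<open>h (x + y + z) = g (y + z) = g y\<close> for typical \<open>x\<close>,
  \<open>y\<close> and \<open>p\<close>-most \<open>z\<close>. Then \<open>h (w + z)\<close> is
  constant in \<open>z\<close> for \<open>w = x + y\<close>, although such a \<open>w\<close> is
  typical and thus of the opposite kind.\<close>

lemma Collect_shift_neq: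
  fixes g h :: "nat \<Rightarrow> nat"
  assumes g: "{x. {y. g (x + y) = g x} \<in> p} \<in> p"
    and h: "{x. \<exists>v. {y. h (x + y) = v} \<in> p} \<notin> p"
  shows "{x. {y. h (x + y) \<noteq> g y} \<in> p} \<in> p"
proof (rule ccontr)
  assume "\<not> ?thesis"
  then have A: "{x. {y. h (x + y) = g y} \<in> p} \<in> p" by (simp add: Collect_not)
  let ?N = "{x. \<not> (\<exists>v. {y. h (x + y) = v} \<in> p)}"
  have "?N \<in> p" using h by (rule Collect_not[THEN iffD2])
  then have "{x. {y. x + y \<in> ?N} \<in> p} \<in> p" by (simp only: idempotent)
  with A have "{x. {y. h (x + y) = g y} \<in> p \<and> {y. x + y \<in> ?N} \<in> p} \<in> p" by (simp only: Collect_conj)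
  then obtain x where x: "{y. h (x + y) = g y} \<in> p" "{y. x + y \<in> ?N} \<in> p"
    using nonempty by blast
  have "{y. {z. h (x + (y + z)) = g (y + z)} \<in> p} \<in> p"
    using x(1) idempotent[of "{y. h (x + y) = g y}"] by simp
  with g x(2) have "{y. ({z. h (x + (y + z)) = g (y + z)} \<in> p \<and> {z. g (y + z) = g y} \<in> p) \<and> x + y \<in> ?N} \<in> p"
    by (simp only: Collect_conj; simp)
  then obtain y where y: "{z. h (x + (y + z)) = g (y + z)} \<in> p" "{z. g (y + z) = g y} \<in> p" "x + y \<in> ?N"
    using nonempty by blast
  have "{z. h (x + (y + z)) = g (y + z) \<and> g (y + z) = g y} \<in> p" using y(1,2) by (simp only: Collect_conj; simp)
  then have "{z. h ((x + y) + z) = g y} \<in> p" by (rule mono) (auto simp: add.assoc)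
  then show False using y(3) by blast
qed

lemma Collect_gt_shift:
  fixes h :: "nat \<Rightarrow> nat"
  assumes "\<not> (\<exists>v. {y. h (x + y) = v} \<in> p)"
  shows "{y. M < h (x + y)} \<in> p"
  using assms eventually_gt[of "\<lambda>y. h (x + y)"] by blast

text \<open>The bipartite case: no vertex is a left end \<open>g x'\<close> and a right end
  \<open>h x\<close> at once. Since \<open>g\<close> settles, \<open>g x'\<close> is read off the
  first summand of \<open>x'\<close>. The proof divides according to whether \<open>h\<close> is
  read off the first summand as well or grows with the last one.\<close>

lemma strategy_disjoint_vertices:
  fixes g h :: "nat \<Rightarrow> nat"
  assumes gh: "\<And>x. g x < h x"
    and nc: "\<And>v. {x. g x = v} \<notin> p"
    and g: "{x. \<exists>v. {y. g (x + y) = v} \<in> p} \<in> p"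
  obtains W where "\<And>P. finite P \<Longrightarrow> W P \<in> p"
    "\<And>(d :: nat \<Rightarrow> nat) x x'. strict_mono d \<Longrightarrow> (\<And>n. FS (d ` {n..}) \<subseteq> W (d ` {..<n})) \<Longrightarrow>
      x \<in> FS (range d) \<Longrightarrow> x' \<in> FS (range d) \<Longrightarrow> h x \<noteq> g x'"
proof -
  define M where "M P = Max (insert 0 (h ` FS P))" for P
  have M: "h x \<le> M P" if "finite P" "x \<in> FS P" for x P
    unfolding M_def using that finite_FS by (intro Max_ge) auto
  have g': "{x. {y. g (x + y) = g x} \<in> p} \<in> p" using g by (rule Collect_bex_const)
  have gtM: "{y. M P < g y} \<in> p" for P using nc by (rule eventually_gt)
  show ?thesis
  proof (cases "{x. \<exists>v. {y. h (x + y) = v} \<in> p} \<in> p")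
    case True
    then have h': "{x. {y. h (x + y) = h x} \<in> p} \<in> p" by (rule Collect_bex_const)
    define Good where "Good = {x. {y. g (x + y) = g x} \<in> p \<and> {y. h (x + y) = h x} \<in> p}"
    have Good: "Good \<in> p" unfolding Good_def using g' h' by (simp only: Collect_conj; simp)
    define W where "W P = {y. y \<in> Good \<and> M P < g y \<and> (\<forall>s\<in>P \<inter> Good. g (s + y) = g s \<and> h (s + y) = h s)}" for P
    show ?thesis
    proof (rule that[of W])
      fix P :: "nat set" assume "finite P"
      then have "{y. \<forall>s\<in>P \<inter> Good. g (s + y) = g s \<and> h (s + y) = h s} \<in> p"
        by (intro Collect_ball_finite) (auto simp: Good_def Collect_conj)
      then show "W P \<in> p" unfolding W_def using Good gtM by (simp add: Collect_conj)
    next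
      fix d :: "nat \<Rightarrow> nat" and x x'
      assume d: "strict_mono d" and W: "\<And>n. FS (d ` {n..}) \<subseteq> W (d ` {..<n})"
        and xx: "x \<in> FS (range d)" "x' \<in> FS (range d)"
      have inj: "inj d" using d by (rule strict_mono_imp_inj_on)
      have dW: "d m \<in> W (d ` {..<m})" for m
        using W[of m] FS_singleton[of "d m" "d ` {m..}"] by auto
      have first: "\<exists>m. g x = g (d m) \<and> h x = h (d m)" if x: "x \<in> FS (range d)" for x
      proof -
        have "x \<in> FS (d ` {0..})" using x by simp
        then obtain m where m: "x = d m \<or> (\<exists>y\<in>FS (d ` {Suc m..}). x = d m + y)"
          by (rule FS_split_first[OF inj])
        then show ?thesis
        proof
          assume "\<exists>y\<in>FS (d ` {Suc m..}). x = d m + y"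
          then obtain y where y: "y \<in> FS (d ` {Suc m..})" "x = d m + y" by blast
          then have "y \<in> W (d ` {..<Suc m})" using W by blast
          moreover have "d m \<in> d ` {..<Suc m} \<inter> Good" using dW[of m] unfolding W_def by auto
          ultimately show ?thesis using y(2) unfolding W_def by blast
        qed blast
      qed
      \<comment> \<open>So \<open>g (d 0) < h (d 0) < g (d 1) < h (d 1) < ...\<close>, and these are
        the only ends that occur.\<close>
      have less: "h (d i) < g (d j)" if "i < j" for i j
        using dW[of j] M[of "d ` {..<j}" "d i"] FS_singleton[of "d i" "d ` {..<j}"] that
        unfolding W_def by fastforce
      obtain i j where "h x = h (d i)" "g x' = g (d j)" using first xx by metis
      then show "h x \<noteq> g x'"
        using less[of i j] less[of j i] gh[of "d i"] gh[of "d j"]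
        by (cases i j rule: linorder_cases) auto
    qed
  next
    case False
    then have h': "{x. \<not> (\<exists>v. {y. h (x + y) = v} \<in> p)} \<in> p" by (rule Collect_not[THEN iffD2])
    define Good where "Good = {x. {y. g (x + y) = g x} \<in> p \<and> \<not> (\<exists>v. {y. h (x + y) = v} \<in> p) \<and>
      {y. h (x + y) \<noteq> g y} \<in> p}"
    have Good: "Good \<in> p"
      unfolding Good_def using g' h' Collect_shift_neq[OF g' False] by (simp only: Collect_conj; simp)
    \<comment> \<open>The constraint \<open>h (s + y) \<noteq> g y\<close> is aimed at the one
      situation that growth does not settle: the last summand \<open>y\<close> of one sum is the
      first summand of the other.\<close>
    define W where "W P = {y. y \<in> Good \<and> M P < g y \<and>
      (\<forall>s\<in>FS P \<inter> Good. g (s + y) = g s \<and> h (s + y) \<noteq> g y \<and> M P < h (s + y))}" for P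
    show ?thesis
    proof (rule that[of W])
      fix P :: "nat set" assume "finite P"
      then have "{y. \<forall>s\<in>FS P \<inter> Good. g (s + y) = g s \<and> h (s + y) \<noteq> g y \<and> M P < h (s + y)} \<in> p"
        by (intro Collect_ball_finite) (auto simp: Good_def Collect_conj finite_FS Collect_gt_shift)
      then show "W P \<in> p" unfolding W_def using Good gtM by (simp add: Collect_conj)
    next
      fix d :: "nat \<Rightarrow> nat" and x x'
      assume d: "strict_mono d" and W: "\<And>n. FS (d ` {n..}) \<subseteq> W (d ` {..<n})"
        and xx: "x \<in> FS (range d)" "x' \<in> FS (range d)"
      have inj: "inj d" using d by (rule strict_mono_imp_inj_on)
      have FSGood: "FS (range d) \<subseteq> Good" using W[of 0] unfolding W_def by (auto simp: atLeast_0)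
      have dW: "d m \<in> W (d ` {..<m})" for m
        using W[of m] FS_singleton[of "d m" "d ` {m..}"] by auto
      have "x' \<in> FS (d ` {0..})" using xx(2) by simp
      then obtain m where m: "x' \<in> FS (d ` {m..})" "x' = d m \<or> (\<exists>y\<in>FS (d ` {Suc m..}). x' = d m + y)"
        by (rule FS_split_first[OF inj])
      obtain n where n: "x \<in> FS (d ` {..<Suc n})" "x = d n \<or> (\<exists>s\<in>FS (d ` {..<n}). x = s + d n)"
        using xx(1) by (rule FS_split_last[OF inj])
      have gx': "g x' = g (d m)" using m(2)
      proof
        assume "\<exists>y\<in>FS (d ` {Suc m..}). x' = d m + y"
        then obtain y where y: "y \<in> FS (d ` {Suc m..})" "x' = d m + y" by blast
        then have "y \<in> W (d ` {..<Suc m})" using W by blast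
        moreover have "d m \<in> FS (d ` {..<Suc m}) \<inter> Good"
          using dW[of m] FS_singleton[of "d m" "d ` {..<Suc m}"] unfolding W_def by auto
        ultimately show ?thesis using y(2) unfolding W_def by blast
      qed simp
      have s: "h x \<noteq> g (d n) \<and> M (d ` {..<n}) < h x"
        using n(2)
      proof
        assume "x = d n"
        then show ?thesis using dW[of n] gh[of "d n"] unfolding W_def by auto
      next
        assume "\<exists>s\<in>FS (d ` {..<n}). x = s + d n"
        then obtain s where s: "s \<in> FS (d ` {..<n})" "x = s + d n" by blast
        then have "s \<in> FS (d ` {..<n}) \<inter> Good" using FSGood FS_mono[of "d ` {..<n}" "range d"] by blast
        then show ?thesis using dW[of n] s(2) unfolding W_def by blast
      qed
      \<comment> \<open>The first index \<open>m\<close> of \<open>x'\<close> is compared with the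
        last index \<open>n\<close> of \<open>x\<close>. For \<open>m < n\<close> the value
        \<open>h x\<close> is too large, for \<open>m > n\<close> it is too small.\<close>
      show "h x \<noteq> g x'"
      proof (cases m n rule: linorder_cases)
        case less
        then have "h (d m) \<le> M (d ` {..<n})" by (intro M) (auto intro: FS_singleton)
        then show ?thesis using s gh[of "d m"] gx' by simp
      next
        case equal
        then show ?thesis using s gx' by simp
      next
        case greater
        then have "FS (d ` {..<Suc n}) \<subseteq> FS (d ` {..<m})" by (intro FS_mono) auto
        then have "h x \<le> M (d ` {..<m})" using n(1) by (intro M) auto
        then show ?thesis using W[of m] m(1) unfolding W_def by fastforce
      qed
    qed
  qed
qed

text \<open>According to how \<open>g (x + y)\<close> and \<open>h (x + y)\<close> depend on \<open>y\<close>, the graph with the edges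
  \<open>(g x, h x)\<close> is made a star, bipartite, or a disjoint union of finite graphs.\<close>

definition no_clique_strategy :: "(nat \<Rightarrow> nat) \<Rightarrow> (nat \<Rightarrow> nat) \<Rightarrow> (nat set \<Rightarrow> nat set) \<Rightarrow> bool" where
  "no_clique_strategy g h W \<longleftrightarrow> (\<forall>P. finite P \<longrightarrow> W P \<in> p) \<and>
    (\<forall>(d :: nat \<Rightarrow> nat) E. strict_mono d \<longrightarrow> (\<forall>n. FS (d ` {n..}) \<subseteq> W (d ` {..<n})) \<longrightarrow> infinite E \<longrightarrow>
      \<not> (\<forall>a\<in>E. \<forall>b\<in>E. a < b \<longrightarrow> (\<exists>x\<in>FS (range d). g x = a \<and> h x = b)))"

lemma no_clique_strategyI:
  assumes "\<And>P. finite P \<Longrightarrow> W P \<in> p"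
    "\<And>(d :: nat \<Rightarrow> nat) E. strict_mono d \<Longrightarrow> (\<And>n. FS (d ` {n..}) \<subseteq> W (d ` {..<n})) \<Longrightarrow> infinite E \<Longrightarrow>
      (\<And>a b. a \<in> E \<Longrightarrow> b \<in> E \<Longrightarrow> a < b \<Longrightarrow> \<exists>x\<in>FS (range d). g x = a \<and> h x = b) \<Longrightarrow> False"
  shows "no_clique_strategy g h W"
  unfolding no_clique_strategy_def
proof (intro conjI allI impI notI)
  fix d :: "nat \<Rightarrow> nat" and E
  assume *: "strict_mono d" "\<forall>n. FS (d ` {n..}) \<subseteq> W (d ` {..<n})" "infinite E"
    "\<forall>a\<in>E. \<forall>b\<in>E. a < b \<longrightarrow> (\<exists>x\<in>FS (range d). g x = a \<and> h x = b)"
  show False by (rule assms(2)[of d E]) (use * in simp_all)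
qed (rule assms(1))

lemma strategy_no_infinite_clique:
  fixes g h :: "nat \<Rightarrow> nat"
  assumes gh: "\<And>x. g x < h x"
  obtains W where "no_clique_strategy g h W"
proof -
  have three: "\<exists>a b c. a \<in> E \<and> b \<in> E \<and> c \<in> E \<and> a < b \<and> b < c" if "infinite E" for E :: "nat set"
    using infinite_obtain_three[OF that] by metis
  consider v where "{x. g x = v} \<in> p"
    | "\<And>v. {x. g x = v} \<notin> p" "{x. \<exists>v. {y. g (x + y) = v} \<in> p} \<in> p"
    | "\<And>v. {x. g x = v} \<notin> p" "{x. \<exists>v. {y. g (x + y) = v} \<in> p} \<notin> p"
    by blast
  then show ?thesis
  proof cases
    case 1
    show ?thesis
    proof (rule that, rule no_clique_strategyI[of "\<lambda>_. {x. g x = v}"])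
      fix d :: "nat \<Rightarrow> nat" and E
      assume "\<And>n. FS (d ` {n..}) \<subseteq> {x. g x = v}" "infinite E"
        and *: "\<And>a b. a \<in> E \<Longrightarrow> b \<in> E \<Longrightarrow> a < b \<Longrightarrow> \<exists>x\<in>FS (range d). g x = a \<and> h x = b"
      from this(1)[of 0] have "g x = v" if "x \<in> FS (range d)" for x using that by (auto simp: atLeast_0)
      \<comment> \<open>Members \<open>a < b < c\<close> of \<open>E\<close> would give edges
        \<open>(a, b)\<close> and \<open>(b, c)\<close>, and both left ends are
        \<open>v\<close>.\<close>
      then show False using three[OF \<open>infinite E\<close>] * by (metis less_irrefl)
    qed (use 1 in simp)
  next
    case 2
    obtain W where W: "\<And>P. finite P \<Longrightarrow> W P \<in> p"
      "\<And>(d :: nat \<Rightarrow> nat) x x'. strict_mono d \<Longrightarrow> (\<And>n. FS (d ` {n..}) \<subseteq> W (d ` {..<n})) \<Longrightarrow>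
        x \<in> FS (range d) \<Longrightarrow> x' \<in> FS (range d) \<Longrightarrow> h x \<noteq> g x'"
      using strategy_disjoint_vertices[OF gh 2] by metis
    show ?thesis
    proof (rule that, rule no_clique_strategyI[OF W(1)])
      fix d :: "nat \<Rightarrow> nat" and E
      assume d: "strict_mono d" "\<And>n. FS (d ` {n..}) \<subseteq> W (d ` {..<n})" "infinite E"
        and *: "\<And>a b. a \<in> E \<Longrightarrow> b \<in> E \<Longrightarrow> a < b \<Longrightarrow> \<exists>x\<in>FS (range d). g x = a \<and> h x = b"
      have "h x \<noteq> g x'" if "x \<in> FS (range d)" "x' \<in> FS (range d)" for x x'
        using W(2)[OF d(1,2) that] by blast
      \<comment> \<open>The middle one of three members of \<open>E\<close> would be a right end and
        a left end.\<close>
      then show False using three[OF d(3)] * by metis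
    qed
  next
    case 3
    define M where "M P = Max (insert 0 (h ` FS P))" for P
    have M: "h x \<le> M P" if "finite P" "x \<in> FS P" for x P
      unfolding M_def using that finite_FS by (intro Max_ge) auto
    define Good where "Good = {x. \<not> (\<exists>v. {y. g (x + y) = v} \<in> p)}"
    have Good: "Good \<in> p" unfolding Good_def using 3(2) by (rule Collect_not[THEN iffD2])
    \<comment> \<open>\<open>M P\<close> bounds the right ends of all sums over \<open>P\<close>.
      Hence the left end of a sum with last index \<open>n\<close> exceeds every right end formed
      before \<open>n\<close>.\<close>
    define W where "W P = {y. y \<in> Good \<and> M P < g y \<and> (\<forall>s\<in>FS P \<inter> Good. M P < g (s + y))}" for P
    show ?thesis
    proof (rule that, rule no_clique_strategyI[of W])
      fix P :: "nat set" assume "finite P"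
      then have "{y. \<forall>s\<in>FS P \<inter> Good. M P < g (s + y)} \<in> p"
        by (intro Collect_ball_finite) (auto simp: Good_def finite_FS Collect_gt_shift)
      moreover have "{y. M P < g y} \<in> p" using 3(1) by (rule eventually_gt)
      ultimately show "W P \<in> p" unfolding W_def using Good by (simp add: Collect_conj)
    next
      fix d :: "nat \<Rightarrow> nat" and E
      assume d: "strict_mono d" and W: "\<And>n. FS (d ` {n..}) \<subseteq> W (d ` {..<n})" and E: "infinite E"
        and *: "\<And>a b. a \<in> E \<Longrightarrow> b \<in> E \<Longrightarrow> a < b \<Longrightarrow> \<exists>x\<in>FS (range d). g x = a \<and> h x = b"
      have inj: "inj d" using d by (rule strict_mono_imp_inj_on)
      have FSGood: "FS (range d) \<subseteq> Good" using W[of 0] unfolding W_def by (auto simp: atLeast_0)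
      have dW: "d m \<in> W (d ` {..<m})" for m
        using W[of m] FS_singleton[of "d m" "d ` {m..}"] by auto
      have last: "\<exists>n. x \<in> FS (d ` {..<Suc n}) \<and> M (d ` {..<n}) < g x" if x: "x \<in> FS (range d)" for x
      proof -
        obtain n where n: "x \<in> FS (d ` {..<Suc n})" "x = d n \<or> (\<exists>s\<in>FS (d ` {..<n}). x = s + d n)"
          using x by (rule FS_split_last[OF inj])
        have "M (d ` {..<n}) < g x" using n(2)
        proof
          assume "\<exists>s\<in>FS (d ` {..<n}). x = s + d n"
          then obtain s where s: "s \<in> FS (d ` {..<n})" "x = s + d n" by blast
          then have "s \<in> FS (d ` {..<n}) \<inter> Good" using FSGood FS_mono[of "d ` {..<n}" "range d"] by blast
          then show ?thesis using dW[of n] s(2) unfolding W_def by blast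
        qed (use dW[of n] in \<open>auto simp: W_def\<close>)
        with n(1) show ?thesis by blast
      qed
      obtain a b where ab: "a \<in> E" "b \<in> E" "a < b" using three[OF E] by blast
      obtain x where x: "x \<in> FS (range d)" "g x = a" "h x = b" using *[OF ab] by blast
      obtain n where n: "x \<in> FS (d ` {..<Suc n})" using last[OF x(1)] by blast
      \<comment> \<open>The edge \<open>(a, b)\<close> comes from a sum with last index
        \<open>n\<close>. An edge \<open>(a, c)\<close> from a sum with a larger last index would
        have its left end \<open>a\<close> above \<open>b\<close>. So all edges starting at
        \<open>a\<close> come from the finitely many sums over the first \<open>Suc n\<close>
        terms.\<close>
      have "E \<subseteq> {..a} \<union> h ` FS (d ` {..<Suc n})"
      proof
        fix c assume c: "c \<in> E"
        show "c \<in> {..a} \<union> h ` FS (d ` {..<Suc n})"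
        proof (cases "c \<le> a")
          case False
          then obtain x' where x': "x' \<in> FS (range d)" "g x' = a" "h x' = c" using *[of a c] ab c by auto
          obtain n' where n': "x' \<in> FS (d ` {..<Suc n'})" "M (d ` {..<n'}) < g x'" using last[OF x'(1)] by blast
          have "n' \<le> n"
          proof (rule ccontr)
            assume "\<not> n' \<le> n"
            then have "FS (d ` {..<Suc n}) \<subseteq> FS (d ` {..<n'})" by (intro FS_mono) auto
            then have "h x \<le> M (d ` {..<n'})" using n(1) by (intro M) auto
            then show False using n'(2) x x' ab by simp
          qed
          then have "FS (d ` {..<Suc n'}) \<subseteq> FS (d ` {..<Suc n})" by (intro FS_mono) auto
          then show ?thesis using n'(1) x'(3) by blast
        qed simp
      qed
      then show False using E finite_FS by (meson finite_UnI finite_atMost finite_imageI finite_lessThan finite_subset)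
    qed
  qed
qed

end

section \<open>Functions on pairs with values in the natural numbers\<close>

text \<open>For \<open>e\<^sub>1, e\<^sub>2\<close> fixed and \<open>e\<close> large, the numbers \<open>e\<close>, \<open>e + e\<^sub>1\<close>, \<open>e + e\<^sub>2\<close>, \<open>e + e\<^sub>1 + e\<^sub>2\<close>
  would lie in one block.\<close>

lemma FS_not_subset_blocks:
  fixes B :: "nat \<Rightarrow> nat set"
  assumes fin: "\<And>n. finite (B n)"
    and growth: "\<And>m n x y. m < n \<Longrightarrow> x \<in> B m \<Longrightarrow> y \<in> B n \<Longrightarrow> 3 * x < y"
    and unique: "\<And>m n e x y. m < n \<Longrightarrow> e \<in> B m \<Longrightarrow> 0 < e \<Longrightarrow> x \<in> B n \<Longrightarrow> x + e \<in> B n \<Longrightarrow>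
      y \<in> B n \<Longrightarrow> y + e \<in> B n \<Longrightarrow> x = y"
    and E: "infinite E" "FS E \<subseteq> \<Union>(range B)"
  shows False
proof -
  obtain e1 where e1: "e1 \<in> E" "0 < e1" using E(1) by (metis infinite_nat_iff_unbounded)
  obtain e2 where e2: "e2 \<in> E" "e1 < e2" using E(1) by (metis infinite_nat_iff_unbounded)
  obtain m where m: "e1 \<in> B m" using E(2) FS_singleton[OF e1(1)] by blast
  let ?X = "{..e2} \<union> (\<Union>k\<le>m. B k)"
  have "infinite (E - ?X)" using E(1) fin by (intro Diff_infinite_finite) auto
  then obtain e where e: "e \<in> E" "e \<notin> ?X" by (metis Diff_iff finite.emptyI ex_in_conv)
  obtain n where n: "e \<in> B n" using E(2) FS_singleton[OF e(1)] by blast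
  have mn: "m < n" using n e(2) by (metis UnI2 UN_I atMost_iff not_less)
  have e2e: "e2 < e" using e(2) by simp
  \<comment> \<open>The factor 3 in \<open>growth\<close> is used here: all four numbers lie between
    \<open>e\<close> and \<open>e + e2 + e1 < 3 * e\<close>, so none can leave the block of
    \<open>e\<close>.\<close>
  have same: "y \<in> B n" if y: "y \<in> FS E" "e \<le> y" "y \<le> 3 * e" for y
  proof -
    obtain k where k: "y \<in> B k" using E(2) y by blast
    show ?thesis using growth[of k n y e] growth[of n k e y] k n y(2,3)
      by (cases k n rule: linorder_cases) auto
  qed
  have "e + e1 \<in> FS E" "e + e2 \<in> FS E" "e + e2 + e1 \<in> FS E"
    using FS_I[of "{e, e1}" E] FS_I[of "{e, e2}" E] FS_I[of "{e, e2, e1}" E] e1 e2 e2e e(1)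
    by (auto simp: add.assoc)
  then have "e + e1 \<in> B n" "e + e2 \<in> B n" "e + e2 + e1 \<in> B n"
    using same e1 e2 e2e by auto
  then show False using unique[OF mn m e1(2) n, of "e + e2"] e1 e2 by simp
qed

lemma FS_not_subset_sparse:
  fixes B :: "nat \<Rightarrow> nat set"
  assumes "\<And>n x y. x \<in> B n \<Longrightarrow> y \<in> B n \<Longrightarrow> x = y"
    and "\<And>m n x y. m < n \<Longrightarrow> x \<in> B m \<Longrightarrow> y \<in> B n \<Longrightarrow> 3 * x < y"
    and "infinite E" "FS E \<subseteq> \<Union>(range B)"
  shows False
proof (rule FS_not_subset_blocks[of B])
  show "finite (B n)" for n
    using assms(1) by (metis (full_types) finite.emptyI finite_insert finite_subset insertI1 subsetI)
qed (use assms in blast)+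

text \<open>In \<open>x2 + x3 = x1 + x4\<close> a term of largest absolute value cannot be balanced
  by three terms each less than a third of it. It must recur on the other side, and cancelling it
  leaves a trivial equation.\<close>

lemma dissociated_int:
  fixes x1 x2 x3 x4 :: int
  assumes sep: "\<And>x y. x \<in> {x1, x2, x3, x4} \<Longrightarrow> y \<in> {x1, x2, x3, x4} \<Longrightarrow>
      x = y \<or> 3 * \<bar>x\<bar> < \<bar>y\<bar> \<or> 3 * \<bar>y\<bar> < \<bar>x\<bar>"
    and eq: "x2 - x1 = x4 - x3"
  shows "x2 = x1 \<or> x1 = x3"
  using sep[of x1 x2] sep[of x1 x3] sep[of x1 x4] sep[of x2 x3] sep[of x2 x4] sep[of x3 x4] eq
  by (smt (verit) insert_iff)

context idempotent_ultra
begin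

text \<open>In contrast to \<open>no_clique_strategy\<close>, only the terms \<open>d n\<close>
  themselves are constrained and not their sums: the values to be controlled belong to pairs of
  terms.\<close>

definition no_FS_strategy :: "(nat \<Rightarrow> nat \<Rightarrow> nat) \<Rightarrow> (nat set \<Rightarrow> nat set) \<Rightarrow> bool" where
  "no_FS_strategy F W \<longleftrightarrow> (\<forall>P. finite P \<longrightarrow> W P \<in> p) \<and>
    (\<forall>(d :: nat \<Rightarrow> nat) E. (\<forall>n. d n \<in> W (d ` {..<n})) \<longrightarrow> infinite E \<longrightarrow>
      \<not> FS E \<subseteq> {F (d i) (d j) | i j. i < j})"

lemma no_FS_strategyI:
  assumes "\<And>P. finite P \<Longrightarrow> W P \<in> p"
    "\<And>(d :: nat \<Rightarrow> nat) E. (\<And>n. d n \<in> W (d ` {..<n})) \<Longrightarrow> infinite E \<Longrightarrow>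
      FS E \<subseteq> {F (d i) (d j) | i j. i < j} \<Longrightarrow> False"
  shows "no_FS_strategy F W"
  unfolding no_FS_strategy_def using assms by blast

text \<open>Three cases: \<open>F (d i) (d j)\<close> does not depend on \<open>d j\<close>, it has the form
  \<open>u (d j) + w (d i)\<close>, or the differences \<open>F (d i') (d j) - F (d i) (d j)\<close> tend to infinity
  with \<open>j\<close>.\<close>

lemma strategy_no_FS_first_coordinate:
  fixes F :: "nat \<Rightarrow> nat \<Rightarrow> nat"
  assumes "{a. \<exists>v. {b. F a b = v} \<in> p} \<in> p"
  obtains W where "no_FS_strategy F W"
proof -
  define g where "g a = (SOME v. {b. F a b = v} \<in> p)" for a
  define Good where "Good = {a. {b. F a b = g a} \<in> p}"
  have Good: "Good \<in> p" using assms
    by (rule mono) (auto simp: g_def Good_def intro: someI)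
  have Goodb: "{b. \<forall>a\<in>P \<inter> Good. F a b = g a} \<in> p" if "finite P" for P
    using that by (intro Collect_ball_finite) (auto simp: Good_def)
  show ?thesis
  proof (cases "\<exists>v. {a. g a = v} \<in> p")
    case True
    then obtain v where v: "{a. g a = v} \<in> p" by blast
    define W where "W P = {b. b \<in> Good \<and> g b = v \<and> (\<forall>a\<in>P \<inter> Good. F a b = g a)}" for P
    show ?thesis
    proof (rule that, rule no_FS_strategyI[of W])
      show "W P \<in> p" if "finite P" for P
        unfolding W_def using Good v Goodb[OF that] by (simp add: Collect_conj)
    next
      fix d :: "nat \<Rightarrow> nat" and E
      assume d: "\<And>n. d n \<in> W (d ` {..<n})" and E: "infinite E" "FS E \<subseteq> {F (d i) (d j) | i j. i < j}"
      have F: "F (d i) (d j) = v" if "i < j" for i j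
        using d[of i] d[of j] that unfolding W_def by auto
      have "E \<subseteq> {v}"
      proof
        fix x assume "x \<in> E"
        then have "x \<in> {F (d i) (d j) | i j. i < j}" using E(2) FS_singleton by blast
        then show "x \<in> {v}" using F by auto
      qed
      then show False using E(1) finite_subset by blast
    qed
  next
    case False
    define W where "W P = {b. b \<in> Good \<and> (\<forall>a\<in>P. 3 * g a < g b) \<and> (\<forall>a\<in>P \<inter> Good. F a b = g a)}" for P
    show ?thesis
    proof (rule that, rule no_FS_strategyI[of W])
      fix P :: "nat set" assume P: "finite P"
      have "{b. \<forall>a\<in>P. 3 * g a < g b} \<in> p"
        using P False by (intro Collect_ball_finite) (auto intro: eventually_gt)
      then show "W P \<in> p"
        unfolding W_def using Good Goodb[OF P] by (simp add: Collect_conj)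
    next
      fix d :: "nat \<Rightarrow> nat" and E
      assume d: "\<And>n. d n \<in> W (d ` {..<n})" and E: "infinite E" "FS E \<subseteq> {F (d i) (d j) | i j. i < j}"
      have F: "F (d i) (d j) = g (d i)" if "i < j" for i j
        using d[of i] d[of j] that unfolding W_def by auto
      have "{F (d i) (d j) | i j. i < j} \<subseteq> (\<Union>n. {g (d n)})" using F by auto
      with E(2) have "FS E \<subseteq> (\<Union>n. {g (d n)})" by (rule subset_trans)
      moreover have "3 * g (d m) < g (d n)" if "m < n" for m n
        using d[of n] that unfolding W_def by auto
      ultimately show False
        by (intro FS_not_subset_sparse[of "\<lambda>n. {g (d n)}", OF _ _ E(1)]) auto
    qed
  qed
qed

text \<open>If \<open>w\<close> is constant on a set of \<open>p\<close>, each value depends on the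
  larger index only and the values are made sparse. Otherwise the values with larger index
  \<open>n\<close> form a block, whose differences are differences of values of \<open>w\<close>.
  Making these grow by a factor 3 in absolute value ensures that a nonzero difference occurs at most
  once in a block.\<close>

lemma strategy_no_FS_sum:
  fixes F :: "nat \<Rightarrow> nat \<Rightarrow> nat" and u :: "nat \<Rightarrow> nat" and w :: "nat \<Rightarrow> int"
  assumes tends: "{a. \<forall>v. {b. F a b = v} \<notin> p} \<in> p"
    and u: "\<And>v. {b. u b = v} \<notin> p"
    and w: "{a. {b. int (F a b) = int (u b) + w a} \<in> p} \<in> p"
  obtains W where "no_FS_strategy F W"
proof -
  define Good where "Good = {a. {b. int (F a b) = int (u b) + w a} \<in> p \<and> (\<forall>v. {b. F a b = v} \<notin> p)}"
  have Good: "Good \<in> p" unfolding Good_def using w tends by (simp only: Collect_conj; simp)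
  have Goodb: "{b. \<forall>a\<in>P \<inter> Good. int (F a b) = int (u b) + w a} \<in> p" if "finite P" for P
    using that by (intro Collect_ball_finite) (auto simp: Good_def)
  show ?thesis
  proof (cases "\<exists>v. {a. w a = v} \<in> p")
    case True
    then obtain v where v: "{a. w a = v} \<in> p" by blast
    define W where "W P = {b. b \<in> Good \<and> w b = v \<and> (\<forall>a\<in>P \<inter> Good. int (F a b) = int (u b) + w a) \<and>
      (\<forall>a\<in>P. 3 * \<bar>int (u a) + v\<bar> < int (u b) + v)}" for P
    show ?thesis
    proof (rule that, rule no_FS_strategyI[of W])
      fix P :: "nat set" assume P: "finite P"
      have "{b. 3 * \<bar>int (u a) + v\<bar> < int (u b) + v} \<in> p" for a
        by (rule mono[OF eventually_gt[OF u, of "nat (3 * \<bar>int (u a) + v\<bar> - v)"]]) auto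
      then have "{b. \<forall>a\<in>P. 3 * \<bar>int (u a) + v\<bar> < int (u b) + v} \<in> p"
        using P by (intro Collect_ball_finite)
      then show "W P \<in> p"
        unfolding W_def using Good v Goodb[OF P] by (simp add: Collect_conj)
    next
      fix d :: "nat \<Rightarrow> nat" and E
      assume d: "\<And>n. d n \<in> W (d ` {..<n})" and E: "infinite E" "FS E \<subseteq> {F (d i) (d j) | i j. i < j}"
      let ?B = "\<lambda>n. {x. int x = int (u (d n)) + v}"
      have F: "int (F (d i) (d j)) = int (u (d j)) + v" if "i < j" for i j
        using d[of i] d[of j] that unfolding W_def by auto
      have "{F (d i) (d j) | i j. i < j} \<subseteq> (\<Union>n. ?B n)" using F by auto
      with E(2) have "FS E \<subseteq> (\<Union>n. ?B n)" by (rule subset_trans)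
      moreover have "3 * \<bar>int (u (d m)) + v\<bar> < int (u (d n)) + v" if "m < n" for m n
        using d[of n] that unfolding W_def by auto
      then have "3 * x < y" if "m < n" "x \<in> ?B m" "y \<in> ?B n" for m n x y
        using that by fastforce
      ultimately show False
        by (intro FS_not_subset_sparse[of ?B, OF _ _ E(1)]) auto
    qed
  next
    case False
    define W where "W P = {b. b \<in> Good \<and> (\<forall>a\<in>P \<inter> Good. int (F a b) = int (u b) + w a) \<and>
      (\<forall>a\<in>P. 3 * \<bar>w a\<bar> < \<bar>w b\<bar>) \<and> (\<forall>a\<in>P \<inter> Good. \<forall>i\<in>P. \<forall>j\<in>P. 3 * F i j < F a b)}" for P
    show ?thesis
    proof (rule that, rule no_FS_strategyI[of W])
      fix P :: "nat set" assume P: "finite P"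
      have "{b. \<forall>a\<in>P. 3 * \<bar>w a\<bar> < \<bar>w b\<bar>} \<in> p"
        using P False by (intro Collect_ball_finite) (auto intro: eventually_abs_gt)
      moreover have "{b. \<forall>a\<in>P \<inter> Good. \<forall>i\<in>P. \<forall>j\<in>P. 3 * F i j < F a b} \<in> p"
        using P by (intro Collect_ball_finite) (auto simp: Good_def intro: eventually_gt)
      ultimately show "W P \<in> p"
        unfolding W_def using Good Goodb[OF P] by (simp add: Collect_conj)
    next
      fix d :: "nat \<Rightarrow> nat" and E
      assume d: "\<And>n. d n \<in> W (d ` {..<n})" and E: "infinite E" "FS E \<subseteq> {F (d i) (d j) | i j. i < j}"
      define B where "B n = (\<lambda>i. F (d i) (d n)) ` {..<n}" for n
      have Fsum: "int (F (d i) (d j)) = int (u (d j)) + w (d i)" if "i < j" for i j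
        using d[of i] d[of j] that unfolding W_def by auto
      have sep: "3 * \<bar>w (d m)\<bar> < \<bar>w (d n)\<bar>" if "m < n" for m n
        using d[of n] that unfolding W_def by auto
      have growth: "3 * F (d i) (d m) < F (d j) (d n)" if "i < m" "m < n" "j < n" for i j m n
        using d[of n] d[of j] that unfolding W_def by auto
      show False
      proof (rule FS_not_subset_blocks[of B])
        show "finite (B n)" for n unfolding B_def by simp
        show "3 * x < y" if "m < n" "x \<in> B m" "y \<in> B n" for m n x y
          using that growth unfolding B_def by auto
        have "{F (d i) (d j) | i j. i < j} \<subseteq> \<Union>(range B)" unfolding B_def by auto
        with E(2) show "FS E \<subseteq> \<Union>(range B)" by (rule subset_trans)
        show "x = y" if "0 < e" and x: "x \<in> B n" "x + e \<in> B n" and y: "y \<in> B n" "y + e \<in> B n" for n e x y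
        proof -
          obtain i1 i2 where i: "i1 < n" "i2 < n" "x = F (d i1) (d n)" "x + e = F (d i2) (d n)"
            using x unfolding B_def by auto
          obtain i3 i4 where i': "i3 < n" "i4 < n" "y = F (d i3) (d n)" "y + e = F (d i4) (d n)"
            using y unfolding B_def by auto
          have "w (d i2) = w (d i1) \<or> w (d i1) = w (d i3)"
          proof (rule dissociated_int)
            show "w (d i2) - w (d i1) = w (d i4) - w (d i3)"
              using Fsum[OF i(1)] Fsum[OF i(2)] Fsum[OF i'(1)] Fsum[OF i'(2)] i i' by linarith
            have "w (d i) = w (d j) \<or> 3 * \<bar>w (d i)\<bar> < \<bar>w (d j)\<bar> \<or> 3 * \<bar>w (d j)\<bar> < \<bar>w (d i)\<bar>" for i j
              using sep[of i j] sep[of j i] by (cases i j rule: linorder_cases) auto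
            then show "a = b \<or> 3 * \<bar>a\<bar> < \<bar>b\<bar> \<or> 3 * \<bar>b\<bar> < \<bar>a\<bar>"
              if "a \<in> {w (d i1), w (d i2), w (d i3), w (d i4)}" "b \<in> {w (d i1), w (d i2), w (d i3), w (d i4)}" for a b
              using that by blast
          qed
          \<comment> \<open>The first alternative would give \<open>e = 0\<close>, the second one is
            \<open>x = y\<close>.\<close>
          then show ?thesis
            using Fsum[OF i(1)] Fsum[OF i(2)] Fsum[OF i'(1)] i i' \<open>0 < e\<close> by auto
        qed
      qed (rule E(1))
    qed
  qed
qed

text \<open>\<open>R a a'\<close> means that \<open>F a'\<close> and \<open>F a\<close> differ by a
  constant on a set of \<open>p\<close>. Terms are chosen pairwise unrelated, so each new
  \<open>b\<close> can be taken such that no difference \<open>F a' b - F a b\<close> with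
  \<open>a\<close>, \<open>a'\<close> already chosen is plus or minus an earlier value. Then an
  element of an earlier block is never a difference within a later one, and the uniqueness required
  of blocks holds vacuously.\<close>

lemma strategy_no_FS_dispersed:
  fixes F :: "nat \<Rightarrow> nat \<Rightarrow> nat"
  defines "R \<equiv> \<lambda>a a'. \<exists>z. {b. int (F a' b) - int (F a b) = z} \<in> p"
  assumes tends: "{a. \<forall>v. {b. F a b = v} \<notin> p} \<in> p"
    and disp: "\<And>a. \<forall>v. {b. F a b = v} \<notin> p \<Longrightarrow> {a'. R a a'} \<notin> p"
  obtains W where "no_FS_strategy F W"
proof -
  define Good where "Good = {a. \<forall>v. {b. F a b = v} \<notin> p}"
  have Good: "Good \<in> p" unfolding Good_def by (rule tends)
  define W where "W P = {b. b \<in> Good \<and> (\<forall>a\<in>P \<inter> Good. \<forall>i\<in>P. \<forall>j\<in>P. 3 * F i j < F a b) \<and>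
      (\<forall>a\<in>P \<inter> Good. \<not> R a b) \<and>
      (\<forall>a\<in>P. \<forall>a'\<in>P. \<forall>i\<in>P. \<forall>j\<in>P. \<not> R a a' \<longrightarrow>
        int (F a' b) - int (F a b) \<noteq> int (F i j) \<and> int (F a' b) - int (F a b) \<noteq> - int (F i j))}" for P
  show ?thesis
  proof (rule that, rule no_FS_strategyI[of W])
    fix P :: "nat set" assume P: "finite P"
    have "{b. \<forall>a\<in>P \<inter> Good. \<forall>i\<in>P. \<forall>j\<in>P. 3 * F i j < F a b} \<in> p"
      using P by (intro Collect_ball_finite) (auto simp: Good_def intro: eventually_gt)
    moreover have "{b. \<forall>a\<in>P \<inter> Good. \<not> R a b} \<in> p"
      using P disp by (intro Collect_ball_finite) (auto simp: Good_def Collect_not)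
    moreover have "{b. \<not> R a a' \<longrightarrow> int (F a' b) - int (F a b) \<noteq> x \<and> int (F a' b) - int (F a b) \<noteq> y} \<in> p"
      for a a' x y
    proof (cases "R a a'")
      case True
      then show ?thesis by (simp add: UNIV_mem)
    next
      case False
      then show ?thesis unfolding R_def by (simp add: Collect_conj Collect_not)
    qed
    then have "{b. \<forall>a\<in>P. \<forall>a'\<in>P. \<forall>i\<in>P. \<forall>j\<in>P. \<not> R a a' \<longrightarrow>
        int (F a' b) - int (F a b) \<noteq> int (F i j) \<and> int (F a' b) - int (F a b) \<noteq> - int (F i j)} \<in> p"
      using P by (intro Collect_ball_finite)
    ultimately show "W P \<in> p"
      unfolding W_def using Good by (simp only: Collect_conj; simp)
  next
    fix d :: "nat \<Rightarrow> nat" and E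
    assume d: "\<And>n. d n \<in> W (d ` {..<n})" and E: "infinite E" "FS E \<subseteq> {F (d i) (d j) | i j. i < j}"
    define B where "B n = (\<lambda>i. F (d i) (d n)) ` {..<n}" for n
    have growth: "3 * F (d i) (d m) < F (d j) (d n)" if "i < m" "m < n" "j < n" for i j m n
      using d[of n] d[of j] that unfolding W_def by auto
    have nR: "\<not> R (d i) (d j)" if "i < j" for i j
      using d[of j] d[of i] that unfolding W_def by auto
    have diff: "int (F (d i2) (d n)) - int (F (d i1) (d n)) \<noteq> int (F (d i) (d j)) \<and>
        int (F (d i2) (d n)) - int (F (d i1) (d n)) \<noteq> - int (F (d i) (d j))"
      if "i1 < i2" "i2 < n" "i < n" "j < n" for i1 i2 i j n
    proof -
      have "d i1 \<in> d ` {..<n}" "d i2 \<in> d ` {..<n}" "d i \<in> d ` {..<n}" "d j \<in> d ` {..<n}"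
        using that by auto
      then show ?thesis using d[of n] nR[OF that(1)] unfolding W_def by blast
    qed
    show False
    proof (rule FS_not_subset_blocks[of B])
      show "finite (B n)" for n unfolding B_def by simp
      show "3 * x < y" if "m < n" "x \<in> B m" "y \<in> B n" for m n x y
        using that growth unfolding B_def by auto
      have "{F (d i) (d j) | i j. i < j} \<subseteq> \<Union>(range B)" unfolding B_def by auto
      with E(2) show "FS E \<subseteq> \<Union>(range B)" by (rule subset_trans)
      show "x = y" if "m < n" "0 < e" "e \<in> B m" and x: "x \<in> B n" "x + e \<in> B n" for m n e x y
      proof -
        obtain i1 i2 where i: "i1 < n" "i2 < n" "x = F (d i1) (d n)" "x + e = F (d i2) (d n)"
          using x unfolding B_def by auto
        obtain j where j: "j < m" "e = F (d j) (d m)" using \<open>e \<in> B m\<close> unfolding B_def by auto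
        show ?thesis
          using diff[of i1 i2 n j m] diff[of i2 i1 n j m] i j \<open>m < n\<close> \<open>0 < e\<close>
          by (cases i1 i2 rule: linorder_cases) auto
      qed
    qed (rule E(1))
  qed
qed

lemma strategy_no_FS:
  fixes F :: "nat \<Rightarrow> nat \<Rightarrow> nat"
  obtains W where "no_FS_strategy F W"
proof (cases "{a. \<exists>v. {b. F a b = v} \<in> p} \<in> p")
  case True
  show ?thesis by (rule strategy_no_FS_first_coordinate[OF True]) (rule that)
next
  case False
  then have "{a. \<not> (\<exists>v. {b. F a b = v} \<in> p)} \<in> p" by (rule Collect_not[THEN iffD2])
  then have tends: "{a. \<forall>v. {b. F a b = v} \<notin> p} \<in> p" by simp
  let ?R = "\<lambda>a a'. \<exists>z. {b. int (F a' b) - int (F a b) = z} \<in> p"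
  show ?thesis
  proof (cases "\<exists>a. (\<forall>v. {b. F a b = v} \<notin> p) \<and> {a'. ?R a a'} \<in> p")
    case True
    then obtain a where a: "\<forall>v. {b. F a b = v} \<notin> p" "{a'. ?R a a'} \<in> p" by blast
    \<comment> \<open>The function \<open>F a\<close> of this one \<open>a\<close> serves as
      \<open>u\<close>: \<open>p\<close>-most rows are translates of it, and \<open>w a'\<close> is
      the amount of translation.\<close>
    define w where "w a' = (SOME z. {b. int (F a' b) - int (F a b) = z} \<in> p)" for a'
    have "{a'. {b. int (F a' b) - int (F a b) = w a'} \<in> p} \<in> p"
      using a(2) by (rule mono) (auto simp: w_def intro: someI)
    then have w: "{a'. {b. int (F a' b) = int (F a b) + w a'} \<in> p} \<in> p"
      by (simp add: algebra_simps)
    show ?thesis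
      by (rule strategy_no_FS_sum[OF tends a(1)[rule_format] w]) (rule that)
  next
    case False
    show ?thesis
    proof (rule strategy_no_FS_dispersed[OF tends])
      show "{a'. ?R a a'} \<notin> p" if "\<forall>v. {b. F a b = v} \<notin> p" for a
      proof
        assume "{a'. ?R a a'} \<in> p"
        with that have "\<exists>a. (\<forall>v. {b. F a b = v} \<notin> p) \<and> {a'. ?R a a'} \<in> p" by (intro exI conjI)
        with False show False by (rule notE)
      qed
    qed (rule that)
  qed
qed

end

section \<open>The space of an almost disjoint family\<close>

lemma openin_Psi_isolated:
  assumes "almost_disjoint_family \<Lambda> \<A>" "n \<in> \<Lambda>"
  shows "openin (Psi_space \<Lambda> \<A>) {Inl n}"
  unfolding openin_Psi_space[OF assms(1)] using assms(2) by auto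

lemma openin_Psi_member:
  assumes AD: "almost_disjoint_family \<Lambda> \<A>" and "A \<in> \<A>" "finite F"
  shows "openin (Psi_space \<Lambda> \<A>) (insert (Inr A) (Inl ` (A - F)))"
proof -
  have "A \<subseteq> \<Lambda>" using AD assms(2) unfolding almost_disjoint_family_def by blast
  then show ?thesis unfolding openin_Psi_space[OF AD] using assms(2,3) by auto
qed

lemmas openin_Psi_whole_member = openin_Psi_member[where F = "{}", simplified]

lemma Hausdorff_space_Psi:
  assumes AD: "almost_disjoint_family \<Lambda> \<A>"
  shows "Hausdorff_space (Psi_space \<Lambda> \<A>)"
  unfolding Hausdorff_space_def topspace_Psi_space[OF AD]
proof (intro allI impI)
  let ?X = "Psi_space \<Lambda> \<A>"
  let ?N = "\<lambda>A F. insert (Inr A) (Inl ` (A - F)) :: ('a + 'a set) set"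
  note oN = openin_Psi_member[OF AD] and oI = openin_Psi_isolated[OF AD]
  fix x y :: "'a + 'a set"
  assume xy: "x \<in> Inl ` \<Lambda> \<union> Inr ` \<A> \<and> y \<in> Inl ` \<Lambda> \<union> Inr ` \<A> \<and> x \<noteq> y"
  consider n m where "x = Inl n" "y = Inl m" "n \<in> \<Lambda>" "m \<in> \<Lambda>" "n \<noteq> m"
    | n A where "x = Inl n" "y = Inr A" "n \<in> \<Lambda>" "A \<in> \<A>"
    | n A where "y = Inl n" "x = Inr A" "n \<in> \<Lambda>" "A \<in> \<A>"
    | A B where "x = Inr A" "y = Inr B" "A \<in> \<A>" "B \<in> \<A>" "A \<noteq> B"
    using xy by (cases x; cases y) (auto simp: image_iff)
  then show "\<exists>U V. openin ?X U \<and> openin ?X V \<and> x \<in> U \<and> y \<in> V \<and> disjnt U V"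
  proof cases
    case (1 n m)
    then show ?thesis using oI by (intro exI[of _ "{Inl n}"] exI[of _ "{Inl m}"]) (auto simp: disjnt_def)
  next
    case (2 n A)
    then show ?thesis using oI oN[of A "{n}"]
      by (intro exI[of _ "{Inl n}"] exI[of _ "?N A {n}"]) (auto simp: disjnt_def)
  next
    case (3 n A)
    then show ?thesis using oI oN[of A "{n}"]
      by (intro exI[of _ "?N A {n}"] exI[of _ "{Inl n}"]) (auto simp: disjnt_def)
  next
    case (4 A B)
    then have "finite (A \<inter> B)" using AD unfolding almost_disjoint_family_def by blast
    then have "openin ?X (?N A (A \<inter> B)) \<and> openin ?X (?N B (A \<inter> B))" using oN 4(3,4) by blast
    moreover have "disjnt (?N A (A \<inter> B)) (?N B (A \<inter> B))" using 4(5) by (auto simp: disjnt_def)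
    ultimately show ?thesis
      unfolding 4(1,2) by (intro exI[of _ "?N A (A \<inter> B)"] exI[of _ "?N B (A \<inter> B)"]) simp
  qed
qed

lemma compactin_Psi_member:
  assumes AD: "almost_disjoint_family \<Lambda> \<A>" and A: "A \<in> \<A>"
  shows "compactin (Psi_space \<Lambda> \<A>) (insert (Inr A) (Inl ` A))"
  unfolding compactin_def
proof (intro conjI allI impI)
  show "insert (Inr A) (Inl ` A) \<subseteq> topspace (Psi_space \<Lambda> \<A>)"
    using AD A unfolding topspace_Psi_space[OF AD] almost_disjoint_family_def by auto
  fix \<U> assume U: "(\<forall>U\<in>\<U>. openin (Psi_space \<Lambda> \<A>) U) \<and> insert (Inr A) (Inl ` A) \<subseteq> \<Union>\<U>"
  then obtain U where U0: "U \<in> \<U>" "Inr A \<in> U" by blast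
  then have "openin (Psi_space \<Lambda> \<A>) U" using U by blast
  then obtain F where F: "finite F" "Inl ` (A - F) \<subseteq> U"
    using U0(2) A unfolding openin_Psi_space[OF AD] by blast
  have "\<forall>n\<in>A \<inter> F. \<exists>V\<in>\<U>. Inl n \<in> V" using U by blast
  then obtain c where c: "\<And>n. n \<in> A \<inter> F \<Longrightarrow> c n \<in> \<U> \<and> Inl n \<in> c n" by metis
  show "\<exists>\<F>. finite \<F> \<and> \<F> \<subseteq> \<U> \<and> insert (Inr A) (Inl ` A) \<subseteq> \<Union>\<F>"
    by (rule exI[of _ "insert U (c ` (A \<inter> F))"]) (use F U0 c in auto)
qed

text \<open>The space is covered by the isolated points and the open sets consisting of a member and
  its elements; a finite subcover yields \<open>\<C>\<close> and \<open>F\<close>. This describes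
  the neighbourhoods of infinity in \<open>nhds_Phi_infinity\<close>.\<close>

lemma compactin_Psi_subset:
  assumes AD: "almost_disjoint_family \<Lambda> \<A>" and C: "compactin (Psi_space \<Lambda> \<A>) C"
  obtains \<C> F where "finite \<C>" "\<C> \<subseteq> \<A>" "finite F" "C \<subseteq> Inl ` (\<Union>\<C> \<union> F) \<union> Inr ` \<C>"
proof -
  define g :: "'a + 'a set \<Rightarrow> ('a + 'a set) set"
    where "g z = (case z of Inl n \<Rightarrow> {Inl n} | Inr A \<Rightarrow> insert (Inr A) (Inl ` A))" for z
  let ?T = "Inl ` \<Lambda> \<union> Inr ` \<A>"
  have "\<forall>U\<in>g ` ?T. openin (Psi_space \<Lambda> \<A>) U"
    using openin_Psi_isolated[OF AD] openin_Psi_whole_member[OF AD] by (auto simp: g_def)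
  moreover have "C \<subseteq> \<Union>(g ` ?T)"
    using compactin_subset_topspace[OF C] unfolding topspace_Psi_space[OF AD]
    by (force simp: g_def split: sum.splits)
  ultimately obtain \<F> where F: "finite \<F>" "\<F> \<subseteq> g ` ?T" "C \<subseteq> \<Union>\<F>"
    using C unfolding compactin_def by meson
  then obtain Z where Z: "Z \<subseteq> ?T" "finite Z" "\<F> = g ` Z" by (meson finite_subset_image)
  show ?thesis
  proof (rule that[of "Inr -` Z" "Inl -` Z"])
    show "finite (Inr -` Z)" "finite (Inl -` Z)" using Z(2) by (auto intro: finite_vimageI)
    show "Inr -` Z \<subseteq> \<A>" using Z(1) by auto
    show "C \<subseteq> Inl ` (\<Union>(Inr -` Z) \<union> Inl -` Z) \<union> Inr ` (Inr -` Z)"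
    proof
      fix x assume "x \<in> C"
      then obtain z where z: "z \<in> Z" "x \<in> g z" using F(3) Z(3) by blast
      then show "x \<in> Inl ` (\<Union>(Inr -` Z) \<union> Inl -` Z) \<union> Inr ` (Inr -` Z)"
        by (cases z) (auto simp: g_def)
    qed
  qed
qed

lemma locally_compact_space_Psi:
  assumes AD: "almost_disjoint_family \<Lambda> \<A>"
  shows "locally_compact_space (Psi_space \<Lambda> \<A>)"
  unfolding locally_compact_space_def
proof
  fix x assume "x \<in> topspace (Psi_space \<Lambda> \<A>)"
  then consider n where "n \<in> \<Lambda>" "x = Inl n" | A where "A \<in> \<A>" "x = Inr A"
    unfolding topspace_Psi_space[OF AD] by auto
  then show "\<exists>U K. openin (Psi_space \<Lambda> \<A>) U \<and> compactin (Psi_space \<Lambda> \<A>) K \<and> x \<in> U \<and> U \<subseteq> K"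
  proof cases
    case (1 n)
    then have "openin (Psi_space \<Lambda> \<A>) {x} \<and> compactin (Psi_space \<Lambda> \<A>) {x}"
      using openin_Psi_isolated[OF AD] by (auto simp: topspace_Psi_space[OF AD])
    then show ?thesis by blast
  next
    case (2 A)
    let ?K = "insert (Inr A) (Inl ` A)"
    have "openin (Psi_space \<Lambda> \<A>) ?K" using AD 2(1) by (rule openin_Psi_whole_member)
    then show ?thesis using compactin_Psi_member[OF AD 2(1)] 2(2) by blast
  qed
qed

section \<open>The one-point compactification\<close>

lemma Hausdorff_space_Phi:
  "almost_disjoint_family \<Lambda> \<A> \<Longrightarrow> Hausdorff_space (Phi_space \<Lambda> \<A>)"
  unfolding Phi_space_def Hausdorff_space_Alexandroff_compactification
  using Hausdorff_space_Psi locally_compact_space_Psi by blast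

lemma compact_space_Phi: "compact_space (Phi_space \<Lambda> \<A>)"
  unfolding Phi_space_def by simp

lemma topspace_Phi:
  "almost_disjoint_family \<Lambda> \<A> \<Longrightarrow>
    topspace (Phi_space \<Lambda> \<A>) = insert None (Some ` (Inl ` \<Lambda> \<union> Inr ` \<A>))"
  unfolding Phi_space_def by (simp add: topspace_Psi_space)

lemma openin_Phi_isolated:
  assumes "almost_disjoint_family \<Lambda> \<A>" "n \<in> \<Lambda>"
  shows "openin (Phi_space \<Lambda> \<A>) {Some (Inl n)}"
  using openin_Alexandroff_compactification_image_Some[THEN iffD2, OF openin_Psi_isolated[OF assms]]
  unfolding Phi_space_def by simp

lemma openin_Phi_member:
  assumes AD: "almost_disjoint_family \<Lambda> \<A>" and A: "A \<in> \<A>"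
  shows "openin (Phi_space \<Lambda> \<A>) (Some ` insert (Inr A) (Inl ` A))"
  unfolding Phi_space_def openin_Alexandroff_compactification_image_Some
  using assms by (rule openin_Psi_whole_member)

lemma openin_Phi_remove_member:
  assumes AD: "almost_disjoint_family \<Lambda> \<A>" and A: "A \<in> \<A>"
  shows "openin (Phi_space \<Lambda> \<A>) (insert None (Some ` (Inl ` \<Lambda> \<union> Inr ` \<A> - insert (Inr A) (Inl ` A))))"
  using compactin_Psi_member[OF AD A]
    compactin_imp_closedin[OF Hausdorff_space_Psi[OF AD] compactin_Psi_member[OF AD A]]
  unfolding Phi_space_def openin_Alexandroff_compactification topspace_Psi_space[OF AD, symmetric]
  by blast

lemma nhds_Phi_member:
  assumes AD: "almost_disjoint_family \<Lambda> \<A>" and U: "openin (Phi_space \<Lambda> \<A>) U" "Some (Inr A) \<in> U"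
  obtains F where "finite F" "Some ` Inl ` (A - F) \<subseteq> U"
proof -
  have A: "A \<in> \<A>" using openin_subset[OF U(1)] U(2) topspace_Phi[OF AD] by auto
  define V where "V = Some -` U"
  have "openin (Psi_space \<Lambda> \<A>) V"
  proof -
    have "openin (Psi_space \<Lambda> \<A>) {x \<in> topspace (Psi_space \<Lambda> \<A>). Some x \<in> U}"
      using continuous_map_Some[of "Psi_space \<Lambda> \<A>"] U(1)
      unfolding continuous_map_def Phi_space_def by blast
    moreover have "V = {x \<in> topspace (Psi_space \<Lambda> \<A>). Some x \<in> U}"
      using openin_subset[OF U(1)] unfolding V_def topspace_Phi[OF AD] topspace_Psi_space[OF AD] by auto
    ultimately show ?thesis by simp
  qed
  then obtain F where "finite F" "Inl ` (A - F) \<subseteq> V"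
    using A U(2) unfolding openin_Psi_space[OF AD] V_def by blast
  then show ?thesis using that[of F] unfolding V_def by blast
qed

lemma nhds_Phi_infinity:
  assumes AD: "almost_disjoint_family \<Lambda> \<A>" and U: "openin (Phi_space \<Lambda> \<A>) U" "None \<in> U"
  obtains \<C> F where "finite \<C>" "\<C> \<subseteq> \<A>" "finite F"
    "insert None (Some ` (Inl ` (\<Lambda> - \<Union>\<C> - F) \<union> Inr ` (\<A> - \<C>))) \<subseteq> U"
proof -
  obtain C where C: "compactin (Psi_space \<Lambda> \<A>) C" "U = insert None (Some ` (topspace (Psi_space \<Lambda> \<A>) - C))"
    using U unfolding Phi_space_def openin_Alexandroff_compactification by blast
  obtain \<C> F where F: "finite \<C>" "\<C> \<subseteq> \<A>" "finite F" "C \<subseteq> Inl ` (\<Union>\<C> \<union> F) \<union> Inr ` \<C>"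
    using compactin_Psi_subset[OF AD C(1)] .
  have "Inl ` (\<Lambda> - \<Union>\<C> - F) \<union> Inr ` (\<A> - \<C>) \<subseteq> topspace (Psi_space \<Lambda> \<A>) - C"
    using F(4) unfolding topspace_Psi_space[OF AD] by auto
  then show ?thesis using that[OF F(1-3)] unfolding C(2) by blast
qed

lemma separable_space_Phi:
  assumes AD: "almost_disjoint_family \<Lambda> \<A>" and inf: "infinite \<A>"
  shows "separable_space (Phi_space \<Lambda> \<A>)"
  unfolding separable_space_def
proof (intro exI[of _ "Some ` Inl ` \<Lambda>"] conjI)
  show "countable (Some ` Inl ` \<Lambda>)" using AD unfolding almost_disjoint_family_def by blast
  show sub: "Some ` Inl ` \<Lambda> \<subseteq> topspace (Phi_space \<Lambda> \<A>)" unfolding topspace_Phi[OF AD] by auto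
  have meetA: "\<exists>n\<in>\<Lambda>. Some (Inl n) \<in> U" if U: "openin (Phi_space \<Lambda> \<A>) U" "Some (Inr A) \<in> U" for U A
  proof -
    obtain F where F: "finite F" "Some ` Inl ` (A - F) \<subseteq> U" using nhds_Phi_member[OF AD U] .
    have "A \<in> \<A>" using openin_subset[OF U(1)] U(2) topspace_Phi[OF AD] by auto
    then have "infinite (A - F)" "A \<subseteq> \<Lambda>" using AD F(1) unfolding almost_disjoint_family_def by auto
    then obtain n where "n \<in> A - F" by (metis ex_in_conv finite.emptyI)
    then show ?thesis using F(2) \<open>A \<subseteq> \<Lambda>\<close> by blast
  qed
  have meet: "\<exists>n\<in>\<Lambda>. Some (Inl n) \<in> U" if U: "openin (Phi_space \<Lambda> \<A>) U" "x \<in> U" for U x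
  proof -
    have "x \<in> topspace (Phi_space \<Lambda> \<A>)" using openin_subset[OF U(1)] U(2) by blast
    then consider "x = None" | n where "n \<in> \<Lambda>" "x = Some (Inl n)" | A where "x = Some (Inr A)"
      unfolding topspace_Phi[OF AD] by auto
    then show ?thesis
    proof cases
      case 1
      then obtain \<C> F where C: "finite \<C>" "\<C> \<subseteq> \<A>" "finite F"
        "insert None (Some ` (Inl ` (\<Lambda> - \<Union>\<C> - F) \<union> Inr ` (\<A> - \<C>))) \<subseteq> U"
        using nhds_Phi_infinity[OF AD U(1)] U(2) by metis
      \<comment> \<open>A neighbourhood of infinity omits only finitely many members; it contains
        another one, and each neighbourhood of that one meets \<Lambda>.\<close>
      have "infinite (\<A> - \<C>)" using inf C(1) by simp
      then obtain A where "A \<in> \<A> - \<C>" by (metis ex_in_conv finite.emptyI)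
      then have "Some (Inr A) \<in> U" using C(4) by blast
      then show ?thesis using meetA[OF U(1)] by blast
    qed (use U meetA in blast)+
  qed
  show "Phi_space \<Lambda> \<A> closure_of (Some ` Inl ` \<Lambda>) = topspace (Phi_space \<Lambda> \<A>)"
    unfolding dense_intersects_open
  proof (intro allI impI)
    fix U assume U: "openin (Phi_space \<Lambda> \<A>) U \<and> U \<noteq> {}"
    then obtain x where "x \<in> U" by blast
    then obtain n where "n \<in> \<Lambda>" "Some (Inl n) \<in> U" using meet[of U x] U by blast
    then show "Some ` Inl ` \<Lambda> \<inter> U \<noteq> {}" by (auto simp: image_iff)
  qed
qed

section \<open>The transfinite construction\<close>

text \<open>The order is a cardinal order on the index type, so every proper initial segment has
  smaller cardinality than the type. An uncountable segment would inject onto an uncountable set of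
  reals, have size continuum by CH, and be as large as the whole type.\<close>

lemma CH_wellorder:
  includes cardinal_syntax
  assumes CH: "continuum_hypothesis" and le: "(UNIV :: 'i set) \<lesssim> (UNIV :: real set)"
  obtains R :: "('i \<times> 'i) set"
  where "wf R" "\<forall>x y. x \<noteq> y \<longrightarrow> (x, y) \<in> R \<or> (y, x) \<in> R" "\<forall>x. countable {y. (y, x) \<in> R}"
proof -
  let ?r = "card_of (UNIV :: 'i set)"
  have wo: "well_order_on UNIV ?r" by (rule card_of_well_order_on)
  obtain j :: "'i \<Rightarrow> real" where j: "inj j" using le unfolding lepoll_def by blast
  have "countable (underS ?r x)" for x
  proof (rule ccontr)
    assume nc: "\<not> countable (underS ?r x)"
    have "|underS ?r x| <o ?r" by (rule card_of_underS[OF card_of_Card_order]) (simp add: Field_card_of)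
    moreover have "?r \<le>o |underS ?r x|"
    proof -
      have inj: "inj_on j (underS ?r x)" using j by (rule inj_on_subset) simp
      have "\<not> countable (j ` underS ?r x)" using nc inj countable_image_inj_on by blast
      then have "j ` underS ?r x \<approx> (UNIV :: real set)"
        using CH unfolding continuum_hypothesis_def by blast
      then have "(UNIV :: real set) \<lesssim> j ` underS ?r x" by (simp add: eqpoll_sym eqpoll_imp_lepoll)
      also have "j ` underS ?r x \<lesssim> underS ?r x" by (rule image_lepoll)
      finally have "(UNIV :: 'i set) \<lesssim> underS ?r x" using le lepoll_trans by blast
      then show ?thesis unfolding lepoll_def by (simp add: card_of_ordLeq[symmetric])
    qed
    ultimately show False using not_ordLess_ordLeq by blast
  qed
  then have "countable {y. (y, x) \<in> ?r - Id}" for x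
    unfolding underS_def by (simp add: conj_commute)
  moreover have "wf (?r - Id)" using wo unfolding well_order_on_def by blast
  moreover have "(x, y) \<in> ?r - Id \<or> (y, x) \<in> ?r - Id" if "x \<noteq> y" for x y
    using wo that unfolding well_order_on_def linear_order_on_def total_on_def by blast
  ultimately show ?thesis by (intro that[of "?r - Id"]) simp_all
qed

text \<open>A pair \<open>(f, S)\<close> is determined by the graph of \<open>f\<close> and the
  relation \<open>x \<in> S n\<close>, that is, by one subset of a countable set.\<close>

lemma index_lepoll_reals: "(UNIV :: ((nat \<Rightarrow> nat) \<times> (nat \<Rightarrow> nat set)) set) \<lesssim> (UNIV :: real set)"
proof -
  define \<phi> :: "(nat \<Rightarrow> nat) \<times> (nat \<Rightarrow> nat set) \<Rightarrow> ((nat \<times> nat) + (nat \<times> nat)) set"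
    where "\<phi> = (\<lambda>(f, S). {Inl (n, f n) | n. True} \<union> {Inr (n, x) | n x. x \<in> S n})"
  have \<phi>: "Inl (n, m) \<in> \<phi> (f, S) \<longleftrightarrow> m = f n" "Inr (n, m) \<in> \<phi> (f, S) \<longleftrightarrow> m \<in> S n" for f S n m
    by (auto simp: \<phi>_def)
  have "inj \<phi>"
  proof (rule injI)
    fix a b assume eq: "\<phi> a = \<phi> b"
    obtain f S g T where ab: "a = (f, S)" "b = (g, T)" by (cases a; cases b)
    have "f n = g n" for n using eq \<phi>(1)[of n "f n" f S] \<phi>(1)[of n "f n" g T] unfolding ab by simp
    moreover have "m \<in> S n \<longleftrightarrow> m \<in> T n" for n m
      using eq \<phi>(2)[of n m f S] \<phi>(2)[of n m g T] unfolding ab by simp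
    ultimately show "a = b" unfolding ab by (auto simp: fun_eq_iff)
  qed
  moreover have "inj (image (to_nat :: (nat \<times> nat) + (nat \<times> nat) \<Rightarrow> nat))"
    by (simp add: inj_image_eq_iff inj_on_def)
  ultimately have "inj (image to_nat \<circ> \<phi>)" by (rule inj_compose[rotated])
  then have "(UNIV :: ((nat \<Rightarrow> nat) \<times> (nat \<Rightarrow> nat set)) set) \<lesssim> (UNIV :: nat set set)"
    unfolding lepoll_def by blast
  then show ?thesis using nat_sets_eqpoll_reals lepoll_trans1 lepoll_trans2 by blast
qed

section \<open>Convergence along a set operation\<close>

definition convergence_space :: "(nat set \<Rightarrow> nat set) \<Rightarrow> 'a topology \<Rightarrow> bool" where
  "convergence_space \<rho> X \<longleftrightarrow>
    (\<forall>f :: nat \<Rightarrow> 'a. range f \<subseteq> topspace X \<longrightarrow>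
      (\<exists>D x. infinite D \<and> x \<in> topspace X \<and>
        (\<forall>U. openin X U \<and> x \<in> U \<longrightarrow> (\<exists>K. finite K \<and> f ` \<rho> (D - K) \<subseteq> U))))"

definition negligible_for :: "(nat set \<Rightarrow> nat set) \<Rightarrow> nat set \<Rightarrow> bool" where
  "negligible_for \<rho> A \<longleftrightarrow> (\<forall>E. infinite E \<longrightarrow> \<not> \<rho> E \<subseteq> A)"

text \<open>"Eventually along \<open>D\<close>": convergence to a point means that
  \<open>tail_in \<rho> D\<close> holds for the preimages of its neighbourhoods. By monotonicity of
  \<open>\<rho>\<close> such sets are closed under finite intersections.\<close>

definition tail_in :: "(nat set \<Rightarrow> nat set) \<Rightarrow> nat set \<Rightarrow> nat set \<Rightarrow> bool" where
  "tail_in \<rho> D S \<longleftrightarrow> (\<exists>K. finite K \<and> \<rho> (D - K) \<subseteq> S)"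

lemma tail_in_mono: "tail_in \<rho> D S \<Longrightarrow> S \<subseteq> T \<Longrightarrow> tail_in \<rho> D T"
  unfolding tail_in_def by blast

lemma tail_in_Int:
  assumes "mono \<rho>" "tail_in \<rho> D S" "tail_in \<rho> D T" shows "tail_in \<rho> D (S \<inter> T)"
proof -
  obtain K L where "finite K" "\<rho> (D - K) \<subseteq> S" "finite L" "\<rho> (D - L) \<subseteq> T"
    using assms(2,3) unfolding tail_in_def by blast
  moreover have "\<rho> (D - (K \<union> L)) \<subseteq> \<rho> (D - K)" "\<rho> (D - (K \<union> L)) \<subseteq> \<rho> (D - L)"
    by (rule monoD[OF assms(1)], blast)+
  ultimately show ?thesis unfolding tail_in_def by (intro exI[of _ "K \<union> L"]) auto
qed

lemma tail_in_INT:
  assumes "mono \<rho>" "finite I" "\<And>i. i \<in> I \<Longrightarrow> tail_in \<rho> D (S i)"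
  shows "tail_in \<rho> D (\<Inter>i\<in>I. S i)"
  using assms(2,3)
proof (induction I rule: finite_induct)
  case empty
  then show ?case unfolding tail_in_def by auto
next
  case (insert i I)
  then show ?case using tail_in_Int[OF assms(1)] by simp
qed

definition decided :: "(nat set \<Rightarrow> nat set) \<Rightarrow> nat set \<Rightarrow> nat set \<Rightarrow> bool" where
  "decided \<rho> D S \<longleftrightarrow> tail_in \<rho> D S \<or> tail_in \<rho> D (- S)"

text \<open>What the recursion asks of the two operations: \<open>decide\<close> supplies the set
  \<open>D\<close> of a stage, with negligible image, and \<open>select\<close> supplies the new
  member.\<close>

locale separating_pair =
  fixes \<rho> \<sigma> :: "nat set \<Rightarrow> nat set"
  assumes mono_\<rho>: "mono \<rho>"
    and decide: "\<And>(f :: nat \<Rightarrow> nat) S.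
      \<exists>D. infinite D \<and> (\<forall>n :: nat. decided \<rho> D (S n)) \<and> negligible_for \<sigma> (f ` \<rho> D)"
    and select: "\<And>E C. infinite E \<Longrightarrow> (\<And>n :: nat. negligible_for \<sigma> (C n)) \<Longrightarrow>
      \<exists>A. infinite A \<and> negligible_for \<sigma> A \<and> (\<forall>n. finite (A \<inter> C n)) \<and> (\<forall>K. finite K \<longrightarrow> A \<inter> \<sigma> (E - K) \<noteq> {})"
    and negligible_singleton: "\<And>n. negligible_for \<sigma> {n}"
begin

lemma negligible_empty: "negligible_for \<sigma> {}"
  using negligible_singleton unfolding negligible_for_def by blast

lemma decide_countable:
  assumes "countable \<S>"
  shows "\<exists>D. infinite D \<and> (\<forall>S\<in>\<S>. decided \<rho> D S) \<and> negligible_for \<sigma> (f ` \<rho> D)"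
proof -
  \<comment> \<open>Adjoining the empty set makes the family nonempty, so that it is the range of a
    sequence.\<close>
  define S where "S = from_nat_into (insert {} \<S>)"
  have S: "insert {} \<S> = range S" unfolding S_def using assms by (simp add: range_from_nat_into)
  obtain D where D: "infinite D" "\<forall>n. decided \<rho> D (S n)" "negligible_for \<sigma> (f ` \<rho> D)"
    using decide[of S f] by (elim exE conjE) (rule that)
  have "\<forall>X\<in>\<S>. decided \<rho> D X"
  proof
    fix X assume "X \<in> \<S>"
    then have "X \<in> range S" using S by blast
    then show "decided \<rho> D X" using D(2) by auto
  qed
  then show ?thesis using D(1,3) by (intro exI[of _ D]) simp
qed

lemma select_countable:
  assumes "infinite E" "countable \<C>" "\<forall>C\<in>\<C>. negligible_for \<sigma> C"
  shows "\<exists>A. infinite A \<and> negligible_for \<sigma> A \<and> (\<forall>C\<in>\<C>. finite (A \<inter> C)) \<and> (\<forall>K. finite K \<longrightarrow> A \<inter> \<sigma> (E - K) \<noteq> {})"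
proof -
  define C where "C = from_nat_into (insert {} \<C>)"
  have C: "insert {} \<C> = range C" unfolding C_def using assms(2) by (simp add: range_from_nat_into)
  have "negligible_for \<sigma> (C n)" for n
  proof -
    have "C n \<in> insert {} \<C>" unfolding C by simp
    then show ?thesis using assms(3) negligible_empty by auto
  qed
  from select[of E C, OF assms(1) this]
  obtain A where A: "infinite A" "negligible_for \<sigma> A" "\<forall>n. finite (A \<inter> C n)"
      "\<forall>K. finite K \<longrightarrow> A \<inter> \<sigma> (E - K) \<noteq> {}"
    by (elim exE conjE) (rule that)
  have "\<forall>X\<in>\<C>. finite (A \<inter> X)"
  proof
    fix X assume "X \<in> \<C>"
    then have "X \<in> range C" using C by blast
    then show "finite (A \<inter> X)" using A(3) by auto
  qed
  then show ?thesis using A by (intro exI[of _ A]) simp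
qed

text \<open>A stage is a pair \<open>(f, S)\<close>: \<open>f\<close> is the function to be handled and \<open>S\<close> lists the sets
  that \<open>D\<close> has to decide; \<open>S 0\<close> doubles as the set \<open>E\<close> such that the new member meets all
  \<open>\<sigma> (E - K)\<close>. A stage yields the new member and a negligible set \<open>B\<close> containing \<open>f ` \<rho> D\<close>.\<close>

lemma almost_disjoint_family_exists:
  assumes CH: "continuum_hypothesis"
  obtains \<A> where "almost_disjoint_family UNIV \<A>" "(UNIV :: real set) \<lesssim> \<A>"
    "\<forall>A\<in>\<A>. negligible_for \<sigma> A"
    "\<forall>E. infinite E \<longrightarrow> (\<exists>A\<in>\<A>. \<forall>K. finite K \<longrightarrow> A \<inter> \<sigma> (E - K) \<noteq> {})"
    "\<forall>(f :: nat \<Rightarrow> nat) S. \<exists>D. infinite D \<and> (\<forall>n :: nat. decided \<rho> D (S n)) \<and>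
      ((\<exists>v. tail_in \<rho> D (f -` {v})) \<or> (\<exists>A\<in>\<A>. tail_in \<rho> D (f -` A)) \<or> (\<forall>A\<in>\<A>. tail_in \<rho> D (- (f -` A))))"
proof -
  obtain R :: "(((nat \<Rightarrow> nat) \<times> (nat \<Rightarrow> nat set)) \<times> ((nat \<Rightarrow> nat) \<times> (nat \<Rightarrow> nat set))) set"
    where R: "wf R" and "\<forall>x y. x \<noteq> y \<longrightarrow> (x, y) \<in> R \<or> (y, x) \<in> R" "\<forall>x. countable {y. (y, x) \<in> R}"
    using CH_wellorder[OF CH index_lepoll_reals] .
  then have total: "x \<noteq> y \<Longrightarrow> (x, y) \<in> R \<or> (y, x) \<in> R" and ctbl: "countable {y. (y, x) \<in> R}" for x y
    by blast+
  define D_ok where "D_ok g i B D \<longleftrightarrow> infinite D \<and> (\<forall>n. decided \<rho> D (snd i n)) \<and>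
      (\<forall>v. decided \<rho> D (fst i -` {v})) \<and> (\<forall>j. (j, i) \<in> R \<longrightarrow> decided \<rho> D (fst i -` fst (g j))) \<and>
      fst i ` \<rho> D \<subseteq> B"
    for g :: "((nat \<Rightarrow> nat) \<times> (nat \<Rightarrow> nat set)) \<Rightarrow> nat set \<times> nat set" and i B D
  define P where "P g i r \<longleftrightarrow> infinite (fst r) \<and> negligible_for \<sigma> (fst r) \<and> negligible_for \<sigma> (snd r) \<and>
      finite (fst r \<inter> snd r) \<and>
      (\<forall>j. (j, i) \<in> R \<longrightarrow> finite (fst r \<inter> fst (g j)) \<and> finite (fst r \<inter> snd (g j))) \<and>
      (infinite (snd i 0) \<longrightarrow> (\<forall>K. finite K \<longrightarrow> fst r \<inter> \<sigma> (snd i 0 - K) \<noteq> {})) \<and> (\<exists>D. D_ok g i (snd r) D)"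
    for g :: "((nat \<Rightarrow> nat) \<times> (nat \<Rightarrow> nat set)) \<Rightarrow> nat set \<times> nat set" and i r
  have "\<exists>g. \<forall>i. P g i (g i)"
  proof (rule dependent_wf_choice[OF R])
    fix f g :: "((nat \<Rightarrow> nat) \<times> (nat \<Rightarrow> nat set)) \<Rightarrow> nat set \<times> nat set" and i r
    assume "\<And>z. (z, i) \<in> R \<Longrightarrow> f z = g z"
    then show "P f i r = P g i r" unfolding P_def D_ok_def by simp
  next
    fix i and g :: "((nat \<Rightarrow> nat) \<times> (nat \<Rightarrow> nat set)) \<Rightarrow> nat set \<times> nat set"
    assume IH: "\<And>j. (j, i) \<in> R \<Longrightarrow> P g j (g j)"
    let ?J = "{j. (j, i) \<in> R}"
    \<comment> \<open>Besides the given list, \<open>D\<close> decides the fibres of the function,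
      so that finitely many values can be discarded later, and the preimages of all earlier
      members.\<close>
    let ?S = "range (snd i) \<union> range (\<lambda>v. fst i -` {v}) \<union> (\<lambda>j. fst i -` fst (g j)) ` ?J"
    have "countable ?S" using ctbl by auto
    from decide_countable[OF this, of "fst i"]
    obtain D where D: "infinite D" "\<forall>S\<in>?S. decided \<rho> D S" "negligible_for \<sigma> (fst i ` \<rho> D)"
      by (elim exE conjE) (rule that)
    define B where "B = fst i ` \<rho> D"
    \<comment> \<open>If \<open>S 0\<close> is finite it imposes nothing; \<open>UNIV\<close> is a
      default that still lets the stage produce a member.\<close>
    define E where "E = (if infinite (snd i 0) then snd i 0 else UNIV)"
    let ?C = "insert B ((\<lambda>j. fst (g j)) ` ?J \<union> (\<lambda>j. snd (g j)) ` ?J)"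
    have cC: "countable ?C" using ctbl by auto
    have nC: "\<forall>C\<in>?C. negligible_for \<sigma> C"
      using IH D(3) unfolding P_def B_def by auto
    have "infinite E" unfolding E_def by simp
    from select_countable[OF this cC nC]
    obtain A where A: "infinite A" "negligible_for \<sigma> A" "\<forall>C\<in>?C. finite (A \<inter> C)"
      "\<forall>K. finite K \<longrightarrow> A \<inter> \<sigma> (E - K) \<noteq> {}"
      by (elim exE conjE) (rule that)
    have "D_ok g i B D" unfolding D_ok_def B_def using D(1,2) by simp
    then have "P g i (A, B)" using A D(3) unfolding P_def E_def B_def by auto
    then show "\<exists>r. P g i r" by blast
  qed
  then obtain g where "\<forall>i. P g i (g i)" by (rule exE)
  then have g: "P g i (g i)" for i by (rule spec)
  define \<A> where "\<A> = range (\<lambda>i. fst (g i))"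
  have inf: "infinite (fst (g i))" and neg: "negligible_for \<sigma> (fst (g i))"
    and AB: "finite (fst (g i) \<inter> snd (g i))" for i
    using g[of i] unfolding P_def by simp_all
  have later: "finite (fst (g i) \<inter> fst (g j))" "finite (fst (g i) \<inter> snd (g j))" if "(j, i) \<in> R" for i j
    using g[of i] that unfolding P_def by blast+
  have fin: "finite (fst (g i) \<inter> fst (g j))" if "i \<noteq> j" for i j
    using total[OF that] later(1)[of i j] later(1)[of j i] by (auto simp: Int_commute)
  have inj: "inj (\<lambda>i. fst (g i))"
    by (rule injI) (metis fin inf inf.idem)
  show ?thesis
  proof (rule that[of \<A>])
    show "almost_disjoint_family UNIV \<A>"
      unfolding almost_disjoint_family_def
    proof (intro conjI ballI impI)
      fix A B assume "A \<in> \<A>" "B \<in> \<A>" "A \<noteq> B"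
      then obtain i j where "A = fst (g i)" "B = fst (g j)" unfolding \<A>_def by blast
      with \<open>A \<noteq> B\<close> show "finite (A \<inter> B)" using fin[of i j] by metis
    qed (auto simp: \<A>_def inf)
    \<comment> \<open>The stages \<open>(id, \<lambda>_. X)\<close> alone yield continuum many
      distinct members.\<close>
    have "inj (\<lambda>X :: nat set. (id :: nat \<Rightarrow> nat, \<lambda>_ :: nat. X))" by (auto simp: inj_on_def fun_eq_iff)
    then have "inj ((\<lambda>i. fst (g i)) \<circ> (\<lambda>X. (id, \<lambda>_. X)))" by (rule inj_compose[OF inj])
    then have "(UNIV :: nat set set) \<lesssim> \<A>"
      unfolding lepoll_def \<A>_def by (intro exI conjI) auto
    then show "(UNIV :: real set) \<lesssim> \<A>"
      using nat_sets_eqpoll_reals lepoll_trans1 eqpoll_sym by blast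
    show "\<forall>A\<in>\<A>. negligible_for \<sigma> A" unfolding \<A>_def using neg by auto
    show "\<forall>E. infinite E \<longrightarrow> (\<exists>A\<in>\<A>. \<forall>K. finite K \<longrightarrow> A \<inter> \<sigma> (E - K) \<noteq> {})"
    proof (intro allI impI)
      fix E :: "nat set" assume "infinite E"
      then have "\<forall>K. finite K \<longrightarrow> fst (g (id, \<lambda>_. E)) \<inter> \<sigma> (E - K) \<noteq> {}"
        using g[of "(id, \<lambda>_. E)"] unfolding P_def by simp
      then show "\<exists>A\<in>\<A>. \<forall>K. finite K \<longrightarrow> A \<inter> \<sigma> (E - K) \<noteq> {}" unfolding \<A>_def by blast
    qed
    show "\<forall>(f :: nat \<Rightarrow> nat) S. \<exists>D. infinite D \<and> (\<forall>n :: nat. decided \<rho> D (S n)) \<and>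
      ((\<exists>v. tail_in \<rho> D (f -` {v})) \<or> (\<exists>A\<in>\<A>. tail_in \<rho> D (f -` A)) \<or> (\<forall>A\<in>\<A>. tail_in \<rho> D (- (f -` A))))"
    proof (intro allI)
      fix f :: "nat \<Rightarrow> nat" and S :: "nat \<Rightarrow> nat set"
      define i where "i = (f, S)"
      obtain D where "D_ok g i (snd (g i)) D" using g[of i] unfolding P_def by blast
      then have D: "infinite D" "\<forall>n. decided \<rho> D (S n)" "\<And>v. decided \<rho> D (f -` {v})"
        "\<And>j. (j, i) \<in> R \<Longrightarrow> decided \<rho> D (f -` fst (g j))" "f ` \<rho> D \<subseteq> snd (g i)"
        unfolding D_ok_def i_def by (simp_all del: split_paired_All)
      have "\<forall>A\<in>\<A>. tail_in \<rho> D (- (f -` A))"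
        if nv: "\<not> (\<exists>v. tail_in \<rho> D (f -` {v}))" and nA: "\<not> (\<exists>A\<in>\<A>. tail_in \<rho> D (f -` A))"
      proof
        fix A assume "A \<in> \<A>"
        then obtain k where k: "A = fst (g k)" unfolding \<A>_def by blast
        \<comment> \<open>The preimage of an earlier member was decided at stage \<open>i\<close>.
          The member of stage \<open>i\<close> or of a later one meets the set
          \<open>snd (g i)\<close> in finitely many points, and \<open>f\<close> eventually avoids
          each of them.\<close>
        show "tail_in \<rho> D (- (f -` A))"
        proof (cases "(k, i) \<in> R")
          case True
          then show ?thesis using D(4) nA \<open>A \<in> \<A>\<close> unfolding decided_def k by blast
        next
          case False
          then have "finite (A \<inter> snd (g i))"
            using total[of i k] later(2)[of i k] AB[of i] unfolding k by blast
          moreover have "tail_in \<rho> D (- (f -` {v}))" for v using D(3)[of v] nv unfolding decided_def by blast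
          ultimately have "tail_in \<rho> D (\<Inter>v\<in>A \<inter> snd (g i). - (f -` {v}))"
            by (intro tail_in_INT mono_\<rho>)
          moreover have "tail_in \<rho> D (f -` snd (g i))"
            unfolding tail_in_def using D(5) by (intro exI[of _ "{}"]) auto
          ultimately have "tail_in \<rho> D ((\<Inter>v\<in>A \<inter> snd (g i). - (f -` {v})) \<inter> f -` snd (g i))"
            by (rule tail_in_Int[OF mono_\<rho>])
          then show ?thesis by (rule tail_in_mono) auto
        qed
      qed
      then show "\<exists>D. infinite D \<and> (\<forall>n. decided \<rho> D (S n)) \<and>
        ((\<exists>v. tail_in \<rho> D (f -` {v})) \<or> (\<exists>A\<in>\<A>. tail_in \<rho> D (f -` A)) \<or> (\<forall>A\<in>\<A>. tail_in \<rho> D (- (f -` A))))"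
        using D(1,2) by (intro exI[of _ D]) argo
    qed
  qed
qed

end

context separating_pair
begin

text \<open>Unless \<open>f\<close> is eventually constant, it eventually avoids each single point.
  Then it converges to infinity if its values eventually lie outside \<Lambda>; otherwise the
  alternatives for \<open>h\<close> give the limit: an isolated point, a member, or
  infinity.\<close>

lemma convergence_space_Phi:
  assumes AD: "almost_disjoint_family UNIV \<A>"
    and fam: "\<forall>(f :: nat \<Rightarrow> nat) S. \<exists>D. infinite D \<and> (\<forall>n :: nat. decided \<rho> D (S n)) \<and>
      ((\<exists>v. tail_in \<rho> D (f -` {v})) \<or> (\<exists>A\<in>\<A>. tail_in \<rho> D (f -` A)) \<or> (\<forall>A\<in>\<A>. tail_in \<rho> D (- (f -` A))))"
  shows "convergence_space \<rho> (Phi_space UNIV \<A>)"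
  unfolding convergence_space_def
proof (intro allI impI)
  let ?X = "Phi_space UNIV \<A>"
  fix f :: "nat \<Rightarrow> (nat + nat set) option"
  assume f: "range f \<subseteq> topspace ?X"
  \<comment> \<open>The default 0 off \<open>I\<close> is harmless, since \<open>h\<close> is only
    evaluated on tails inside \<open>I\<close>.\<close>
  define h where "h x = (case f x of Some (Inl v) \<Rightarrow> v | _ \<Rightarrow> 0)" for x
  define I where "I = {x. \<exists>v. f x = Some (Inl v)}"
  have fI: "f x = Some (Inl (h x))" if "x \<in> I" for x using that unfolding I_def h_def by auto
  \<comment> \<open>The list starts with \<open>I\<close> and continues with the fibres of
    \<open>f\<close>; there are countably many, though the space is not countable.\<close>
  obtain D where D: "infinite D" "\<forall>n. decided \<rho> D (case n of 0 \<Rightarrow> I | Suc m \<Rightarrow> f -` {f m})"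
    and alt: "(\<exists>v. tail_in \<rho> D (h -` {v})) \<or> (\<exists>A\<in>\<A>. tail_in \<rho> D (h -` A)) \<or> (\<forall>A\<in>\<A>. tail_in \<rho> D (- (h -` A)))"
    using fam[THEN spec, of h, THEN spec, of "\<lambda>n. case n of 0 \<Rightarrow> I | Suc m \<Rightarrow> f -` {f m}"]
    by (elim exE conjE) (rule that)
  have dI: "decided \<rho> D I" using D(2)[THEN spec, of 0] by simp
  have dv: "decided \<rho> D (f -` {y})" for y
  proof (cases "y \<in> range f")
    case True
    then obtain m where "y = f m" by blast
    then show ?thesis using D(2)[THEN spec, of "Suc m"] by simp
  next
    case False
    then have "f -` {y} = {}" by blast
    then show ?thesis unfolding decided_def tail_in_def by auto
  qed
  define conv where "conv x \<longleftrightarrow> x \<in> topspace ?X \<and> (\<forall>U. openin ?X U \<and> x \<in> U \<longrightarrow> tail_in \<rho> D (f -` U))" for x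
  have const: "conv y" if "tail_in \<rho> D (f -` {y})" "y \<in> topspace ?X" for y
    unfolding conv_def using that by (auto elim: tail_in_mono)
  have "\<exists>x. conv x"
  proof (cases "\<exists>y\<in>topspace ?X. tail_in \<rho> D (f -` {y})")
    case True
    then show ?thesis using const by blast
  next
    case False
    then have avoid: "tail_in \<rho> D (- (f -` {y}))" if "y \<in> topspace ?X" for y
      using that dv[of y] unfolding decided_def by blast
    have avoidI: "tail_in \<rho> D (- (f -` {Some (Inl v)}))" for v
      by (rule avoid) (simp add: topspace_Phi[OF AD])
    have avoidF: "tail_in \<rho> D (\<Inter>v\<in>F. - (f -` {Some (Inl v)}))" if "finite F" for F
      using that avoidI by (intro tail_in_INT mono_\<rho>)
    show ?thesis
    proof (cases "tail_in \<rho> D I")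
      case tI: True
      consider v where "tail_in \<rho> D (h -` {v})" | A where "A \<in> \<A>" "tail_in \<rho> D (h -` A)"
        | "\<forall>A\<in>\<A>. tail_in \<rho> D (- (h -` A))"
        using alt by (elim disjE exE bexE)
      then show ?thesis
      proof cases
        case (1 v)
        then have "tail_in \<rho> D (I \<inter> h -` {v})" using tI by (intro tail_in_Int mono_\<rho>)
        then have "tail_in \<rho> D (f -` {Some (Inl v)})" by (rule tail_in_mono) (auto simp: fI)
        then have "conv (Some (Inl v))" by (rule const) (simp add: topspace_Phi[OF AD])
        then show ?thesis by (rule exI)
      next
        case (2 A)
        have "conv (Some (Inr A))"
          unfolding conv_def
        proof (intro conjI allI impI)
          show "Some (Inr A) \<in> topspace ?X" using 2(1) by (simp add: topspace_Phi[OF AD])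
          fix U assume "openin ?X U \<and> Some (Inr A) \<in> U"
          then obtain F where F: "finite F" "Some ` Inl ` (A - F) \<subseteq> U"
            using nhds_Phi_member[OF AD] by metis
          have "tail_in \<rho> D (I \<inter> (h -` A \<inter> (\<Inter>v\<in>F. - (f -` {Some (Inl v)}))))"
            using tI 2(2) avoidF[OF F(1)] by (intro tail_in_Int mono_\<rho>)
          then show "tail_in \<rho> D (f -` U)"
          proof (rule tail_in_mono, intro subsetI)
            fix x assume x: "x \<in> I \<inter> (h -` A \<inter> (\<Inter>v\<in>F. - (f -` {Some (Inl v)})))"
            then have "h x \<in> A - F" using fI[of x] by auto
            then show "x \<in> f -` U" using F(2) fI[of x] x by auto
          qed
        qed
        then show ?thesis by (rule exI)
      next
        case 3
        have "conv None"
          unfolding conv_def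
        proof (intro conjI allI impI)
          show "None \<in> topspace ?X" by (simp add: topspace_Phi[OF AD])
          fix U assume "openin ?X U \<and> None \<in> U"
          then obtain \<C> F where C: "finite \<C>" "\<C> \<subseteq> \<A>" "finite F"
            "insert None (Some ` (Inl ` (UNIV - \<Union>\<C> - F) \<union> Inr ` (\<A> - \<C>))) \<subseteq> U"
            using nhds_Phi_infinity[OF AD] by metis
          have "tail_in \<rho> D (\<Inter>A\<in>\<C>. - (h -` A))" using C(1,2) 3 by (intro tail_in_INT mono_\<rho>) auto
          then have "tail_in \<rho> D (I \<inter> ((\<Inter>A\<in>\<C>. - (h -` A)) \<inter> (\<Inter>v\<in>F. - (f -` {Some (Inl v)}))))"
            using tI avoidF[OF C(3)] by (intro tail_in_Int mono_\<rho>)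
          then show "tail_in \<rho> D (f -` U)"
          proof (rule tail_in_mono, intro subsetI)
            fix x assume x: "x \<in> I \<inter> ((\<Inter>A\<in>\<C>. - (h -` A)) \<inter> (\<Inter>v\<in>F. - (f -` {Some (Inl v)})))"
            then have "h x \<in> UNIV - \<Union>\<C> - F" using fI[of x] by auto
            then show "x \<in> f -` U" using C(4) fI[of x] x by auto
          qed
        qed
        then show ?thesis by (rule exI)
      qed
    next
      case False
      then have tI: "tail_in \<rho> D (- I)" using dI unfolding decided_def by blast
      have "conv None"
        unfolding conv_def
      proof (intro conjI allI impI)
        show "None \<in> topspace ?X" by (simp add: topspace_Phi[OF AD])
        fix U assume "openin ?X U \<and> None \<in> U"
        then obtain \<C> F where C: "finite \<C>" "\<C> \<subseteq> \<A>"
          "insert None (Some ` (Inl ` (UNIV - \<Union>\<C> - F) \<union> Inr ` (\<A> - \<C>))) \<subseteq> U"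
          using nhds_Phi_infinity[OF AD] by metis
        have "tail_in \<rho> D (\<Inter>A\<in>\<C>. - (f -` {Some (Inr A)}))"
          using C(1,2) by (intro tail_in_INT mono_\<rho> avoid) (auto simp: topspace_Phi[OF AD])
        with tI have "tail_in \<rho> D (- I \<inter> (\<Inter>A\<in>\<C>. - (f -` {Some (Inr A)})))"
          by (intro tail_in_Int mono_\<rho>)
        then show "tail_in \<rho> D (f -` U)"
        proof (rule tail_in_mono, intro subsetI)
          fix x assume x: "x \<in> - I \<inter> (\<Inter>A\<in>\<C>. - (f -` {Some (Inr A)}))"
          have "f x \<in> topspace ?X" using f by blast
          then consider "f x = None" | v where "f x = Some (Inl v)" | A where "f x = Some (Inr A)" "A \<in> \<A>"
            unfolding topspace_Phi[OF AD] by auto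
          then show "x \<in> f -` U"
          proof cases
            case 1
            then show ?thesis using C(3) by auto
          next
            case 2
            then show ?thesis using x unfolding I_def by auto
          next
            case (3 A)
            then have "A \<in> \<A> - \<C>" using x by auto
            then show ?thesis using C(3) 3 by auto
          qed
        qed
      qed
      then show ?thesis by (rule exI)
    qed
  qed
  then obtain x where x: "x \<in> topspace ?X" "\<forall>U. openin ?X U \<and> x \<in> U \<longrightarrow> tail_in \<rho> D (f -` U)"
    unfolding conv_def by (elim exE conjE) (rule that)
  have "\<forall>U. openin ?X U \<and> x \<in> U \<longrightarrow> (\<exists>K. finite K \<and> f ` \<rho> (D - K) \<subseteq> U)"
    using x(2) unfolding tail_in_def image_subset_iff_subset_vimage .
  then show "\<exists>D x. infinite D \<and> x \<in> topspace ?X \<and>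
      (\<forall>U. openin ?X U \<and> x \<in> U \<longrightarrow> (\<exists>K. finite K \<and> f ` \<rho> (D - K) \<subseteq> U))"
    using D(1) x(1) by (intro exI conjI)
qed

text \<open>The witness is the inclusion of the isolated points. A limit at a point of \<Lambda> or
  at a member is excluded by negligibility. A limit at infinity is excluded by the member hitting
  all \<open>\<sigma> (D - K)\<close>: removing it together with its elements leaves a neighbourhood
  of infinity.\<close>

lemma not_convergence_space_Phi:
  assumes AD: "almost_disjoint_family UNIV \<A>"
    and neg: "\<forall>A\<in>\<A>. negligible_for \<sigma> A"
    and hit: "\<forall>E. infinite E \<longrightarrow> (\<exists>A\<in>\<A>. \<forall>K. finite K \<longrightarrow> A \<inter> \<sigma> (E - K) \<noteq> {})"
  shows "\<not> convergence_space \<sigma> (Phi_space UNIV \<A>)"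
proof
  let ?X = "Phi_space UNIV \<A>"
  assume "convergence_space \<sigma> ?X"
  moreover have "range (\<lambda>n. Some (Inl n)) \<subseteq> topspace ?X" by (auto simp: topspace_Phi[OF AD])
  ultimately have "\<exists>D x. infinite D \<and> x \<in> topspace ?X \<and>
      (\<forall>U. openin ?X U \<and> x \<in> U \<longrightarrow> (\<exists>K. finite K \<and> (\<lambda>n. Some (Inl n)) ` \<sigma> (D - K) \<subseteq> U))"
    unfolding convergence_space_def by (elim allE impE)
  then obtain D x where D: "infinite D" and x: "x \<in> topspace ?X"
    and lim: "\<forall>U. openin ?X U \<and> x \<in> U \<longrightarrow> (\<exists>K. finite K \<and> (\<lambda>n. Some (Inl n)) ` \<sigma> (D - K) \<subseteq> U)"
    by (elim exE conjE) (rule that)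
  have limU: "\<exists>K. finite K \<and> \<sigma> (D - K) \<subseteq> {n. Some (Inl n) \<in> U}" if "openin ?X U" "x \<in> U" for U
    using lim[THEN spec, of U] that by (auto simp: image_subset_iff)
  have notneg: "\<not> negligible_for \<sigma> A" if "finite K" "\<sigma> (D - K) \<subseteq> A" for K A
    using that D unfolding negligible_for_def by (meson Diff_infinite_finite)
  consider "x = None" | n where "x = Some (Inl n)" | A where "x = Some (Inr A)" "A \<in> \<A>"
    using x unfolding topspace_Phi[OF AD] by auto
  then show False
  proof cases
    case 1
    from hit D obtain A where A: "A \<in> \<A>" "\<forall>K. finite K \<longrightarrow> A \<inter> \<sigma> (D - K) \<noteq> {}" by metis
    obtain K where K: "finite K" "\<sigma> (D - K) \<subseteq> {n. Some (Inl n) \<in>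
        insert None (Some ` (Inl ` UNIV \<union> Inr ` \<A> - insert (Inr A) (Inl ` A)))}"
      using limU[OF openin_Phi_remove_member[OF AD A(1)]] 1 by auto
    have "A \<inter> \<sigma> (D - K) = {}" using K(2) by auto
    then show False using A(2) K(1) by simp
  next
    case (2 n)
    obtain K where K: "finite K" "\<sigma> (D - K) \<subseteq> {m. Some (Inl m) \<in> {Some (Inl n)}}"
      using limU[OF openin_Phi_isolated[OF AD, of n]] 2 by auto
    then have "\<sigma> (D - K) \<subseteq> {n}" by auto
    then show False using notneg[OF K(1)] negligible_singleton by blast
  next
    case (3 A)
    obtain K where K: "finite K" "\<sigma> (D - K) \<subseteq> {m. Some (Inl m) \<in> Some ` insert (Inr A) (Inl ` A)}"
      using limU[OF openin_Phi_member[OF AD 3(2)]] 3 by auto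
    then have "\<sigma> (D - K) \<subseteq> A" by auto
    then show False using notneg[OF K(1)] neg 3(2) by blast
  qed
qed

lemma separating_space_exists:
  assumes CH: "continuum_hypothesis"
  shows "\<exists>\<A>. almost_disjoint_family (UNIV :: nat set) \<A> \<and> infinite \<A> \<and>
    Hausdorff_space (Phi_space UNIV \<A>) \<and> compact_space (Phi_space UNIV \<A>) \<and>
    separable_space (Phi_space UNIV \<A>) \<and> topspace (Phi_space UNIV \<A>) \<approx> (UNIV :: real set) \<and>
    convergence_space \<rho> (Phi_space UNIV \<A>) \<and> \<not> convergence_space \<sigma> (Phi_space UNIV \<A>)"
proof -
  obtain \<A> where AD: "almost_disjoint_family UNIV \<A>" and le: "(UNIV :: real set) \<lesssim> \<A>"
    and neg: "\<forall>A\<in>\<A>. negligible_for \<sigma> A"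
    and hit: "\<forall>E. infinite E \<longrightarrow> (\<exists>A\<in>\<A>. \<forall>K. finite K \<longrightarrow> A \<inter> \<sigma> (E - K) \<noteq> {})"
    and fam: "\<forall>(f :: nat \<Rightarrow> nat) S. \<exists>D. infinite D \<and> (\<forall>n :: nat. decided \<rho> D (S n)) \<and>
      ((\<exists>v. tail_in \<rho> D (f -` {v})) \<or> (\<exists>A\<in>\<A>. tail_in \<rho> D (f -` A)) \<or> (\<forall>A\<in>\<A>. tail_in \<rho> D (- (f -` A))))"
    by (rule almost_disjoint_family_exists[OF CH]) (rule that)
  have inf: "infinite \<A>"
  proof
    assume "finite \<A>"
    then have "finite (UNIV :: real set)" using le unfolding lepoll_def by (meson inj_on_finite)
    then show False using infinite_UNIV_char_0 by blast
  qed
  have "topspace (Phi_space UNIV \<A>) \<approx> (UNIV :: real set)"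
  proof (rule lepoll_antisym)
    \<comment> \<open>Membership of 0 and 1 tells the three kinds of points apart; the remaining
      information is shifted by 2.\<close>
    define \<psi> :: "(nat + nat set) option \<Rightarrow> nat set" where
      "\<psi> z = (case z of None \<Rightarrow> {0} | Some (Inl n) \<Rightarrow> {1, n + 2} | Some (Inr A) \<Rightarrow> {0, 1} \<union> (\<lambda>k. k + 2) ` A)" for z
    have "inj \<psi>"
    proof (rule injI)
      fix y z assume eq: "\<psi> y = \<psi> z"
      then have eq': "k \<in> \<psi> y \<longleftrightarrow> k \<in> \<psi> z" for k by simp
      show "y = z"
        using eq'[of 0] eq'[of 1] eq'[of "_ + 2"]
        by (fastforce simp: \<psi>_def split: option.splits sum.splits)
    qed
    then have "topspace (Phi_space UNIV \<A>) \<lesssim> (UNIV :: nat set set)"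
      unfolding lepoll_def by (meson inj_on_subset subset_UNIV)
    then show "topspace (Phi_space UNIV \<A>) \<lesssim> (UNIV :: real set)"
      using nat_sets_eqpoll_reals lepoll_trans2 by blast
    have "\<A> \<lesssim> topspace (Phi_space UNIV \<A>)"
      unfolding lepoll_def topspace_Phi[OF AD]
      by (intro exI[of _ "\<lambda>A. Some (Inr A)"]) (auto simp: inj_on_def)
    then show "(UNIV :: real set) \<lesssim> topspace (Phi_space UNIV \<A>)" using le lepoll_trans by blast
  qed
  then show ?thesis
    using AD inf Hausdorff_space_Phi[OF AD] compact_space_Phi[of UNIV \<A>] separable_space_Phi[OF AD inf]
      convergence_space_Phi[OF AD fam] not_convergence_space_Phi[OF AD neg hit]
    by (intro exI[of _ \<A>]) simp
qed

end

section \<open>Hindman, Ramsey and differentially compact spaces\<close>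

definition pair_codes :: "nat set \<Rightarrow> nat set" where
  "pair_codes D = set_encode ` nsets D 2"

lemma pair_codes_mono: "D \<subseteq> E \<Longrightarrow> pair_codes D \<subseteq> pair_codes E"
  unfolding pair_codes_def nsets_def by auto

lemma mem_pair_codesI: "a \<in> D \<Longrightarrow> b \<in> D \<Longrightarrow> a \<noteq> b \<Longrightarrow> set_encode {a, b} \<in> pair_codes D"
  unfolding pair_codes_def by (intro imageI) simp

lemma mem_pair_codesE:
  assumes "x \<in> pair_codes D"
  obtains a b where "a \<in> D" "b \<in> D" "a < b" "x = set_encode {a, b}"
proof -
  obtain e where e: "e \<in> nsets D 2" "x = set_encode e" using assms unfolding pair_codes_def by blast
  obtain a b where "e = {a, b}" "a \<in> D" "b \<in> D" "a < b" using e(1) unfolding ordered_nsets_2_eq by blast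
  then show ?thesis using that e(2) by blast
qed

lemma less_set_encode: "finite A \<Longrightarrow> a \<in> A \<Longrightarrow> a < set_encode A"
proof -
  assume "finite A" "a \<in> A"
  then have "2 ^ a \<le> set_encode A" unfolding set_encode_def by (intro member_le_sum) auto
  then show ?thesis using less_exp[of a] by linarith
qed

lemma set_encode_doubleton_inject:
  "set_encode {a, b} = set_encode {c, d} \<longleftrightarrow> {a, b} = {c, d}"
  by (metis set_encode_inverse finite.emptyI finite_insert)

lemma Ramsey_space_iff_convergence_space: "Ramsey_space X \<longleftrightarrow> convergence_space pair_codes X"
proof
  assume R: "Ramsey_space X"
  show "convergence_space pair_codes X"
    unfolding convergence_space_def
  proof (intro allI impI)
    fix f :: "nat \<Rightarrow> 'a" assume "range f \<subseteq> topspace X"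
    then have "(f \<circ> set_encode) ` nsets UNIV 2 \<subseteq> topspace X" by auto
    from R[unfolded Ramsey_space_def, THEN spec, THEN mp, OF this]
    show "\<exists>D x. infinite D \<and> x \<in> topspace X \<and>
        (\<forall>U. openin X U \<and> x \<in> U \<longrightarrow> (\<exists>K. finite K \<and> f ` pair_codes (D - K) \<subseteq> U))"
      by (simp only: pair_codes_def image_comp)
  qed
next
  assume C: "convergence_space pair_codes X"
  show "Ramsey_space X"
    unfolding Ramsey_space_def
  proof (intro allI impI)
    fix f :: "nat set \<Rightarrow> 'a" assume f: "f ` nsets UNIV 2 \<subseteq> topspace X"
    \<comment> \<open>On numbers that code no pair, \<open>g\<close> takes the value at
      \<open>{0, 1}\<close>, which keeps its range inside the space.\<close>
    define g where "g n = (if set_decode n \<in> nsets UNIV 2 then f (set_decode n) else f {0, 1})" for n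
    have "{0, 1} \<in> nsets (UNIV :: nat set) 2" by simp
    then have "range g \<subseteq> topspace X" using f unfolding g_def by auto
    from C[unfolded convergence_space_def, THEN spec, THEN mp, OF this]
    obtain D x where Dx: "infinite D" "x \<in> topspace X"
      "\<forall>U. openin X U \<and> x \<in> U \<longrightarrow> (\<exists>K. finite K \<and> g ` pair_codes (D - K) \<subseteq> U)"
      by (elim exE conjE) (rule that)
    have "g ` pair_codes E = f ` nsets E 2" for E
    proof -
      have "g (set_encode e) = f e" if "e \<in> nsets E 2" for e
        using that unfolding g_def nsets_def by auto
      then show ?thesis unfolding pair_codes_def image_image by (intro image_cong) auto
    qed
    then show "\<exists>D x. infinite D \<and> x \<in> topspace X \<and>
        (\<forall>U. openin X U \<and> x \<in> U \<longrightarrow> (\<exists>K. finite K \<and> f ` nsets (D - K) 2 \<subseteq> U))"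
      using Dx by (intro exI[of _ D] exI[of _ x]) simp
  qed
qed

lemma Hindman_space_iff_convergence_space: "Hindman_space X \<longleftrightarrow> convergence_space FS X"
  unfolding Hindman_space_def convergence_space_def ..

section \<open>Choice of a new member\<close>

lemma select_sparse:
  assumes mono: "mono \<sigma>"
    and union: "\<And>E C n. infinite E \<Longrightarrow> (\<And>i :: nat. negligible_for \<sigma> (C i)) \<Longrightarrow> \<not> \<sigma> E \<subseteq> (\<Union>i\<le>n. C i)"
    and big: "\<And>m x. x \<in> \<sigma> {m<..} \<Longrightarrow> m < x"
    and sparse: "\<And>a. (\<And>n :: nat. a (Suc n) \<in> \<sigma> {3 * a n<..}) \<Longrightarrow> negligible_for \<sigma> (range a)"
    and E: "infinite E" and C: "\<And>n :: nat. negligible_for \<sigma> (C n)"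
  shows "\<exists>A. infinite A \<and> negligible_for \<sigma> A \<and> (\<forall>n. finite (A \<inter> C n)) \<and> (\<forall>K. finite K \<longrightarrow> A \<inter> \<sigma> (E - K) \<noteq> {})"
proof -
  let ?P = "\<lambda>n x. x \<in> \<sigma> (E - {..n}) \<and> x \<notin> (\<Union>i\<le>n. C i)"
  have pick: "\<exists>y. y \<in> \<sigma> (E - {..m}) \<and> y \<notin> (\<Union>i\<le>n. C i)" for m n
  proof -
    have "infinite (E - {..m})" using E by simp
    then have "\<not> \<sigma> (E - {..m}) \<subseteq> (\<Union>i\<le>n. C i)" using C by (rule union)
    then show ?thesis by blast
  qed
  \<comment> \<open>The term \<open>a n\<close> lies beyond \<open>n\<close> in \<open>E\<close> and
    outside the first sets \<open>C i\<close>; this gives both the hits and the almost disjointness.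
    Sparseness is phrased as membership in \<open>\<sigma> {3 * a n<..}\<close> because for codes of
    pairs the vertices, and not just the code, have to lie beyond \<open>a n\<close>.\<close>
  have "\<exists>a. \<forall>n. ?P n (a n) \<and> a (Suc n) \<in> \<sigma> {3 * a n<..}"
  proof (rule dependent_nat_choice)
    show "\<exists>x. ?P 0 x" using pick[of 0 0] by blast
    fix x n
    let ?m = "max (Suc n) (3 * x)"
    obtain y where y: "y \<in> \<sigma> (E - {..?m})" "y \<notin> (\<Union>i\<le>Suc n. C i)" using pick[of ?m "Suc n"] by blast
    have "E - {..?m} \<subseteq> E - {..Suc n}" "E - {..?m} \<subseteq> {3 * x<..}" by auto
    then have "y \<in> \<sigma> (E - {..Suc n})" "y \<in> \<sigma> {3 * x<..}"
      using monoD[OF mono] y(1) by blast+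
    then show "\<exists>y. ?P (Suc n) y \<and> y \<in> \<sigma> {3 * x<..}" using y(2) by blast
  qed
  then obtain a where "\<forall>n. ?P n (a n) \<and> a (Suc n) \<in> \<sigma> {3 * a n<..}" by (rule exE)
  then have a: "a n \<in> \<sigma> (E - {..n})" "a n \<notin> (\<Union>i\<le>n. C i)" "a (Suc n) \<in> \<sigma> {3 * a n<..}" for n
    by blast+
  have "a n < a (Suc n)" for n using big[OF a(3)[of n]] by simp
  then have "strict_mono a" by (simp add: strict_mono_Suc_iff)
  then have inf: "infinite (range a)" using finite_imageD strict_mono_imp_inj_on by blast
  have "finite (range a \<inter> C n)" for n
  proof (rule finite_subset)
    have "k < n" if "a k \<in> C n" for k using a(2)[of k] that by (auto simp: not_le[symmetric])
    then show "range a \<inter> C n \<subseteq> a ` {..<n}" by auto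
  qed simp
  moreover have "range a \<inter> \<sigma> (E - K) \<noteq> {}" if "finite K" for K
  proof -
    obtain n where "K \<subseteq> {..n}" using \<open>finite K\<close> finite_nat_iff_bounded_le by blast
    then have "a n \<in> \<sigma> (E - K)" using a(1)[of n] monoD[OF mono, of "E - {..n}" "E - K"] by blast
    then show ?thesis by blast
  qed
  ultimately show ?thesis using inf sparse[of a, OF a(3)] by (intro exI[of _ "range a"]) simp
qed

lemma negligible_FS_singleton: "negligible_for FS {n}"
  unfolding negligible_for_def
proof (intro allI impI notI)
  fix E assume "infinite E" "FS E \<subseteq> {n}"
  then have "E \<subseteq> {n}" using FS_singleton by blast
  then show False using \<open>infinite E\<close> finite_subset by blast
qed

text \<open>Hindman's theorem: an idempotent ultrafilter containing \<open>FS E\<close> contains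
  some \<open>C i\<close>, and \<open>adaptive_Hindman\<close> with the constant strategy
  \<open>C i\<close> yields finite sums inside it.\<close>

lemma FS_not_subset_Union_negligible:
  assumes "infinite E" "\<And>i :: nat. negligible_for FS (C i)"
  shows "\<not> FS E \<subseteq> (\<Union>i\<le>n. C i)"
proof
  assume sub: "FS E \<subseteq> (\<Union>i\<le>n. C i)"
  obtain p where "idempotent_ultra p" and FSp: "\<And>K. finite K \<Longrightarrow> FS (E - K) \<in> p"
    using idempotent_ultra_exists[OF assms(1)] by metis
  then interpret idempotent_ultra p by simp
  have "FS E \<in> p" using FSp[of "{}"] by simp
  then have "{x. \<exists>i\<in>{..n}. x \<in> C i} \<in> p" by (rule mono) (use sub in auto)
  then obtain i where "C i \<in> p" using Collect_bex_finite[of "{..n}" "\<lambda>i x. x \<in> C i"] by auto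
  then have "\<forall>P :: nat set. finite P \<longrightarrow> C i \<in> p" by simp
  then obtain d :: "nat \<Rightarrow> nat" where d: "strict_mono d" "\<forall>n. FS (d ` {n..}) \<subseteq> C i"
    by (rule adaptive_Hindman)
  have "infinite (range d)" using d(1) finite_imageD strict_mono_imp_inj_on by blast
  then show False using assms(2)[of i] d(2)[THEN spec, of 0] unfolding negligible_for_def by (simp add: atLeast_0)
qed

lemma negligible_FS_sparse:
  assumes "\<And>n. a (Suc n) \<in> FS {3 * a n<..}"
  shows "negligible_for FS (range a)"
  unfolding negligible_for_def
proof (intro allI impI notI)
  fix E assume E: "infinite E" "FS E \<subseteq> range a"
  have step: "3 * a n < a (Suc n)" for n using FS_gt[OF assms[of n]] .
  have "3 * a m < a n" if "m < n" for m n
    using that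
  proof (induction n rule: less_induct)
    case (less n)
    then obtain k where k: "n = Suc k" by (cases n) auto
    show ?case
    proof (cases "m = k")
      case False
      then have "3 * a m < a k" using less k by simp
      then show ?thesis using step[of k] k by simp
    qed (use step k in simp)
  qed
  moreover have "FS E \<subseteq> (\<Union>n. {a n})" using E(2) by auto
  ultimately show False
    by (intro FS_not_subset_sparse[of "\<lambda>n. {a n}", OF _ _ E(1)]) auto
qed

lemma pair_codes_gt: "x \<in> pair_codes {m<..} \<Longrightarrow> m < x"
  by (erule mem_pair_codesE) (metis finite.emptyI finite.insertI greaterThan_iff insertI1 less_set_encode order.strict_trans)

lemma negligible_pair_codes_singleton: "negligible_for pair_codes {n}"
  unfolding negligible_for_def
proof (intro allI impI notI)
  fix E assume "infinite E" and sub: "pair_codes E \<subseteq> {n}"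
  obtain a b c where abc: "a \<in> E" "b \<in> E" "c \<in> E" "a < b" "b < c"
    using infinite_obtain_three[OF \<open>infinite E\<close>] .
  have "set_encode {a, b} \<in> {n}" "set_encode {b, c} \<in> {n}"
    by (rule subsetD[OF sub mem_pair_codesI]; use abc in simp)+
  then have "{a, b} = {b, c}" by (metis singletonD set_encode_doubleton_inject)
  then show False using abc by (auto simp: doubleton_eq_iff)
qed

text \<open>Ramsey's theorem for the colouring of a pair by the least \<open>i\<close> such that
  \<open>C i\<close> contains its code.\<close>

lemma pair_codes_not_subset_Union_negligible:
  assumes "infinite E" "\<And>i :: nat. negligible_for pair_codes (C i)"
  shows "\<not> pair_codes E \<subseteq> (\<Union>i\<le>n. C i)"
proof
  assume sub: "pair_codes E \<subseteq> (\<Union>i\<le>n. C i)"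
  define f where "f X = (LEAST i. set_encode X \<in> C i)" for X
  have f: "f X < Suc n \<and> set_encode X \<in> C (f X)" if "X \<subseteq> E" "finite X" "card X = 2" for X
  proof -
    have "set_encode X \<in> pair_codes E" using that unfolding pair_codes_def nsets_def by blast
    then obtain i where "i \<le> n" "set_encode X \<in> C i" using sub by blast
    then show ?thesis
      unfolding f_def using LeastI[of "\<lambda>i. set_encode X \<in> C i" i] Least_le[of "\<lambda>i. set_encode X \<in> C i" i] by simp
  qed
  then obtain Y t where Y: "Y \<subseteq> E" "infinite Y" "\<forall>X. X \<subseteq> Y \<and> finite X \<and> card X = 2 \<longrightarrow> f X = t"
    using Ramsey[OF assms(1), of 2 f "Suc n"] by metis
  have "pair_codes Y \<subseteq> C t"
  proof
    fix x assume "x \<in> pair_codes Y"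
    then obtain X where X: "X \<subseteq> Y" "finite X" "card X = 2" "x = set_encode X"
      unfolding pair_codes_def nsets_def by blast
    then have "f X = t" using Y(3) by blast
    then show "x \<in> C t" using f[of X] X Y(1) by auto
  qed
  then show False using assms(2)[of t] Y(2) unfolding negligible_for_def by blast
qed

text \<open>Two different pairs coded in the sequence have no common vertex: the vertices of the
  later one exceed the code of the earlier one, which in turn exceeds its own vertices. But
  \<open>E\<close> contains \<open>{e, f}\<close> and \<open>{e, g}\<close>.\<close>

lemma negligible_pair_codes_sparse:
  assumes a: "\<And>n. a (Suc n) \<in> pair_codes {3 * a n<..}"
  shows "negligible_for pair_codes (range a)"
  unfolding negligible_for_def
proof (intro allI impI notI)
  fix E assume "infinite E" and sub: "pair_codes E \<subseteq> range a"
  have "a n < a (Suc n)" for n using pair_codes_gt[OF a[of n]] by simp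
  then have sm: "strict_mono a" by (simp add: strict_mono_Suc_iff)
  have far: "a i < x" if ij: "i < j" and j: "a j = set_encode {x, y}" for i j x y
  proof -
    obtain k where k: "j = Suc k" using ij by (cases j) auto
    have ik: "a i \<le> a k" using sm ij k by (simp add: strict_mono_less_eq)
    obtain u v where uv: "u \<in> {3 * a k<..}" "v \<in> {3 * a k<..}" "a j = set_encode {u, v}"
      using a[of k] unfolding k by (rule mem_pair_codesE)
    then have "{u, v} = {x, y}" using j by (metis set_encode_doubleton_inject)
    then have "3 * a k < x" using uv(1,2) by (auto simp: doubleton_eq_iff)
    then show ?thesis using ik by simp
  qed
  obtain e f g where efg: "e \<in> E" "f \<in> E" "g \<in> E" "e < f" "f < g"
    using infinite_obtain_three[OF \<open>infinite E\<close>] .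
  obtain i where i: "a i = set_encode {e, f}" using sub mem_pair_codesI[of e E f] efg by (metis less_irrefl rangeE subsetD)
  obtain j where j: "a j = set_encode {e, g}" using sub mem_pair_codesI[of e E g] efg by (metis less_irrefl less_trans rangeE subsetD)
  have "e < a i" "e < a j" unfolding i j by (rule less_set_encode; simp)+
  moreover have "a i \<noteq> a j"
    unfolding i j set_encode_doubleton_inject using efg by (auto simp: doubleton_eq_iff)
  ultimately show False using far[of i j e g] far[of j i e f] i j by (cases i j rule: linorder_cases) auto
qed

lemma range_diff_initial:
  fixes d :: "nat \<Rightarrow> nat"
  assumes "strict_mono d" shows "range d - d ` {..<n} = d ` {n..}"
proof -
  have "inj d" using assms by (rule strict_mono_imp_inj_on)
  then have "range d - d ` {..<n} = d ` (UNIV - {..<n})" by (rule image_set_diff[symmetric])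
  also have "UNIV - {..<n} = {n..}" by auto
  finally show ?thesis .
qed

lemma card_initial:
  fixes d :: "nat \<Rightarrow> nat"
  assumes "strict_mono d" shows "card (d ` {..<n}) = n"
  using card_image[OF inj_on_subset[OF strict_mono_imp_inj_on[OF assms] subset_UNIV], of "{..<n}"] by simp

section \<open>The two separating pairs\<close>

interpretation FS_pair_codes: separating_pair FS pair_codes
proof
  show "mono FS" by (rule monoI) (rule FS_mono)
  show "negligible_for pair_codes {n}" for n by (rule negligible_pair_codes_singleton)
  show "\<exists>A. infinite A \<and> negligible_for pair_codes A \<and> (\<forall>n. finite (A \<inter> C n)) \<and>
      (\<forall>K. finite K \<longrightarrow> A \<inter> pair_codes (E - K) \<noteq> {})"
    if "infinite E" "\<And>n :: nat. negligible_for pair_codes (C n)" for E C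
    using that pair_codes_not_subset_Union_negligible pair_codes_gt negligible_pair_codes_sparse
    by (intro select_sparse) (auto simp: mono_def pair_codes_mono)
  fix f :: "nat \<Rightarrow> nat" and S :: "nat \<Rightarrow> nat set"
  obtain p where "idempotent_ultra p"
    using idempotent_ultra_exists[of "UNIV :: nat set"] by (metis infinite_UNIV_nat)
  then interpret idempotent_ultra p .
  define T where "T n = (if S n \<in> p then S n else - S n)" for n
  have T: "T n \<in> p" for n unfolding T_def using Compl_iff by simp
  \<comment> \<open>A value is read as the pair that it codes, with ends \<open>g x < h x\<close>.
    The defaults 0 and 1 preserve this inequality; the extra edge does no harm, since the graph need
    only contain the clique.\<close>
  define g where "g x = (if set_decode (f x) \<in> nsets UNIV 2 then Min (set_decode (f x)) else 0)" for x
  define h where "h x = (if set_decode (f x) \<in> nsets UNIV 2 then Max (set_decode (f x)) else 1)" for x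
  have gh: "g x < h x" for x
    unfolding g_def h_def by (auto elim!: nsets2_E simp: min_def max_def)
  obtain W where W: "no_clique_strategy g h W" using strategy_no_infinite_clique[OF gh] .
  \<comment> \<open>\<open>card P\<close> recovers the number of terms already chosen, so the set
    with index \<open>k\<close> is decided from step \<open>k\<close> on and each step faces
    finitely many constraints.\<close>
  define V where "V P = W P \<inter> {x. \<forall>k\<in>{..card P}. x \<in> T k}" for P
  have "\<forall>P. finite P \<longrightarrow> V P \<in> p"
    using W T unfolding V_def no_clique_strategy_def Int_iff by (auto intro: Collect_ball_finite)
  then obtain d :: "nat \<Rightarrow> nat" where d: "strict_mono d" "\<forall>n. FS (d ` {n..}) \<subseteq> V (d ` {..<n})"
    by (rule adaptive_Hindman)
  note card = card_initial[OF d(1)]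
  show "\<exists>D. infinite D \<and> (\<forall>n. decided FS D (S n)) \<and> negligible_for pair_codes (f ` FS D)"
  proof (intro exI[of _ "range d"] conjI allI)
    show "infinite (range d)" using d(1) finite_imageD strict_mono_imp_inj_on by blast
    fix n
    have "FS (range d - d ` {..<n}) \<subseteq> T n"
      unfolding range_diff_initial[OF d(1)] using d(2)[THEN spec, of n] unfolding V_def card by auto
    then have "tail_in FS (range d) (T n)" unfolding tail_in_def by (intro exI[of _ "d ` {..<n}"]) simp
    then show "decided FS (range d) (S n)" unfolding decided_def T_def by (auto split: if_splits)
  next
    show "negligible_for pair_codes (f ` FS (range d))"
      unfolding negligible_for_def
    proof (intro allI impI notI)
      fix E assume E: "infinite E" and sub: "pair_codes E \<subseteq> f ` FS (range d)"
      have clique: "\<exists>x\<in>FS (range d). g x = a \<and> h x = b" if ab: "a \<in> E" "b \<in> E" "a < b" for a b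
      proof -
        have "set_encode {a, b} \<in> f ` FS (range d)" using sub mem_pair_codesI[of a E b] ab by auto
        then obtain x where x: "x \<in> FS (range d)" "f x = set_encode {a, b}" by auto
        then have "set_decode (f x) = {a, b}" by simp
        then have "g x = a \<and> h x = b" unfolding g_def h_def using ab(3) by simp
        then show ?thesis using x(1) by blast
      qed
      have "\<forall>n. FS (d ` {n..}) \<subseteq> W (d ` {..<n})" using d(2) unfolding V_def by simp
      moreover have "\<forall>a\<in>E. \<forall>b\<in>E. a < b \<longrightarrow> (\<exists>x\<in>FS (range d). g x = a \<and> h x = b)"
        using clique by simp
      ultimately show False
        using W[unfolded no_clique_strategy_def, THEN conjunct2, THEN spec, of d, THEN spec, of E] d(1) E by argo
    qed
  qed
qed

interpretation pair_codes_FS: separating_pair pair_codes FS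
proof
  show "mono pair_codes" by (rule monoI) (rule pair_codes_mono)
  show "negligible_for FS {n}" for n by (rule negligible_FS_singleton)
  show "\<exists>A. infinite A \<and> negligible_for FS A \<and> (\<forall>n. finite (A \<inter> C n)) \<and>
      (\<forall>K. finite K \<longrightarrow> A \<inter> FS (E - K) \<noteq> {})"
    if "infinite E" "\<And>n :: nat. negligible_for FS (C n)" for E C
    using that FS_not_subset_Union_negligible FS_gt negligible_FS_sparse
    by (intro select_sparse) (auto simp: mono_def FS_mono)
  fix f :: "nat \<Rightarrow> nat" and S :: "nat \<Rightarrow> nat set"
  obtain p where "idempotent_ultra p"
    using idempotent_ultra_exists[of "UNIV :: nat set"] by (metis infinite_UNIV_nat)
  then interpret idempotent_ultra p .
  \<comment> \<open>Here \<open>S n\<close> or its complement is chosen by the iterated quantifier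
    over pairs.\<close>
  define T where "T n = (if {a. {b. set_encode {a, b} \<in> S n} \<in> p} \<in> p then S n else - S n)" for n
  define c where "c k a = {b. set_encode {a, b} \<in> T k}" for k a
  have c: "{a. c k a \<in> p} \<in> p" for k
    unfolding c_def T_def by (simp add: Collect_not)
  obtain W where W: "no_FS_strategy (\<lambda>a b. f (set_encode {a, b})) W"
    using strategy_no_FS .
  \<comment> \<open>The ultrafilter proof of Ramsey's theorem: a new term is itself typical for the
    sets considered so far, and it lies in the sets \<open>c k a\<close> of the earlier typical
    terms.\<close>
  define V where "V P = {b. \<forall>k\<in>{..card P}. c k b \<in> p} \<inter>
    {b. \<forall>a\<in>P. \<forall>k\<in>{..card P}. c k a \<in> p \<longrightarrow> b \<in> c k a}" for P
  have cc: "{b. c k a \<in> p \<longrightarrow> b \<in> c k a} \<in> p" for k a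
    by (cases "c k a \<in> p") (simp_all add: UNIV_mem)
  have "\<forall>P. finite P \<longrightarrow> W P \<inter> V P \<in> p"
    using W c cc unfolding V_def no_FS_strategy_def Int_iff
    by (intro allI impI conjI Collect_ball_finite) simp_all
  then obtain d :: "nat \<Rightarrow> nat" where d: "strict_mono d" "\<forall>n. FS (d ` {n..}) \<subseteq> W (d ` {..<n}) \<inter> V (d ` {..<n})"
    by (rule adaptive_Hindman)
  have dW: "d n \<in> W (d ` {..<n})" and dV: "d n \<in> V (d ` {..<n})" for n
    using d(2)[THEN spec, of n] FS_singleton[of "d n" "d ` {n..}"] by auto
  note card = card_initial[OF d(1)]
  show "\<exists>D. infinite D \<and> (\<forall>n. decided pair_codes D (S n)) \<and> negligible_for FS (f ` pair_codes D)"
  proof (intro exI[of _ "range d"] conjI allI)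
    show "infinite (range d)" using d(1) finite_imageD strict_mono_imp_inj_on by blast
    fix n
    have "pair_codes (range d - d ` {..<n}) \<subseteq> T n"
      unfolding range_diff_initial[OF d(1)]
    proof
      fix x assume "x \<in> pair_codes (d ` {n..})"
      then obtain u v where "u \<in> d ` {n..}" "v \<in> d ` {n..}" "u < v" "x = set_encode {u, v}"
        by (rule mem_pair_codesE)
      then obtain i j where ij: "n \<le> i" "n \<le> j" "d i < d j" "x = set_encode {d i, d j}" by auto
      then have "i < j" using d(1) by (simp add: strict_mono_less)
      have "c n (d i) \<in> p" using dV[of i] ij(1) unfolding V_def card by auto
      then have "d j \<in> c n (d i)" using dV[of j] ij(2) \<open>i < j\<close> unfolding V_def card by auto
      then show "x \<in> T n" unfolding c_def ij(4) by simp
    qed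
    then have "tail_in pair_codes (range d) (T n)" unfolding tail_in_def by (intro exI[of _ "d ` {..<n}"]) simp
    then show "decided pair_codes (range d) (S n)" unfolding decided_def T_def by (auto split: if_splits)
  next
    show "negligible_for FS (f ` pair_codes (range d))"
      unfolding negligible_for_def
    proof (intro allI impI notI)
      fix E assume E: "infinite E" and sub: "FS E \<subseteq> f ` pair_codes (range d)"
      have "f ` pair_codes (range d) \<subseteq> {f (set_encode {d i, d j}) | i j. i < j}"
      proof
        fix x assume "x \<in> f ` pair_codes (range d)"
        then obtain y where y: "y \<in> pair_codes (range d)" "x = f y" by blast
        then obtain u v where "u \<in> range d" "v \<in> range d" "u < v" "y = set_encode {u, v}"
          using mem_pair_codesE by metis
        then obtain i j where ij: "d i < d j" "y = set_encode {d i, d j}" by auto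
        then have "i < j" using d(1) by (simp add: strict_mono_less)
        then show "x \<in> {f (set_encode {d i, d j}) | i j. i < j}" using ij(2) y(2) by blast
      qed
      with sub have "FS E \<subseteq> {f (set_encode {d i, d j}) | i j. i < j}" by (rule subset_trans)
      then show False
        using W[unfolded no_FS_strategy_def, THEN conjunct2, THEN spec, of d, THEN spec, of E] dW E by simp
    qed
  qed
qed

lemma Ramsey_space_imp_differentially_compact:
  assumes "Ramsey_space X" shows "differentially_compact_space X"
  unfolding differentially_compact_space_def
proof (intro allI impI)
  fix f :: "nat \<Rightarrow> 'a" assume "range f \<subseteq> topspace X"
  then have "(\<lambda>e. f (Max e - Min e)) ` nsets UNIV 2 \<subseteq> topspace X" by auto
  from assms[unfolded Ramsey_space_def, THEN spec, THEN mp, OF this]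
  obtain D x where Dx: "infinite D" "x \<in> topspace X"
    "\<forall>U. openin X U \<and> x \<in> U \<longrightarrow> (\<exists>K. finite K \<and> (\<lambda>e. f (Max e - Min e)) ` nsets (D - K) 2 \<subseteq> U)"
    by (elim exE conjE) (rule that)
  have sub: "f ` Delta E \<subseteq> (\<lambda>e. f (Max e - Min e)) ` nsets E 2" for E
  proof
    fix y assume "y \<in> f ` Delta E"
    then obtain a b where ab: "y = f (a - b)" "a \<in> E" "b \<in> E" "b < a" unfolding Delta_def by blast
    then have "Max {b, a} = a" "Min {b, a} = b" by auto
    then have "y = f (Max {b, a} - Min {b, a})" using ab(1) by simp
    moreover have "{b, a} \<in> nsets E 2" using ab by simp
    ultimately show "y \<in> (\<lambda>e. f (Max e - Min e)) ` nsets E 2" by (rule image_eqI)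
  qed
  have "\<forall>U. openin X U \<and> x \<in> U \<longrightarrow> (\<exists>K. finite K \<and> f ` Delta (D - K) \<subseteq> U)"
    using Dx(3) sub by (meson subset_trans)
  then show "\<exists>D x. infinite D \<and> x \<in> topspace X \<and>
      (\<forall>U. openin X U \<and> x \<in> U \<longrightarrow> (\<exists>K. finite K \<and> f ` Delta (D - K) \<subseteq> U))"
    using Dx(1,2) by (intro exI conjI)
qed

text \<open>A difference of two partial sums of an enumeration of \<open>D\<close> is a sum over an
  interval of indices, so \<open>Delta\<close> of the partial sums lies in \<open>FS D\<close>, and
  tails go to tails.\<close>

lemma Hindman_space_imp_differentially_compact:
  assumes "Hindman_space X" shows "differentially_compact_space X"
  unfolding differentially_compact_space_def
proof (intro allI impI)
  fix f :: "nat \<Rightarrow> 'a" assume "range f \<subseteq> topspace X"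
  from assms[unfolded Hindman_space_def, THEN spec, THEN mp, OF this]
  obtain D x where D: "infinite D" and x: "x \<in> topspace X"
    "\<forall>U. openin X U \<and> x \<in> U \<longrightarrow> (\<exists>K. finite K \<and> f ` FS (D - K) \<subseteq> U)"
    by (elim exE conjE) (rule that)
  define d where "d = enumerate D"
  have sm: "strict_mono d" and dD: "range d = D"
    unfolding d_def using strict_mono_enumerate[OF D] range_enumerate[OF D] by auto
  have inj: "inj d" using sm by (rule strict_mono_imp_inj_on)
  define s where "s n = (\<Sum>i<Suc n. d i)" for n
  \<comment> \<open>The set \<open>D\<close> may contain 0, but only as its first element; all later
    increments of \<open>s\<close> are positive.\<close>
  have pos: "0 < d (Suc n)" for n using strict_monoD[OF sm, of 0 "Suc n"] by simp
  have ssm: "strict_mono s" unfolding strict_mono_Suc_iff s_def using pos by simp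
  have tails: "\<exists>L. finite L \<and> Delta (range s - L) \<subseteq> FS (D - K)" if "finite K" for K
  proof -
    have "finite (d -` K)" using \<open>finite K\<close> inj by (rule finite_vimageI)
    then obtain N where N: "d -` K \<subseteq> {..<N}" using finite_nat_iff_bounded by blast
    have "Delta (range s - s ` {..<N}) \<subseteq> FS (D - K)"
    proof
      fix y assume "y \<in> Delta (range s - s ` {..<N})"
      then obtain i j where ij: "y = s i - s j" "s j < s i" "s j \<notin> s ` {..<N}" unfolding Delta_def by auto
      then have "j < i" "N \<le> j" using ssm by (auto simp: strict_mono_less not_less[symmetric])
      have "s i = (\<Sum>k\<in>{..<Suc j} \<union> {Suc j..i}. d k)"
        unfolding s_def by (rule sum.cong) (use \<open>j < i\<close> in auto)
      also have "\<dots> = s j + (\<Sum>k\<in>{Suc j..i}. d k)" unfolding s_def by (rule sum.union_disjoint) auto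
      finally have "y = (\<Sum>k\<in>{Suc j..i}. d k)" using ij(1) by simp
      also have "\<dots> \<in> FS (d ` {Suc j..i})" using \<open>j < i\<close> by (intro FS_image_I[OF inj]) auto
      also have "\<dots> \<subseteq> FS (D - K)"
      proof (rule FS_mono)
        show "d ` {Suc j..i} \<subseteq> D - K" using N dD \<open>N \<le> j\<close> by auto
      qed
      finally show "y \<in> FS (D - K)" .
    qed
    then show ?thesis by (intro exI[of _ "s ` {..<N}"]) simp
  qed
  have "\<forall>U. openin X U \<and> x \<in> U \<longrightarrow> (\<exists>L. finite L \<and> f ` Delta (range s - L) \<subseteq> U)"
    using x(2) tails by (meson image_mono subset_trans)
  moreover have "infinite (range s)" using ssm finite_imageD strict_mono_imp_inj_on by blast
  ultimately show "\<exists>D x. infinite D \<and> x \<in> topspace X \<and>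
      (\<forall>U. openin X U \<and> x \<in> U \<longrightarrow> (\<exists>K. finite K \<and> f ` Delta (D - K) \<subseteq> U))"
    using x(1) by (intro exI conjI)
qed

theorem corollary14p9:
  assumes "continuum_hypothesis"
  shows
    "(\<exists>(\<Lambda> :: nat set) \<A>. almost_disjoint_family \<Lambda> \<A> \<and> infinite \<A> \<and>
        Hausdorff_space (Phi_space \<Lambda> \<A>) \<and> compact_space (Phi_space \<Lambda> \<A>) \<and>
        separable_space (Phi_space \<Lambda> \<A>) \<and> topspace (Phi_space \<Lambda> \<A>) \<approx> (UNIV :: real set) \<and>
        Ramsey_space (Phi_space \<Lambda> \<A>) \<and> \<not> Hindman_space (Phi_space \<Lambda> \<A>)) \<and>
     (\<exists>(\<Lambda> :: nat set) \<A>. almost_disjoint_family \<Lambda> \<A> \<and> infinite \<A> \<and>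
        Hausdorff_space (Phi_space \<Lambda> \<A>) \<and> compact_space (Phi_space \<Lambda> \<A>) \<and>
        separable_space (Phi_space \<Lambda> \<A>) \<and> topspace (Phi_space \<Lambda> \<A>) \<approx> (UNIV :: real set) \<and>
        Hindman_space (Phi_space \<Lambda> \<A>) \<and> \<not> Ramsey_space (Phi_space \<Lambda> \<A>)) \<and>
     (\<exists>(\<Lambda> :: nat set) \<A>. almost_disjoint_family \<Lambda> \<A> \<and> infinite \<A> \<and>
        Hausdorff_space (Phi_space \<Lambda> \<A>) \<and> compact_space (Phi_space \<Lambda> \<A>) \<and>
        separable_space (Phi_space \<Lambda> \<A>) \<and> topspace (Phi_space \<Lambda> \<A>) \<approx> (UNIV :: real set) \<and>
        differentially_compact_space (Phi_space \<Lambda> \<A>) \<and> \<not> Hindman_space (Phi_space \<Lambda> \<A>)) \<and>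
     (\<exists>(\<Lambda> :: nat set) \<A>. almost_disjoint_family \<Lambda> \<A> \<and> infinite \<A> \<and>
        Hausdorff_space (Phi_space \<Lambda> \<A>) \<and> compact_space (Phi_space \<Lambda> \<A>) \<and>
        separable_space (Phi_space \<Lambda> \<A>) \<and> topspace (Phi_space \<Lambda> \<A>) \<approx> (UNIV :: real set) \<and>
        differentially_compact_space (Phi_space \<Lambda> \<A>) \<and> \<not> Ramsey_space (Phi_space \<Lambda> \<A>))"
  proof -
  obtain \<A> where A: "almost_disjoint_family (UNIV :: nat set) \<A>" "infinite \<A>" "Hausdorff_space (Phi_space UNIV \<A>)"
      "compact_space (Phi_space UNIV \<A>)" "separable_space (Phi_space UNIV \<A>)"
      "topspace (Phi_space UNIV \<A>) \<approx> (UNIV :: real set)"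
      "Ramsey_space (Phi_space UNIV \<A>)" "\<not> Hindman_space (Phi_space UNIV \<A>)"
    using pair_codes_FS.separating_space_exists[OF assms, folded
        Ramsey_space_iff_convergence_space Hindman_space_iff_convergence_space]
    by (elim exE conjE) (rule that)
  obtain \<B> where B: "almost_disjoint_family (UNIV :: nat set) \<B>" "infinite \<B>" "Hausdorff_space (Phi_space UNIV \<B>)"
      "compact_space (Phi_space UNIV \<B>)" "separable_space (Phi_space UNIV \<B>)"
      "topspace (Phi_space UNIV \<B>) \<approx> (UNIV :: real set)"
      "Hindman_space (Phi_space UNIV \<B>)" "\<not> Ramsey_space (Phi_space UNIV \<B>)"
    using FS_pair_codes.separating_space_exists[OF assms, folded
        Ramsey_space_iff_convergence_space Hindman_space_iff_convergence_space]
    by (elim exE conjE) (rule that)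
  show ?thesis
  proof (intro conjI, goal_cases)
    case 1
    show ?case using A by (intro exI[of _ UNIV] exI[of _ \<A>]) simp
  next
    case 2
    show ?case using B by (intro exI[of _ UNIV] exI[of _ \<B>]) simp
  next
    case 3
    show ?case using A Ramsey_space_imp_differentially_compact[OF A(7)]
      by (intro exI[of _ UNIV] exI[of _ \<A>]) simp
  next
    case 4
    show ?case using B Hindman_space_imp_differentially_compact[OF B(7)]
      by (intro exI[of _ UNIV] exI[of _ \<B>]) simp
  qed
qed

end
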